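(* For each $s>1$ there exist $N\in\mathbb{N}$ and a $\frac1s$-Hölder continuous map $g:[0,1]\to\mathbb{R}^N$ such that $\Gamma_s=g([0,1])$ satisfies $\mathcal{H}^s(\Gamma_s)>0$ and, for $\mathcal{H}^s$-almost every $x\in\Gamma_s$, the set $\mathrm{Tan}(\Gamma_s,x)$ contains infinitely many pairwise non-homeomorphic tangents.
   Context: For nonempty $A,B\subset\mathbb{R}^N$, $\mathrm{exc}(A,B)=\sup_{a\in A}\inf_{b\in B}|a-b|$. Nonempty closed sets $X_m\subset\mathbb{R}^N$ converge to a nonempty closed set $X$ in the Attouch–Wets topology if for every $r>0$, $\mathrm{exc}(X_m\cap\overline{B}(\mathbf{0},r),X)\to0$ and $\mathrm{exc}(X\cap\overline{B}(\mathbf{0},r),X_m)\to0$. For a closed set $X$ and $x\in X$, a closed set $T\ni\mathbf{0}$ is a tangent of $X$ at $x$ if $r_m^{-1}(X-x)\to T$ in the Attouch–Wets topology for some scales $r_m\downarrow0$; $\mathrm{Tan}(X,x)$ is the set of all such tangents. $\mathcal{H}^s$ is $s$-dimensional Hausdorff measure. *)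

theory Defs
  imports "HOL-Analysis.Analysis"
begin

text \<open>Euclidean space R^N, represented concretely as the functions nat => real
  vanishing at all indices >= N, with the Euclidean distance.  (The dimension N
  is existentially quantified in the theorem, so it cannot be a type.)\<close>

definition RN :: "nat \<Rightarrow> (nat \<Rightarrow> real) set" where
  "RN N = {x. \<forall>i\<ge>N. x i = 0}"

definition eucl_dist :: "nat \<Rightarrow> (nat \<Rightarrow> real) \<Rightarrow> (nat \<Rightarrow> real) \<Rightarrow> real" where
  "eucl_dist N x y = sqrt (\<Sum>i<N. (x i - y i)^2)"

definition eucl_top :: "nat \<Rightarrow> (nat \<Rightarrow> real) topology" where
  "eucl_top N = Metric_space.mtopology (RN N) (eucl_dist N)"

definition closed_ball0 :: "nat \<Rightarrow> real \<Rightarrow> (nat \<Rightarrow> real) set" where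
  "closed_ball0 N r = {y \<in> RN N. eucl_dist N (\<lambda>i. 0) y \<le> r}"

text \<open>Excess exc(A,B) = sup_{a in A} inf_{b in B} |a-b|, valued in [0,\<infinity>];
  for A empty this is 0 (the natural convention, needed when X_m \<inter> B(0,r) is empty).\<close>
definition exc :: "nat \<Rightarrow> (nat \<Rightarrow> real) set \<Rightarrow> (nat \<Rightarrow> real) set \<Rightarrow> ennreal" where
  "exc N A B = (SUP a\<in>A. INF b\<in>B. ennreal (eucl_dist N a b))"

definition AW_converges ::
  "nat \<Rightarrow> (nat \<Rightarrow> (nat \<Rightarrow> real) set) \<Rightarrow> (nat \<Rightarrow> real) set \<Rightarrow> bool" where
  "AW_converges N Xs X \<longleftrightarrow>
     (\<forall>m. Xs m \<noteq> {} \<and> closedin (eucl_top N) (Xs m)) \<and>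
     X \<noteq> {} \<and> closedin (eucl_top N) X \<and>
     (\<forall>r>0. ((\<lambda>m. exc N (Xs m \<inter> closed_ball0 N r) X) \<longlongrightarrow> 0) sequentially \<and>
            ((\<lambda>m. exc N (X \<inter> closed_ball0 N r) (Xs m)) \<longlongrightarrow> 0) sequentially)"

definition blowup :: "(nat \<Rightarrow> real) set \<Rightarrow> (nat \<Rightarrow> real) \<Rightarrow> real \<Rightarrow> (nat \<Rightarrow> real) set" where
  "blowup X x r = (\<lambda>y. (\<lambda>i. (y i - x i) / r)) ` X"

definition Tan :: "nat \<Rightarrow> (nat \<Rightarrow> real) set \<Rightarrow> (nat \<Rightarrow> real) \<Rightarrow> (nat \<Rightarrow> real) set set" where
  "Tan N X x = {T. closedin (eucl_top N) T \<and> (\<lambda>i. 0) \<in> T \<and>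
      (\<exists>r::nat \<Rightarrow> real. (\<forall>m. r m > 0) \<and> decseq r \<and> r \<longlonglongrightarrow> 0 \<and>
          AW_converges N (\<lambda>m. blowup X x (r m)) T)}"

text \<open>Diameter (in [0,\<infinity>]) and s-dimensional Hausdorff (outer) measure in R^N,
  H^s = lim_{\<delta>\<rightarrow>0} H^s_\<delta> (normalisation constant omitted; irrelevant for the
  statement, which only concerns positivity and null sets).\<close>
definition ediam :: "nat \<Rightarrow> (nat \<Rightarrow> real) set \<Rightarrow> ennreal" where
  "ediam N U = (SUP x\<in>U. SUP y\<in>U. ennreal (eucl_dist N x y))"

definition hausdorff_pre :: "nat \<Rightarrow> real \<Rightarrow> real \<Rightarrow> (nat \<Rightarrow> real) set \<Rightarrow> ennreal" where
  "hausdorff_pre N s \<delta> E =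
     (INF U\<in>{U :: nat \<Rightarrow> (nat \<Rightarrow> real) set. E \<subseteq> (\<Union>i. U i) \<and> (\<forall>i. U i \<subseteq> RN N) \<and>
                 (\<forall>i. ediam N (U i) \<le> ennreal \<delta>)}.
        (\<Sum>i. ennreal (enn2real (ediam N (U i)) powr s)))"

definition hausdorff :: "nat \<Rightarrow> real \<Rightarrow> (nat \<Rightarrow> real) set \<Rightarrow> ennreal" where
  "hausdorff N s E = (SUP \<delta>\<in>{0<..}. hausdorff_pre N s \<delta> E)"

end

theory Submission
  imports Defs "HOL-Complex_Analysis.Great_Picard"
begin

text \<open>
  Fix a large integer \<open>b\<close> and put \<open>\<lambda> = b powr (-1/s)\<close>. Starting from an edge, every edge of level \<open>k\<close>
  is replaced by a path of \<open>b\<close> edges of level \<open>k + 1\<close>, whose new vertices are pushed by \<open>\<lambda>^(k+1)\<close>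
  in fresh coordinate directions; the limit is a snowflake arc, on which \<open>|g t - g u|\<close> is comparable to
  \<open>|t - u| powr (1/s)\<close>. At selected edges one of the \<open>b\<close> children is closed up to a loop while the other
  \<open>b - 1\<close> cover the whole displacement of the parent. The number of edges of each level is unchanged, so
  Lebesgue measure on \<open>[0,1]\<close> is still carried to a measure comparable to \<open>H\<^sup>s\<close>.

  The levels are cut into windows of slowly growing length \<open>K w\<close>. At the end of window \<open>w\<close> every block of
  \<open>b ^ K w\<close> consecutive edges receives one cluster of \<open>n w\<close> consecutive loops. Around
  a point that sits at the cluster, the curve looks at that scale like a long snowflake line carrying \<open>n w\<close> loops,
  and as \<open>K w\<close> tends to infinity a tangent arises that is a line with exactly \<open>n w\<close> loops. Since the sum of
  \<open>1 / b ^ K w\<close> over the windows with \<open>n w = \<nu>\<close> diverges, almost every point sits at such clusters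
  infinitely often, for every \<open>\<nu>\<close>. The number of loops is a topological invariant: the base points of the
  loops are the points whose complement is not a union of two connected sets.
\<close>

subsection \<open>The tree of edges and its loops\<close>

text \<open>The obstacle is the lower bound: points on non-adjacent edges of level \<open>k\<close>
  must stay \<open>lam ^ k / 4\<close> apart, in a dimension fixed in advance, although loops make
  different parts of the curve touch. Finitely many coordinates suffice because only vertices with
  adjacent parent edges have to be told apart on their own level; all other pairs were separated on
  a coarser one. So a coordinate is indexed by the level modulo \<open>M\<close>, a proper colouring
  of the parent edges and the digit of the vertex. These estimates hold for an arbitrary loop
  pattern \<open>L\<close>, which can therefore be chosen purely for the sake of the tangents. The
  lower bound serves three times: for positive measure, for properness of the tangent curve, and for
  excluding contacts other than the loops. Divergence is compatible with unbounded
  \<open>K w\<close> because \<open>K w\<close> may grow like the logarithm of \<open>w\<close> to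
  base \<open>b\<close>. With \<open>n w\<close> the 2-adic valuation of \<open>w + 1\<close>, every
  \<nu> occurs along an arithmetic progression, and a harmonic series remains.\<close>

text \<open>
  The edge \<open>i\<close> of level \<open>k\<close> joins the vertices \<open>i\<close> and \<open>i + 1\<close> and has the children \<open>b * i, ..., b * i + b - 1\<close>
  of level \<open>k + 1\<close>. If \<open>L k q\<close> holds, then the child \<open>b * q + 2\<close> of \<open>q\<close> is a loop: its end points
  \<open>b * q + 2\<close> and \<open>b * q + 3\<close> are identified.
\<close>

locale loop_tree =
  fixes b :: int and L :: "nat \<Rightarrow> int \<Rightarrow> bool"
  assumes b_ge: "17 \<le> b"
begin

lemma b_pos: "0 < b" and b_nz: "b \<noteq> 0"
  using b_ge by auto

lemma div_mult_add [simp]: "0 \<le> r \<Longrightarrow> r < b \<Longrightarrow> (b * q + r) div b = q"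
  using b_ge by simp

lemma mod_mult_add [simp]: "0 \<le> r \<Longrightarrow> r < b \<Longrightarrow> (b * q + r) mod b = r"
  using b_ge by simp

lemma int_digit_cases:
  obtains q r where "j = b * q + r" "0 \<le> r" "r < b"
  by (rule that[of "j div b" "j mod b"]) (use b_pos in auto)

text \<open>Gluing is encoded by a normal form instead of a quotient: two vertices are identified
  exactly when their \<open>rep\<close> agree.\<close>

primrec rep :: "nat \<Rightarrow> int \<Rightarrow> int" where
  "rep 0 j = j"
| "rep (Suc k) j = (if j mod b = 0 then b * rep k (j div b)
     else if j mod b = 3 \<and> L k (j div b) then j - 1 else j)"

text \<open>
  The parity of the number of loops around an edge separates the strands that meet at an identified vertex:
  residues modulo \<open>b\<close> alone would not distinguish the beginning of a loop from the edge that leaves it.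
\<close>

primrec parity :: "nat \<Rightarrow> int \<Rightarrow> bool" where
  "parity 0 i = False"
| "parity (Suc k) i = (parity k (i div b) \<noteq> (i mod b = 2 \<and> L k (i div b)))"

definition adj :: "nat \<Rightarrow> int \<Rightarrow> int \<Rightarrow> bool" where
  "adj k i i' \<longleftrightarrow> (\<exists>j\<in>{i, i + 1}. \<exists>j'\<in>{i', i' + 1}. rep k j = rep k j')"

lemma adj_refl: "adj k i i"
  by (auto simp: adj_def)

lemma adj_sym: "adj k i i' \<Longrightarrow> adj k i' i"
  unfolding adj_def by metis

lemma rep_old: "rep (Suc k) (b * q) = b * rep k q"
  using b_pos by simp

lemma rep_new: "0 < r \<Longrightarrow> r < b \<Longrightarrow>
  rep (Suc k) (b * q + r) = (if r = 3 \<and> L k q then b * q + 2 else b * q + r)"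
  by simp

lemma not_dvd_add: "0 < r \<Longrightarrow> r < b \<Longrightarrow> b * x \<noteq> b * q + r"
  by (metis b_pos mod_mult_add mod_mult_self1_is_0 less_irrefl order_less_imp_le)

lemma not_dvd_digit [simp]: "0 < r \<Longrightarrow> r < b \<Longrightarrow> \<not> b dvd b * q + r"
  by (metis dvdE not_dvd_add)

lemma digits_eq: "0 \<le> r \<Longrightarrow> r < b \<Longrightarrow> 0 \<le> r' \<Longrightarrow> r' < b \<Longrightarrow>
   b * q + r = b * q' + r' \<longleftrightarrow> q = q' \<and> r = r'"
  by (metis div_mult_add mod_mult_add)

text \<open>Representatives of old vertices are multiples of \<open>b\<close>, those of new vertices
  are not, and among new vertices only digit 3 is folded, onto digit 2 of the same parent. Hence a
  coincidence is inherited, trivial, or given by the two ends of one loop.\<close>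

lemma rep_Suc_eq_cases:
  assumes "rep (Suc k) j = rep (Suc k) j'"
  obtains (old) q q' where "j = b * q" "j' = b * q'" "rep k q = rep k q'"
    | (same) "j = j'"
    | (loop) q where "L k q" "{j, j'} = {b * q + 2, b * q + 3}"
proof -
  obtain q r where j: "j = b * q + r" "0 \<le> r" "r < b" by (rule int_digit_cases)
  obtain q' r' where j': "j' = b * q' + r'" "0 \<le> r'" "r' < b" by (rule int_digit_cases)
  have b3: "3 < b" using b_ge by simp
  consider "r = 0" "r' = 0" | "r = 0" "r' > 0" | "r > 0" "r' = 0" | "r > 0" "r' > 0"
    using j j' by linarith
  then show thesis
  proof cases
    case 1
    then show thesis using assms j j' old[of q q'] rep_old b_nz by auto
  next
    case 2
    have A: "rep (Suc k) j = b * rep k q" using 2 j rep_old[of k q] by simp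
    have B: "rep (Suc k) j' = (if r' = 3 \<and> L k q' then b * q' + 2 else b * q' + r')"
      unfolding j' using 2 j' by (intro rep_new)
    have "b * rep k q = (if r' = 3 \<and> L k q' then b * q' + 2 else b * q' + r')"
      using A B assms by presburger
    then have False using not_dvd_add[of 2 "rep k q" q'] not_dvd_add[of r' "rep k q" q'] 2 j' b3
      by (cases "r' = 3 \<and> L k q'") auto
    then show thesis ..
  next
    case 3
    have A: "rep (Suc k) j' = b * rep k q'" using 3 j' rep_old[of k q'] by simp
    have B: "rep (Suc k) j = (if r = 3 \<and> L k q then b * q + 2 else b * q + r)"
      unfolding j using 3 j by (intro rep_new)
    have "b * rep k q' = (if r = 3 \<and> L k q then b * q + 2 else b * q + r)"
      using A B assms by presburger
    then have False using not_dvd_add[of 2 "rep k q'" q] not_dvd_add[of r "rep k q'" q] 3 j b3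
      by (cases "r = 3 \<and> L k q") auto
    then show thesis ..
  next
    case 4
    have e: "(if r = 3 \<and> L k q then b * q + 2 else b * q + r)
       = (if r' = 3 \<and> L k q' then b * q' + 2 else b * q' + r')"
      using assms 4 j j' rep_new by simp
    show thesis
    proof (cases "r = 3 \<and> L k q")
      case T: True
      show thesis
      proof (cases "r' = 3 \<and> L k q'")
        case True
        then show thesis using T e j j' same digits_eq[of 2 2 q q'] b3 by simp
      next
        case False
        with T e j' digits_eq[of 2 r' q q'] b3 have "q = q'" "r' = 2" by auto
        then show thesis using T j j' loop[of q] by auto
      qed
    next
      case F: False
      show thesis
      proof (cases "r' = 3 \<and> L k q'")
        case True
        with F e j digits_eq[of r 2 q q'] b3 have "q = q'" "r = 2" by auto
        then show thesis using True j j' loop[of q] by auto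
      next
        case False
        then have "j = j'" using F e j j' by argo
        then show thesis by (rule same)
      qed
    qed
  qed
qed

text \<open>Separates the strands that leave a glued vertex. An inherited coincidence passes the
  property on because the child with digit 0 keeps the parity of its parent; at a fresh loop the
  leaving edges are the children 2 and 3, and only child 2 flips.\<close>

lemma rep_eq_parity_out:
  assumes "rep k p = rep k p'" "p \<noteq> p'"
  shows "parity k p \<noteq> parity k p'"
  using assms
proof (induction k arbitrary: p p')
  case 0
  then show ?case by simp
next
  case (Suc k)
  from Suc.prems(1) show ?case
  proof (cases rule: rep_Suc_eq_cases)
    case (old q q')
    then show ?thesis using Suc b_nz by auto
  next
    case same
    then show ?thesis using Suc.prems by simp
  next
    case (loop q)
    then show ?thesis using b_ge by (auto simp: doubleton_eq_iff)
  qed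
qed

lemma pred_old: "b * q - 1 = b * (q - 1) + (b - 1)"
  by (simp add: algebra_simps)

lemma parity_pred_old: "parity (Suc k) (b * q - 1) = parity k (q - 1)"
proof -
  have "(b * q - 1) div b = q - 1" "(b * q - 1) mod b = b - 1"
    unfolding pred_old by (rule div_mult_add mod_mult_add; use b_ge in simp)+
  then show ?thesis using b_ge by simp
qed

text \<open>The mirror image for entering strands: the edge entering an old vertex is a last child,
  which keeps the parity of its parent, and the edges entering the two ends of a loop are the
  children 1 and 2.\<close>

lemma rep_eq_parity_in:
  assumes "rep k p = rep k p'" "p \<noteq> p'"
  shows "parity k (p - 1) \<noteq> parity k (p' - 1)"
  using assms
proof (induction k arbitrary: p p')
  case 0
  then show ?case by simp
next
  case (Suc k)
  from Suc.prems(1) show ?case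
  proof (cases rule: rep_Suc_eq_cases)
    case (old q q')
    then show ?thesis using Suc by (metis parity_pred_old)
  next
    case same
    then show ?thesis using Suc.prems by simp
  next
    case (loop q)
    have "b * q + 2 - 1 = b * q + 1" "b * q + 3 - 1 = b * q + 2" by simp_all
    moreover have "parity (Suc k) (b * q + 1) = parity k q"
      "parity (Suc k) (b * q + 2) \<noteq> parity k q"
      using loop b_ge by simp_all
    ultimately have "parity (Suc k) (b * q + 2 - 1) = parity k q"
      "parity (Suc k) (b * q + 3 - 1) \<noteq> parity k q" by metis+
    moreover have "p = b * q + 2 \<and> p' = b * q + 3 \<or> p = b * q + 3 \<and> p' = b * q + 2"
      using loop(2) by (simp only: doubleton_eq_iff)
    ultimately show ?thesis by metis
  qed
qed

text \<open>Continuation along the curve is seen by the digit alone: consecutive edges, the passage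
  from digit \<open>b - 1\<close> to 0 at an old vertex, and the passage from digit 1 to 3 that
  skips a loop. The loop edge itself ends where it starts and is ruled out by
  \<open>i \<noteq> i'\<close>.\<close>

lemma rep_succ_mod:
  assumes "rep k (i + 1) = rep k i'" "i \<noteq> i'"
  shows "i mod b \<noteq> i' mod b"
proof (cases k)
  case 0
  then have "i' = i + 1" using assms by simp
  moreover have "\<not> b dvd 1" using b_ge zdvd_not_zless[of 1 b] by auto
  ultimately show ?thesis by (metis add_diff_cancel_left' mod_eq_dvd_iff)
next
  case (Suc k')
  have nn: "\<not> (b dvd 1)" using b_ge zdvd_not_zless[of 1 b] by auto
  from assms(1)[unfolded Suc] show ?thesis
  proof (cases rule: rep_Suc_eq_cases)
    case (old q q')
    then have "i = b * q - 1" by simp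
    then have i: "i = b * (q - 1) + (b - 1)" by (simp add: algebra_simps)
    have "i mod b = b - 1" unfolding i by (rule mod_mult_add) (use b_ge in simp)+
    then show ?thesis using old(2) b_ge by simp
  next
    case same
    then show ?thesis using nn by (metis add_diff_cancel_left' mod_eq_dvd_iff)
  next
    case (loop q)
    then consider "i + 1 = b * q + 2" "i' = b * q + 3" | "i + 1 = b * q + 3" "i' = b * q + 2"
      by (auto simp: doubleton_eq_iff)
    then show ?thesis
    proof cases
      case 1
      then have "i = b * q + 1" by simp
      then show ?thesis using 1 b_ge by simp
    next
      case 2
      then show ?thesis using assms by simp
    qed
  qed
qed

text \<open>Parity and last digit form a proper colouring of the adjacency graph: parity settles a
  common start or a common end, the digit settles an end that meets a start.\<close>

lemma adj_edge_colour:
  assumes "adj k i i'" "parity k i = parity k i'" "i mod b = i' mod b"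
  shows "i = i'"
proof (rule ccontr)
  assume ne: "i \<noteq> i'"
  from assms(1) consider "rep k i = rep k i'" | "rep k (i + 1) = rep k (i' + 1)"
    | "rep k (i + 1) = rep k i'" | "rep k (i' + 1) = rep k i"
    unfolding adj_def by fastforce
  then show False
  proof cases
    case 1 then show False using rep_eq_parity_out ne assms by blast
  next
    case 2 then show False using rep_eq_parity_in[of k "i + 1" "i' + 1"] ne assms by simp
  next
    case 3 then show False using rep_succ_mod ne assms by blast
  next
    case 4 then show False using rep_succ_mod ne assms by metis
  qed
qed

section \<open>Passage to the parent level and bounded degree\<close>

lemma vertex_div:
  assumes "j \<in> {i, i + 1}"
  shows "j div b = i div b \<or> (j = b * (i div b + 1))"
proof -
  obtain q r where j: "i = b * q + r" "0 \<le> r" "r < b" by (rule int_digit_cases)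
  have "(i + 1) div b = q" if "r + 1 < b"
    using j that div_mult_add[of "r + 1" q] by (simp add: add.assoc)
  moreover have "i + 1 = b * (q + 1)" if "\<not> r + 1 < b"
    using j that by (simp add: algebra_simps)
  ultimately show ?thesis using assms j by auto
qed

lemma vertex_old:
  assumes "j \<in> {i, i + 1}" "j = b * a"
  shows "a \<in> {i div b, i div b + 1}"
  using vertex_div[OF assms(1)] assms(2) b_nz by auto

lemma vertex_new:
  assumes "j \<in> {i, i + 1}" "j mod b \<noteq> 0"
  shows "j div b = i div b"
  using vertex_div[OF assms(1)] assms(2) by auto

lemma adj_parent:
  assumes "adj (Suc k) i i'"
  shows "adj k (i div b) (i' div b)"
proof -
  from assms obtain j j' where j: "j \<in> {i, i + 1}" "j' \<in> {i', i' + 1}" "rep (Suc k) j = rep (Suc k) j'"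
    unfolding adj_def by blast
  from j(3) show ?thesis
  proof (cases rule: rep_Suc_eq_cases)
    case (old q q')
    then show ?thesis using vertex_old j unfolding adj_def by metis
  next
    case same
    then show ?thesis
    proof (cases "j mod b = 0")
      case True
      then obtain a where "j = b * a" by auto
      then show ?thesis using same vertex_old j unfolding adj_def by metis
    next
      case False
      then show ?thesis using same vertex_new j adj_refl by metis
    qed
  next
    case (loop q)
    then have "j mod b \<noteq> 0" "j' mod b \<noteq> 0" "j div b = j' div b"
      using b_ge by (auto simp: doubleton_eq_iff)
    then show ?thesis using vertex_new j adj_refl by metis
  qed
qed

text \<open>If one end of an edge is old, the other has digit 1 or \<open>b - 1\<close> and is never
  glued to another vertex. Contact through these other ends makes them equal, so the old ends differ
  by 0 or 2, and 2 is not a multiple of \<open>b\<close>.\<close>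

lemma adj_common_old:
  assumes "adj (Suc k) q q'" "b * a \<in> {q, q + 1}" "b * a' \<in> {q', q' + 1}"
  shows "rep (Suc k) (b * a) = rep (Suc k) (b * a')"
proof -
  have near: "(\<exists>c. J = b * c + 1) \<or> (\<exists>c. J = b * c + (b - 1))" 
    if "J \<in> {q, q + 1}" "b * a \<in> {q, q + 1}" "J \<noteq> b * a" for J q a
  proof -
    from that have "J = b * a + 1 \<or> J = b * (a - 1) + (b - 1)" by (auto simp: algebra_simps)
    then show ?thesis by blast
  qed
  have new: "rep (Suc k) J = J \<and> (\<forall>x. J \<noteq> b * x)" 
    if "J \<in> {q, q + 1}" "b * a \<in> {q, q + 1}" "J \<noteq> b * a" for J q a
  proof -
    from near[OF that] obtain c r where J: "J = b * c + r" and r: "r = 1 \<or> r = b - 1" by blast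
    have r': "0 < r" "r < b" "r \<noteq> 3" using r b_ge by auto
    show ?thesis unfolding J using rep_new[OF r'(1,2)] not_dvd_add[OF r'(1,2)] r' by metis
  qed
  from assms obtain J J' where J: "J \<in> {q, q + 1}" "J' \<in> {q', q' + 1}" "rep (Suc k) J = rep (Suc k) J'"
    unfolding adj_def by blast
  consider "J = b * a" "J' = b * a'" | "J = b * a" "J' \<noteq> b * a'" | "J \<noteq> b * a" "J' = b * a'"
    | "J \<noteq> b * a" "J' \<noteq> b * a'" by blast
  then show ?thesis
  proof cases
    case 1 then show ?thesis using J by simp
  next
    case 2 then show ?thesis using new[OF J(2) assms(3)] J rep_old by metis
  next
    case 3 then show ?thesis using new[OF J(1) assms(2)] J rep_old by metis
  next
    case 4
    then have "J = J'" using new[OF J(2) assms(3)] new[OF J(1) assms(2)] J by simp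
    moreover have "b * a = J + 1 \<or> b * a = J - 1" "b * a' = J' + 1 \<or> b * a' = J' - 1"
      using J assms 4 by auto
    moreover have "b * a - b * a' \<noteq> 2" "b * a' - b * a \<noteq> 2"
      using not_dvd_add[of 2 "a - a'" 0] not_dvd_add[of 2 "a' - a" 0] b_ge
      by (simp_all add: right_diff_distrib)
    ultimately have "b * a = b * a'" by linarith
    then show ?thesis by presburger
  qed
qed

text \<open>Identifications do not accumulate: an old vertex inherits its class, and a new vertex
  gains at most one partner.\<close>

lemma card_rep_class: "finite {j. rep k j = R} \<and> card {j. rep k j = R} \<le> 2"
proof (induction k arbitrary: R)
  case 0
  then show ?case by simp
next
  case (Suc k)
  show ?case
  proof (cases "\<exists>x. rep (Suc k) x = R")
    case False
    then show ?thesis by simp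
  next
    case True
    then obtain x where x: "rep (Suc k) x = R" by blast
    show ?thesis
    proof (cases "x mod b = 0")
      case True
      then obtain q where q: "x = b * q" by auto
      have "{j. rep (Suc k) j = R} \<subseteq> (*) b ` {j. rep k j = rep k q}"
      proof
        fix j assume "j \<in> {j. rep (Suc k) j = R}"
        then have "rep (Suc k) j = rep (Suc k) x" using x by simp
        then show "j \<in> (*) b ` {j. rep k j = rep k q}"
        proof (cases rule: rep_Suc_eq_cases)
          case (old y y')
          then show ?thesis using q b_nz by auto
        next
          case same
          then show ?thesis using q by auto
        next
          case (loop y)
          then show ?thesis using q not_dvd_add[of 2 q y] not_dvd_add[of 3 q y] b_ge by (auto simp: doubleton_eq_iff)
        qed
      qed
      moreover have "finite ((*) b ` {j. rep k j = rep k q})" "card ((*) b ` {j. rep k j = rep k q}) \<le> 2"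
        using Suc[of "rep k q"] card_image_le[of "{j. rep k j = rep k q}" "(*) b"] by auto
      ultimately show ?thesis using finite_subset card_mono by (metis le_trans)
    next
      case False
      have "j \<in> {x, if x mod b = 2 then x + 1 else x - 1}" if "rep (Suc k) j = R" for j
      proof -
        from that x have "rep (Suc k) j = rep (Suc k) x" by simp
        then show ?thesis
        proof (cases rule: rep_Suc_eq_cases)
          case (old y y')
          then show ?thesis using False by auto
        next
          case same
          then show ?thesis by auto
        next
          case (loop y)
          then show ?thesis using b_ge by (auto simp: doubleton_eq_iff)
        qed
      qed
      then have sub: "{j. rep (Suc k) j = R} \<subseteq> {x, if x mod b = 2 then x + 1 else x - 1}" by blast
      have "card {x, y} \<le> 2" for y :: int by (simp add: card_insert_if)
      then show ?thesis using card_mono[OF _ sub] finite_subset[OF sub] le_trans by blast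
    qed
  qed
qed

text \<open>The 8 counts two ends, at most two vertices in the class of each, and two edges at each
  vertex.\<close>

lemma card_adj: "finite {i'. adj k i i'} \<and> card {i'. adj k i i'} \<le> 8"
proof -
  define C where "C j = {j'. rep k j' = rep k j}" for j
  define S where "S = C i \<union> C (i + 1)"
  have C: "finite (C j)" "card (C j) \<le> 2" for j
    using card_rep_class[of k "rep k j"] unfolding C_def by auto
  have S: "finite S" "card S \<le> 4"
    using C[of i] C[of "i + 1"] card_Un_le[of "C i" "C (i + 1)"] unfolding S_def by auto
  have "{i'. adj k i i'} \<subseteq> S \<union> (\<lambda>j. j - 1) ` S"
  proof
    fix i' assume "i' \<in> {i'. adj k i i'}"
    then have "i' \<in> S \<or> i' + 1 \<in> S" unfolding S_def C_def adj_def by auto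
    then show "i' \<in> S \<union> (\<lambda>j. j - 1) ` S" by force
  qed
  moreover have "finite (S \<union> (\<lambda>j. j - 1) ` S)" using S by simp
  moreover have "card (S \<union> (\<lambda>j. j - 1) ` S) \<le> 8"
    using card_Un_le[of S "(\<lambda>j. j - 1) ` S"] card_image_le[OF S(1), of "\<lambda>j. j - 1"] S by linarith
  ultimately show ?thesis by (meson card_mono finite_subset le_trans)
qed

end

subsection \<open>The curve\<close>

type_synonym coord = "nat \<times> bool \<times> int \<times> int"

lemma geometric_increments:
  fixes x :: "nat \<Rightarrow> real"
  assumes "0 < l" "l < 1" and inc: "\<And>m. \<bar>x (Suc m) - x m\<bar> \<le> C * l ^ m"
  shows "convergent x" and "\<bar>lim x - x m\<bar> \<le> C / (1 - l) * l ^ m"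
proof -
  have sm: "summable (\<lambda>i. C * l ^ (m + i))" for m
    using assms by (simp add: power_add summable_mult summable_geometric)
  have sum: "summable (\<lambda>i. x (Suc (m + i)) - x (m + i))" for m
    by (rule summable_comparison_test'[OF sm[of m], of 0]) (use inc in \<open>auto simp: real_norm_def\<close>)
  have tel: "(\<Sum>i<n. x (Suc (m + i)) - x (m + i)) = x (m + n) - x m" for m n
    by (induction n) auto
  have lim: "(\<lambda>n. x (m + n)) \<longlonglongrightarrow> x m + (\<Sum>i. x (Suc (m + i)) - x (m + i))" for m
  proof -
    have "(\<lambda>n. x m + (\<Sum>i<n. x (Suc (m + i)) - x (m + i)))
       \<longlonglongrightarrow> x m + (\<Sum>i. x (Suc (m + i)) - x (m + i))"
      by (intro tendsto_add tendsto_const summable_LIMSEQ sum)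
    then show ?thesis by (simp add: tel)
  qed
  show conv: "convergent x" using lim[of 0] by (auto simp: convergent_def)
  have "x \<longlonglongrightarrow> x m + (\<Sum>i. x (Suc (m + i)) - x (m + i))"
    using lim[of m] LIMSEQ_offset[of x m] by (simp add: add.commute)
  then have "lim x - x m = (\<Sum>i. x (Suc (m + i)) - x (m + i))"
    using limI by fastforce
  also have "\<bar>\<dots>\<bar> \<le> (\<Sum>i. C * l ^ (m + i))"
  proof -
    have ab: "summable (\<lambda>i. \<bar>x (Suc (m + i)) - x (m + i)\<bar>)"
      by (rule summable_comparison_test'[OF sm[of m], of 0]) (use inc in \<open>auto simp: real_norm_def\<close>)
    have "\<bar>\<Sum>i. x (Suc (m + i)) - x (m + i)\<bar> \<le> (\<Sum>i. \<bar>x (Suc (m + i)) - x (m + i)\<bar>)"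
      by (rule summable_rabs[OF ab])
    also have "\<dots> \<le> (\<Sum>i. C * l ^ (m + i))"
      by (rule suminf_le[OF _ ab sm]) (use inc in auto)
    finally show ?thesis .
  qed
  also have "\<dots> = C / (1 - l) * l ^ m"
    using assms suminf_geometric[of l] suminf_mult[of "\<lambda>i. l ^ i" "C * l ^ m"] 
    by (simp add: power_add summable_geometric mult.assoc) 
  finally show "\<bar>lim x - x m\<bar> \<le> C / (1 - l) * l ^ m" .
qed

lemma interp_ge:
  fixes a :: real
  assumes "0 \<le> a" "a \<le> 1" "c \<le> x" "c \<le> y"
  shows "c \<le> x + a * (y - x)"
proof -
  have "0 \<le> (1 - a) * (x - c) + a * (y - c)" using assms by simp
  then show ?thesis by (simp add: algebra_simps)
qed

lemma interp_le:
  fixes a :: real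
  assumes "0 \<le> a" "a \<le> 1" "x \<le> c" "y \<le> c"
  shows "x + a * (y - x) \<le> c"
  using interp_ge[of a "-c" "-x" "-y"] assms by (simp add: algebra_simps)

text \<open>By \<open>lam_b\<close>, subdivision, which shrinks differences by a factor of at least
  \<open>b - 1\<close>, beats the scale factor by 2 per level. \<open>M_pow\<close> then reduces
  what is left of the previous use of a coordinate, \<open>M\<close> levels earlier, to a sixteenth
  of the present displacement; \<open>M_tail\<close> does the same for everything from the next use
  on.\<close>

locale loop_curve = loop_tree +
  fixes lam :: real and M :: nat
  assumes lam_pos: "0 < lam" and lam_less: "lam < 1" and lam_b: "2 \<le> lam * (b - 1)"
    and M_ge: "2 \<le> M" and M_pow: "32 * (b - 1) \<le> 2 ^ M"
    and M_tail: "3 / (1 - lam) * lam ^ (M - 1) \<le> 1 / 16"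
begin

text \<open>
  The vertex \<open>b * q + r\<close> is placed at the proportion \<open>wt k q r\<close> of the parent edge \<open>q\<close>, and is then moved
  in the coordinate \<open>key\<close> of its own. Coordinates are reused every \<open>M\<close> levels; \<open>M\<close> is so large that the
  influence of other levels on the coordinates of one level is negligible.
\<close>

definition wt :: "nat \<Rightarrow> int \<Rightarrow> int \<Rightarrow> real" where
  "wt k q r = (if L k q then (if r \<le> 2 then r else r - 1) / (b - 1) else r / b)"

text \<open>The two middle components are the colour of the parent edge from
  \<open>adj_edge_colour\<close>. Digit 3 is folded to 2 at a loop so that both ends of the loop
  receive the same displacement.\<close>

primrec key :: "nat \<Rightarrow> int \<Rightarrow> coord" where
  "key 0 j = (0, False, (j div b) mod b, j mod b)"
| "key (Suc k) j = (Suc k mod M, parity k (j div b), (j div b) mod b,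
     if j mod b = 3 \<and> L k (j div b) then 2 else j mod b)"

definition bump :: "nat \<Rightarrow> int \<Rightarrow> coord \<Rightarrow> real" where
  "bump k j z = (if j mod b \<noteq> 0 \<and> z = key k j then 1 else 0)"

primrec v :: "nat \<Rightarrow> int \<Rightarrow> coord \<Rightarrow> real" where
  "v 0 j z = bump 0 j z"
| "v (Suc k) j z = v k (j div b) z + wt k (j div b) (j mod b) * (v k (j div b + 1) z - v k (j div b) z)
     + lam ^ Suc k * bump (Suc k) j z"

definition interp :: "nat \<Rightarrow> int \<Rightarrow> int \<Rightarrow> coord \<Rightarrow> real" where
  "interp k q r z = v k q z + wt k q r * (v k (q + 1) z - v k q z)"

definition coords :: "coord set" where
  "coords = {..<M} \<times> UNIV \<times> {0..<b} \<times> {0..<b}"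

text \<open>The curve is defined for all real \<open>t\<close>, not only on the unit interval; this
  lets the zooms below be functions on the whole line.\<close>

definition G :: "real \<Rightarrow> coord \<Rightarrow> real" where
  "G t z = lim (\<lambda>m. v m \<lfloor>t * real_of_int b ^ m\<rfloor> z)"

definition edge :: "nat \<Rightarrow> int \<Rightarrow> real set" where
  "edge k i = {i / real_of_int b ^ k .. (i + 1) / real_of_int b ^ k}"

abbreviation K1 :: real where "K1 \<equiv> 3 / (1 - lam)"

section \<open>Vertex displacements and convergence to the curve\<close>

lemma b_real: "17 \<le> real_of_int b"
  using b_ge by linarith

lemma lam_pow_pos [simp]: "0 < lam ^ k"
  using lam_pos by simp

lemma wt_0 [simp]: "wt k q 0 = 0"
  by (simp add: wt_def)

lemma wt_b [simp]: "wt k q b = 1"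
  using b_ge by (simp add: wt_def)

lemma wt_ge: "0 \<le> r \<Longrightarrow> 0 \<le> wt k q r"
  using b_ge by (simp add: wt_def)

lemma wt_le: "r \<le> b \<Longrightarrow> wt k q r \<le> 1"
  using b_ge by (auto simp: wt_def divide_simps)

lemma wt_step: "\<bar>wt k q (r + 1) - wt k q r\<bar> \<le> 1 / (b - 1)"
proof -
  have "1 / real_of_int b \<le> 1 / (b - 1)" using b_real by (intro divide_left_mono) auto
  then show ?thesis using b_real by (auto simp: wt_def diff_divide_distrib[symmetric] add_divide_distrib)
qed

lemma fst_key: "fst (key k j) = k mod M"
  using M_ge by (cases k) auto

lemma key_coords: "key k j \<in> coords"
  using b_ge M_ge by (cases k) (auto simp: coords_def)

lemma finite_coords: "finite coords"
  by (simp add: coords_def)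

lemma bump_bounds: "0 \<le> bump k j z" "bump k j z \<le> 1"
  by (auto simp: bump_def)

lemma bump_other: "fst z \<noteq> k mod M \<Longrightarrow> bump k j z = 0"
  using fst_key by (auto simp: bump_def)

text \<open>Also covers \<open>r = b\<close>: there the weight is 1 and the bump of an old vertex
  vanishes, so the right end of the parent results.\<close>

lemma v_Suc:
  assumes "0 \<le> r" "r \<le> b"
  shows "v (Suc k) (b * q + r) z = interp k q r z + lam ^ Suc k * bump (Suc k) (b * q + r) z"
proof (cases "r = b")
  case True
  then have e: "b * q + r = b * (q + 1)" by (simp add: algebra_simps)
  show ?thesis unfolding e using True b_nz by (simp add: interp_def bump_def)
next
  case False
  then show ?thesis using assms by (simp add: interp_def)
qed

lemma v_old: "v (Suc k) (b * q) z = v k q z"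
  using b_nz by (simp add: bump_def)

lemma v_step:
  "\<bar>v (Suc k) (j + 1) z - v (Suc k) j z\<bar> \<le> \<bar>v k (j div b + 1) z - v k (j div b) z\<bar> / (b - 1)
     + (if fst z = Suc k mod M then lam ^ Suc k else 0)"
proof -
  obtain q r where j: "j = b * q + r" "0 \<le> r" "r < b" by (rule int_digit_cases)
  define d where "d = v k (q + 1) z - v k q z"
  have e: "v (Suc k) (j + 1) z - v (Suc k) j z = (wt k q (r + 1) - wt k q r) * d
     + lam ^ Suc k * (bump (Suc k) (j + 1) z - bump (Suc k) j z)"
    using v_Suc[of r k q z] v_Suc[of "r + 1" k q z] j by (simp add: interp_def d_def algebra_simps)
  have X: "\<bar>(wt k q (r + 1) - wt k q r) * d\<bar> \<le> \<bar>d\<bar> / (b - 1)"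
    using mult_right_mono[OF wt_step[of k q r], of "\<bar>d\<bar>"] by (simp add: abs_mult)
  have "\<bar>bump (Suc k) (j + 1) z - bump (Suc k) j z\<bar> \<le> (if fst z = Suc k mod M then 1 else 0)"
    using bump_bounds[of "Suc k" "j + 1" z] bump_bounds[of "Suc k" j z] bump_other[of z "Suc k"] by auto
  then have Y: "\<bar>lam ^ Suc k * (bump (Suc k) (j + 1) z - bump (Suc k) j z)\<bar>
      \<le> (if fst z = Suc k mod M then lam ^ Suc k else 0)"
    using lam_pos by (auto simp: abs_mult mult_left_le split: if_splits)
  have jq: "j div b = q" using j by simp
  show ?thesis unfolding jq e d_def[symmetric] by (rule order_trans[OF abs_triangle_ineq add_mono[OF X Y]])
qed

text \<open>The bound reproduces itself: the inherited part \<open>2 * lam ^ k / (b - 1)\<close> is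
  at most \<open>lam ^ Suc k\<close> by \<open>lam_b\<close>, and the new displacement adds at most
  the same amount.\<close>

lemma v_diff: "\<bar>v k (j + 1) z - v k j z\<bar> \<le> 2 * lam ^ k"
proof (induction k arbitrary: j)
  case 0
  show ?case using bump_bounds[of 0 "j + 1" z] bump_bounds[of 0 j z] by auto
next
  case (Suc k)
  have "\<bar>v (Suc k) (j + 1) z - v (Suc k) j z\<bar> \<le> \<bar>v k (j div b + 1) z - v k (j div b) z\<bar> / (b - 1) + lam ^ Suc k"
    using v_step[of k j z] lam_pow_pos[of "Suc k"] by (smt (verit))
  also have "\<dots> \<le> 2 * lam ^ k / (b - 1) + lam ^ Suc k"
    using Suc[of "j div b"] b_real by (intro add_right_mono divide_right_mono) auto
  also have "2 * lam ^ k / (b - 1) \<le> lam ^ Suc k"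
    using mult_left_mono[OF lam_b, of "lam ^ k"] lam_pos b_real by (simp add: divide_simps algebra_simps)
  finally show ?case by simp
qed

lemma v_diff_decay:
  assumes "\<And>j. \<bar>v k (j + 1) z - v k j z\<bar> \<le> B" "\<And>l. k < l \<Longrightarrow> l \<le> k + d \<Longrightarrow> l mod M \<noteq> fst z"
  shows "\<bar>v (k + d) (j + 1) z - v (k + d) j z\<bar> \<le> B / (b - 1) ^ d"
  using assms(2)
proof (induction d arbitrary: j)
  case 0
  then show ?case using assms(1) by simp
next
  case (Suc d)
  let ?q = "j div b"
  have "\<bar>v (k + Suc d) (j + 1) z - v (k + Suc d) j z\<bar> \<le> \<bar>v (k + d) (?q + 1) z - v (k + d) ?q z\<bar> / (b - 1)"
    using v_step[of "k + d" j z] Suc.prems[of "k + Suc d"] by auto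
  also have "\<dots> \<le> B / (b - 1) ^ d / (b - 1)"
    using Suc.IH[of ?q] Suc.prems b_real by (intro divide_right_mono) auto
  finally show ?case by (simp add: mult.commute)
qed

text \<open>The coordinates of level \<open>Suc k\<close> were last used \<open>M\<close> levels
  earlier, so differences in them have since been divided \<open>M - 1\<close> times by
  \<open>b - 1\<close>; if \<open>Suc k < M\<close>, they have not been used at all.\<close>

lemma v_diff_small:
  assumes "fst z = Suc k mod M"
  shows "\<bar>v k (q + 1) z - v k q z\<bar> \<le> lam ^ Suc k / 16"
proof (cases "M \<le> Suc k")
  case True
  define l where "l = Suc k - M"
  have k: "k = l + (M - 1)" "Suc k = l + M" using True M_ge l_def by auto
  have "l' mod M \<noteq> fst z" if "l < l'" "l' \<le> l + (M - 1)" for l'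
  proof
    assume "l' mod M = fst z"
    then have "l' mod M = l mod M" using assms k by simp
    then have "M dvd l' - l" using that by (simp add: mod_eq_dvd_iff_nat)
    then show False using that M_ge by (auto dest: dvd_imp_le)
  qed
  then have "\<bar>v k (q + 1) z - v k q z\<bar> \<le> 2 * lam ^ l / (b - 1) ^ (M - 1)"
    using v_diff_decay[of l z "2 * lam ^ l" "M - 1" q] v_diff k(1) by simp
  also have "\<dots> \<le> lam ^ Suc k / 16"
  proof -
    have "32 * (real_of_int b - 1) \<le> (lam * (real_of_int b - 1)) ^ M"
    proof -
      have "real_of_int (32 * (b - 1)) \<le> real_of_int (2 ^ M)" using M_pow by (subst of_int_le_iff)
      also have "\<dots> = 2 ^ M" by simp
      also have "\<dots> \<le> (lam * (b - 1)) ^ M" using lam_b by (intro power_mono) auto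
      finally show ?thesis by simp
    qed
    moreover have "(real_of_int b - 1) ^ M = (b - 1) * (real_of_int b - 1) ^ (M - 1)"
      using M_ge by (metis Suc_diff_1 less_le_trans of_int_1 of_int_diff pos2 power_Suc)
    ultimately have "32 * (real_of_int b - 1) \<le> lam ^ M * (real_of_int b - 1) ^ (M - 1) * (real_of_int b - 1)"
      by (simp add: power_mult_distrib mult_ac)
    then have "32 \<le> lam ^ M * (real_of_int b - 1) ^ (M - 1)" using b_real
      by (metis (no_types, opaque_lifting) diff_gt_0_iff_gt less_le_trans mult_le_cancel_right_pos one_less_numeral_iff semiring_norm(76) less_numeral_extra(1) numeral_less_iff semiring_norm(77) order_less_le_trans)
    then have "32 * lam ^ l \<le> lam ^ l * lam ^ M * (real_of_int b - 1) ^ (M - 1)"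
      using mult_left_mono[of 32 _ "lam ^ l"] lam_pos by (simp add: mult_ac)
    then show ?thesis using b_real k by (simp add: divide_simps power_add mult_ac)
  qed
  finally show ?thesis .
next
  case False
  then have f: "fst z = Suc k" using assms by simp
  have "\<bar>v (0 + k) (q + 1) z - v (0 + k) q z\<bar> \<le> 0 / (b - 1) ^ k"
  proof (rule v_diff_decay)
    show "\<bar>v 0 (j + 1) z - v 0 j z\<bar> \<le> 0" for j using f bump_other[of z 0] by simp
    show "l mod M \<noteq> fst z" if "0 < l" "l \<le> 0 + k" for l using that False f by simp
  qed
  then show ?thesis using lam_pow_pos[of "Suc k"] by simp
qed

lemma v_rep: "v k (rep k j) z = v k j z"
proof (induction k arbitrary: j)
  case 0
  then show ?case by simp
next
  case (Suc k)
  obtain q r where j: "j = b * q + r" "0 \<le> r" "r < b" by (rule int_digit_cases)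
  show ?case
  proof (cases "r = 0")
    case True
    then have "j = b * q" using j by simp
    then show ?thesis using Suc rep_old v_old by metis
  next
    case False
    show ?thesis
    proof (cases "r = 3 \<and> L k q")
      case True
      have "rep (Suc k) j = b * q + 2" using True j b_ge by simp
      moreover have "wt k q 2 = wt k q 3" using True by (simp add: wt_def)
      moreover have "bump (Suc k) (b * q + 2) z = bump (Suc k) (b * q + 3) z"
        using True b_ge by (simp add: bump_def)
      ultimately show ?thesis using True v_Suc[of 2 k q z] v_Suc[of 3 k q z] j b_ge
        by (simp only: interp_def)
    next
      case F: False
      then have "rep (Suc k) j = j" using False j rep_new[of r k q] by (simp del: rep.simps)
      then show ?thesis by simp
    qed
  qed
qed

lemma floor_pow_div: fixes t :: real shows "\<lfloor>t * real_of_int b ^ Suc m\<rfloor> div b = \<lfloor>t * real_of_int b ^ m\<rfloor>"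
  using floor_divide_real_eq_div[of b "t * real_of_int b ^ Suc m"] b_pos b_nz by simp

lemma v_parent: "\<bar>v (Suc m) j z - v m (j div b) z\<bar> \<le> 3 * lam ^ m"
proof -
  let ?q = "j div b"
  have "0 \<le> wt m ?q (j mod b)" "wt m ?q (j mod b) \<le> 1"
    using wt_ge[of "j mod b" m ?q] wt_le[of "j mod b" m ?q] b_pos by (auto simp: less_imp_le)
  then have "\<bar>wt m ?q (j mod b) * (v m (?q + 1) z - v m ?q z)\<bar> \<le> 2 * lam ^ m"
    using v_diff[of m ?q z] mult_mono[of "wt m ?q (j mod b)" 1 "\<bar>v m (?q + 1) z - v m ?q z\<bar>" "2 * lam ^ m"]
    by (simp add: abs_mult)
  moreover have "\<bar>lam ^ Suc m * bump (Suc m) j z\<bar> \<le> lam ^ m"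
  proof -
    have "lam ^ Suc m * bump (Suc m) j z \<le> lam ^ Suc m * 1"
      using bump_bounds[of "Suc m" j z] lam_pos by (intro mult_left_mono) auto
    moreover have "lam ^ Suc m \<le> lam ^ m" using lam_pos lam_less by simp
    moreover have "0 \<le> lam ^ Suc m * bump (Suc m) j z" using bump_bounds[of "Suc m" j z] lam_pos by simp
    ultimately show ?thesis by linarith
  qed
  ultimately show ?thesis unfolding v.simps by linarith
qed

lemma G_inc: fixes t :: real shows "\<bar>v (Suc m) \<lfloor>t * real_of_int b ^ Suc m\<rfloor> z - v m \<lfloor>t * real_of_int b ^ m\<rfloor> z\<bar> \<le> 3 * lam ^ m"
  using v_parent[of m "\<lfloor>t * real_of_int b ^ Suc m\<rfloor>" z] unfolding floor_pow_div .

lemma G_approx: "\<bar>G t z - v k \<lfloor>t * real_of_int b ^ k\<rfloor> z\<bar> \<le> K1 * lam ^ k"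
  unfolding G_def
  using geometric_increments(2)[OF lam_pos lam_less, of "\<lambda>m. v m \<lfloor>t * real_of_int b ^ m\<rfloor> z", OF G_inc] by simp

lemma G_LIMSEQ: "(\<lambda>m. v m \<lfloor>t * real_of_int b ^ m\<rfloor> z) \<longlonglongrightarrow> G t z" for t :: real
  unfolding G_def convergent_LIMSEQ_iff[symmetric]
  using geometric_increments(1)[OF lam_pos lam_less, of "\<lambda>m. v m \<lfloor>t * real_of_int b ^ m\<rfloor> z", OF G_inc] by simp

lemma v_refine: "v (k + d) (j * b ^ d) z = v k j z"
proof (induction d)
  case (Suc d)
  have "v (k + Suc d) (j * b ^ Suc d) z = v (Suc (k + d)) (b * (j * b ^ d)) z" by (simp add: mult_ac)
  then show ?case using Suc v_old by metis
qed simp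

lemma G_vertex: "G (j / real_of_int b ^ k) z = v k j z"
proof -
  have "v (m + k) \<lfloor>j / real_of_int b ^ k * real_of_int b ^ (m + k)\<rfloor> z = v k j z" for m
  proof -
    have e: "real_of_int j / real_of_int b ^ k * real_of_int b ^ (m + k) = real_of_int (j * b ^ m)"
      using b_nz by (simp add: power_add)
    show ?thesis unfolding e floor_of_int using v_refine[of k m j z] by (simp only: add.commute)
  qed
  then have "(\<lambda>m. v m \<lfloor>j / real_of_int b ^ k * real_of_int b ^ m\<rfloor> z) \<longlonglongrightarrow> v k j z"
    by - (rule LIMSEQ_offset[of _ k], simp only: tendsto_const)
  then show ?thesis using G_LIMSEQ[of "real_of_int j / real_of_int b ^ k" z] LIMSEQ_unique by blast
qed

lemma v_hull:
  assumes "i * b ^ d \<le> j" "j \<le> (i + 1) * b ^ d"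
  shows "\<exists>a. 0 \<le> a \<and> a \<le> 1 \<and> (\<forall>z. (\<forall>l. k < l \<longrightarrow> l \<le> k + d \<longrightarrow> l mod M \<noteq> fst z) \<longrightarrow>
     v (k + d) j z = v k i z + a * (v k (i + 1) z - v k i z))"
  using assms
proof (induction d arbitrary: j)
  case 0
  then consider "j = i" | "j = i + 1" by fastforce
  then show ?case
  proof cases
    case 1 then show ?thesis by (intro exI[of _ 0]) simp
  next
    case 2 then show ?thesis by (intro exI[of _ 1]) simp
  qed
next
  case (Suc d)
  obtain q r where j: "j = b * q + r" "0 \<le> r" "r < b" by (rule int_digit_cases)
  have q: "q = j div b" using j by simp
  have lo: "i * b ^ d \<le> q"
    using zdiv_mono1[OF Suc.prems(1) b_pos] b_nz q by (simp add: mult.left_commute)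
  have hi: "q \<le> (i + 1) * b ^ d"
    using zdiv_mono1[OF Suc.prems(2) b_pos] b_nz q by (simp add: mult.left_commute)
  obtain a1 where a1: "0 \<le> a1" "a1 \<le> 1" "\<And>z. (\<And>l. k < l \<Longrightarrow> l \<le> k + d \<Longrightarrow> l mod M \<noteq> fst z) \<Longrightarrow>
     v (k + d) q z = v k i z + a1 * (v k (i + 1) z - v k i z)" using Suc.IH[OF lo hi] by blast
  show ?case
  proof (cases "q = (i + 1) * b ^ d")
    case True
    then have "b * q + r \<le> b * q" using j Suc.prems(2) by (simp add: mult_ac)
    then have "j = b * q" using j by simp
    then have "v (k + Suc d) j z = v (k + d) q z" for z using v_old by simp
    then show ?thesis using a1 by (intro exI[of _ a1]) auto
  next
    case False
    then have "q + 1 \<le> (i + 1) * b ^ d" "i * b ^ d \<le> q + 1" using hi lo by auto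
    then obtain a2 where a2: "0 \<le> a2" "a2 \<le> 1" "\<And>z. (\<And>l. k < l \<Longrightarrow> l \<le> k + d \<Longrightarrow> l mod M \<noteq> fst z) \<Longrightarrow>
     v (k + d) (q + 1) z = v k i z + a2 * (v k (i + 1) z - v k i z)" using Suc.IH[of "q + 1"] by blast
    define w where "w = wt (k + d) q r"
    have w: "0 \<le> w" "w \<le> 1" using wt_ge wt_le j w_def by auto
    have "v (k + Suc d) j z = v k i z + (a1 + w * (a2 - a1)) * (v k (i + 1) z - v k i z)"
      if nz: "\<And>l. k < l \<Longrightarrow> l \<le> k + Suc d \<Longrightarrow> l mod M \<noteq> fst z" for z
    proof -
      have "bump (Suc (k + d)) j z = 0" using nz[of "Suc (k + d)"] bump_other[of z "Suc (k + d)"] by force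
      then have "v (k + Suc d) j z = interp (k + d) q r z" using v_Suc[of r "k + d" q z] j by simp
      also have "\<dots> = v k i z + (a1 + w * (a2 - a1)) * (v k (i + 1) z - v k i z)"
      proof -
        have e: "v (k + d) q z = v k i z + a1 * (v k (i + 1) z - v k i z)"
          "v (k + d) (q + 1) z = v k i z + a2 * (v k (i + 1) z - v k i z)"
          using a1(3) a2(3) nz by simp_all
        show ?thesis unfolding interp_def w_def[symmetric] e by (simp add: algebra_simps)
      qed
      finally show ?thesis .
    qed
    moreover have "0 \<le> a1 + w * (a2 - a1)" "a1 + w * (a2 - a1) \<le> 1"
      using interp_ge[of w 0 a1 a2] interp_le[of w a1 1 a2] w a1 a2 by auto
    ultimately show ?thesis by blast
  qed
qed

lemma G_hull:
  assumes "t \<in> edge k i"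
  shows "\<exists>a. 0 \<le> a \<and> a \<le> 1 \<and> (\<forall>z. (\<forall>l. k < l \<longrightarrow> l \<le> k + d \<longrightarrow> l mod M \<noteq> fst z) \<longrightarrow>
     \<bar>G t z - (v k i z + a * (v k (i + 1) z - v k i z))\<bar> \<le> K1 * lam ^ (k + d))"
proof -
  let ?j = "\<lfloor>t * real_of_int b ^ (k + d)\<rfloor>"
  have B: "real_of_int b ^ k > 0" "real_of_int b ^ d > 0" using b_pos by simp_all
  have "i \<le> t * real_of_int b ^ k" "t * real_of_int b ^ k \<le> i + 1"
    using assms B by (auto simp: edge_def divide_simps)
  then have "i * real_of_int b ^ d \<le> t * real_of_int b ^ k * real_of_int b ^ d" "t * real_of_int b ^ k * real_of_int b ^ d \<le> (i + 1) * real_of_int b ^ d"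
    using B(2) by (auto intro: mult_right_mono)
  then have lo: "real_of_int (i * b ^ d) \<le> t * real_of_int b ^ (k + d)" and hi: "t * real_of_int b ^ (k + d) \<le> real_of_int ((i + 1) * b ^ d)"
    by (auto simp: power_add mult_ac)
  have "i * b ^ d \<le> ?j" using lo by (simp only: le_floor_iff)
  moreover have "?j \<le> (i + 1) * b ^ d" using hi by (metis floor_mono floor_of_int)
  ultimately obtain a :: real where a: "0 \<le> a" "a \<le> 1" "\<forall>z. (\<forall>l. k < l \<longrightarrow> l \<le> k + d \<longrightarrow> l mod M \<noteq> fst z) \<longrightarrow>
     v (k + d) ?j z = v k i z + a * (v k (i + 1) z - v k i z)" using v_hull by blast
  show ?thesis
  proof (intro exI[of _ a] conjI allI impI a(1,2))
    fix z :: coord assume "\<forall>l. k < l \<longrightarrow> l \<le> k + d \<longrightarrow> l mod M \<noteq> fst z"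
    then show "\<bar>G t z - (v k i z + a * (v k (i + 1) z - v k i z))\<bar> \<le> K1 * lam ^ (k + d)"
      using a(3) G_approx[of t z "k + d"] by metis
  qed
qed

end

subsection \<open>Separation of non-adjacent edges\<close>

context loop_curve
begin

lemma interp_near:
  assumes "0 \<le> r" "r \<le> b" "J \<in> {q, q + 1}" "fst z = Suc k mod M"
  shows "\<bar>interp k q r z - v k J z\<bar> \<le> lam ^ Suc k / 16"
proof -
  let ?d = "v k (q + 1) z - v k q z"
  have w: "0 \<le> wt k q r" "wt k q r \<le> 1" using wt_ge wt_le assms by auto
  have d: "\<bar>?d\<bar> \<le> lam ^ Suc k / 16" by (rule v_diff_small[OF assms(4)])
  have "\<bar>wt k q r * ?d\<bar> \<le> \<bar>?d\<bar>" "\<bar>(1 - wt k q r) * ?d\<bar> \<le> \<bar>?d\<bar>"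
    using w mult_right_mono[of "wt k q r" 1 "\<bar>?d\<bar>"] mult_right_mono[of "1 - wt k q r" 1 "\<bar>?d\<bar>"]
    by (simp_all add: abs_mult)
  moreover have "interp k q r z - v k q z = wt k q r * ?d"
    "interp k q r z - v k (q + 1) z = - ((1 - wt k q r) * ?d)"
    by (simp_all add: interp_def algebra_simps)
  ultimately have "\<bar>interp k q r z - v k q z\<bar> \<le> \<bar>?d\<bar>" "\<bar>interp k q r z - v k (q + 1) z\<bar> \<le> \<bar>?d\<bar>"
    by (simp_all only: abs_minus_cancel)
  then show ?thesis using assms(3) d by auto
qed

lemma interp_close:
  assumes "adj k q q'" "0 \<le> r" "r \<le> b" "0 \<le> r'" "r' \<le> b" "fst z = Suc k mod M"
  shows "\<bar>interp k q r z - interp k q' r' z\<bar> \<le> lam ^ Suc k / 8"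
proof -
  obtain J J' where J: "J \<in> {q, q + 1}" "J' \<in> {q', q' + 1}" "rep k J = rep k J'"
    using assms(1) unfolding adj_def by blast
  have "v k J z = v k J' z" using J(3) v_rep by metis
  then show ?thesis using interp_near[OF assms(2,3) J(1) assms(6)] interp_near[OF assms(4,5) J(2) assms(6)]
    by linarith
qed

text \<open>Equal colours of adjacent parents force equal parents; equal digits, up to the fold at a
  loop, then give the same glued vertex.\<close>

lemma key_inj:
  assumes "adj k q q'" "0 < r" "r < b" "0 < r'" "r' < b"
    and "key (Suc k) (b * q + r) = key (Suc k) (b * q' + r')"
  shows "rep (Suc k) (b * q + r) = rep (Suc k) (b * q' + r')"
proof -
  have m: "(b * q + r) mod b = r" "(b * q' + r') mod b = r'"
     "(b * q + r) div b = q" "(b * q' + r') div b = q'" using assms by simp_all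
  have e: "parity k q = parity k q'" "q mod b = q' mod b"
    and r: "(if r = 3 \<and> L k q then 2 else r) = (if r' = 3 \<and> L k q' then 2 else r')"
    using assms(6) unfolding key.simps m prod.inject by blast+
  have "q = q'" by (rule adj_edge_colour[OF assms(1) e])
  then show ?thesis using r rep_new assms(2-5) by (auto split: if_splits)
qed

lemma edge_vertex_form:
  assumes "j \<in> {i, i + 1}"
  obtains r where "0 \<le> r" "r \<le> b" "j = b * (i div b) + r"
proof -
  obtain q r where i: "i = b * q + r" "0 \<le> r" "r < b" by (rule int_digit_cases)
  then have "i div b = q" by simp
  then show thesis using that[of r] that[of "r + 1"] i assms by auto
qed

lemma new_vertex_sep:
  assumes "adj k q q'" "0 < r" "r < b" "0 \<le> r'" "r' \<le> b"
    "rep (Suc k) (b * q + r) \<noteq> rep (Suc k) (b * q' + r')"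
  shows "bump (Suc k) (b * q' + r') (key (Suc k) (b * q + r)) = 0"
proof (cases "0 < r' \<and> r' < b")
  case True
  then have "key (Suc k) (b * q + r) \<noteq> key (Suc k) (b * q' + r')" using key_inj[OF assms(1-3)] assms(6) by blast
  then show ?thesis unfolding bump_def by metis
next
  case False
  then consider "r' = 0" | "r' = b" using assms by linarith
  then have "b dvd b * q' + r'" by cases auto
  then have "(b * q' + r') mod b = 0" by presburger
  then show ?thesis unfolding bump_def by metis
qed

lemma bump_self: "0 < r \<Longrightarrow> r < b \<Longrightarrow> bump k (b * q + r) (key k (b * q + r)) = 1"
  by (simp add: bump_def del: key.simps)

text \<open>In its own coordinate the new vertex has the full displacement
  \<open>lam ^ Suc k\<close>, the other vertex has none, and the positions inherited from the
  adjacent parents differ by at most an eighth of it.\<close>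

lemma vertex_sep_new:
  assumes adj: "adj k q q'" and r: "0 < r" "r < b" "0 \<le> r'" "r' \<le> b"
    and ne: "rep (Suc k) (b * q + r) \<noteq> rep (Suc k) (b * q' + r')"
  shows "\<exists>z\<in>coords. fst z = Suc k mod M \<and>
    7 / 8 * lam ^ Suc k \<le> \<bar>v (Suc k) (b * q + r) z - v (Suc k) (b * q' + r') z\<bar>"
proof -
  define z where "z = key (Suc k) (b * q + r)"
  have z: "z \<in> coords" "fst z = Suc k mod M" by (simp_all add: z_def key_coords fst_key del: key.simps)
  have "v (Suc k) (b * q + r) z = interp k q r z + lam ^ Suc k"
    using v_Suc[of r k q z] bump_self[of r "Suc k" q] r z_def by simp
  moreover have "v (Suc k) (b * q' + r') z = interp k q' r' z"
    using v_Suc[of r' k q' z] new_vertex_sep[OF adj r ne] r z_def by simp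
  moreover have "\<bar>interp k q r z - interp k q' r' z\<bar> \<le> lam ^ Suc k / 8"
    using interp_close[OF adj _ _ _ _ z(2), of r r'] r by simp
  ultimately show ?thesis using z by (intro bexI[of _ z] conjI) linarith+
qed

text \<open>One of the two ends must be new at its level, since old ends of adjacent edges would be
  glued by \<open>adj_common_old\<close>. Level 0 has no parents to refer to; there only edge 0
  matters.\<close>

lemma vertex_sep:
  assumes adj: "adj k q q'" and A: "A \<in> {q, q + 1}" "A' \<in> {q', q' + 1}"
    and ne: "rep k A \<noteq> rep k A'" and z: "k = 0 \<Longrightarrow> q = 0 \<and> q' = 0"
  shows "\<exists>z\<in>coords. fst z = k mod M \<and> 7 / 8 * lam ^ k \<le> \<bar>v k A z - v k A' z\<bar>"
proof (cases k)
  case 0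
  then have AA: "{A, A'} = {0, 1}" using A ne z by auto
  have "v 0 0 (key 0 1) = 0" "v 0 1 (key 0 1) = 1" using b_ge by (simp_all add: bump_def del: key.simps)
  then have "\<bar>v 0 A (key 0 1) - v 0 A' (key 0 1)\<bar> = 1" using AA by (auto simp: doubleton_eq_iff)
  then show ?thesis using 0 key_coords[of 0 1] fst_key[of 0 1] by (intro bexI[of _ "key 0 1"]) auto
next
  case (Suc m)
  let ?p = "q div b" and ?p' = "q' div b"
  have adjp: "adj m ?p ?p'" using adj_parent adj Suc by simp
  obtain r where r: "0 \<le> r" "r \<le> b" "A = b * ?p + r" using edge_vertex_form A(1) by blast
  obtain r' where r': "0 \<le> r'" "r' \<le> b" "A' = b * ?p' + r'" using edge_vertex_form A(2) by blast
  consider "0 < r" "r < b" | "0 < r'" "r' < b" | "r \<in> {0, b}" "r' \<in> {0, b}" using r r' by fastforce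
  then show ?thesis
  proof cases
    case 1
    then show ?thesis using vertex_sep_new[OF adjp 1 r'(1,2)] ne Suc r r' by simp
  next
    case 2
    then show ?thesis using vertex_sep_new[OF adj_sym[OF adjp] 2 r(1,2)] ne Suc r r' 
      by (simp add: abs_minus_commute)
  next
    case 3
    then have "A = b * ?p \<or> A = b * (?p + 1)" "A' = b * ?p' \<or> A' = b * (?p' + 1)"
      using r r' by (auto simp: algebra_simps)
    then obtain a a' where "A = b * a" "A' = b * a'" by blast
    then show ?thesis using adj_common_old[of m q q' a a'] adj A ne Suc by simp
  qed
qed

lemma edge_parent: "edge (Suc k) i \<subseteq> edge k (i div b)"
proof
  fix t assume "t \<in> edge (Suc k) i"
  then have t: "i / real_of_int b ^ Suc k \<le> t" "t \<le> (i + 1) / real_of_int b ^ Suc k" by (auto simp: edge_def)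
  obtain q r where i: "i = b * q + r" "0 \<le> r" "r < b" by (rule int_digit_cases)
  have B: "real_of_int b ^ k > 0" "real_of_int b > 0" using b_pos by simp_all
  have "real_of_int (b * q) \<le> real_of_int i" "real_of_int (i + 1) \<le> real_of_int (b * q + b)"
    using i by (subst of_int_le_iff; simp)+
  then have "q \<le> i / real_of_int b" "(i + 1) / real_of_int b \<le> q + 1"
    using B by (simp_all add: divide_simps algebra_simps)
  then have "q / real_of_int b ^ k \<le> i / real_of_int b / real_of_int b ^ k"
    "(i + 1) / real_of_int b / real_of_int b ^ k \<le> (q + 1) / real_of_int b ^ k"
    using B(1) by (rule_tac [!] divide_right_mono) simp_all
  then have "q / real_of_int b ^ k \<le> i / real_of_int b ^ Suc k"
    "(i + 1) / real_of_int b ^ Suc k \<le> (q + 1) / real_of_int b ^ k"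
    by simp_all
  moreover have "i div b = q" using i by simp
  ultimately show "t \<in> edge k (i div b)" using t by (simp add: edge_def)
qed

lemma mod_shift:
  assumes "k < l" "l < k + M"
  shows "l mod M \<noteq> k mod M"
proof
  assume "l mod M = k mod M"
  then have "M dvd l - k" using assms by (simp add: mod_eq_dvd_iff_nat)
  then show False using assms by (auto dest: dvd_imp_le)
qed

lemma G_hull_block:
  assumes "t \<in> edge k i"
  shows "\<exists>a. 0 \<le> a \<and> a \<le> 1 \<and> (\<forall>z. fst z = k mod M \<longrightarrow>
     \<bar>G t z - (v k i z + a * (v k (i + 1) z - v k i z))\<bar> \<le> lam ^ k / 16)"
proof -
  have tail: "K1 * lam ^ (k + (M - 1)) \<le> lam ^ k / 16"
    using mult_right_mono[OF M_tail, of "lam ^ k"] lam_pos by (simp add: power_add mult_ac)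
  obtain a where a: "0 \<le> a" "a \<le> 1" "\<forall>z. (\<forall>l. k < l \<longrightarrow> l \<le> k + (M - 1) \<longrightarrow> l mod M \<noteq> fst z) \<longrightarrow>
     \<bar>G t z - (v k i z + a * (v k (i + 1) z - v k i z))\<bar> \<le> K1 * lam ^ (k + (M - 1))"
    using G_hull[OF assms] by blast
  show ?thesis
  proof (intro exI[of _ a] conjI allI impI a(1,2))
    fix z :: coord assume "fst z = k mod M"
    then have "\<forall>l. k < l \<longrightarrow> l \<le> k + (M - 1) \<longrightarrow> l mod M \<noteq> fst z"
      using mod_shift[of k] M_ge by auto
    then show "\<bar>G t z - (v k i z + a * (v k (i + 1) z - v k i z))\<bar> \<le> lam ^ k / 16"
      using a(3) tail order_trans by blast
  qed
qed

text \<open>The coordinate belongs to the end \<rho> of \<open>i\<close> favoured by the hull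
  parameter \<open>a\<close>. In it \<open>G t\<close> carries at least half of
  \<open>lam ^ Suc k\<close>, while neither end of \<open>i'\<close> is displaced. Subtracting 1/8
  for the parents and 1/16 for each of the two hull errors leaves 1/4.\<close>

lemma lower_new_edge:
  assumes adj: "adj k (i div b) (i' div b)" and nadj: "\<not> adj (Suc k) i i'"
    and new: "i mod b \<noteq> 0" "(i + 1) mod b \<noteq> 0" and t: "t \<in> edge (Suc k) i" "u \<in> edge (Suc k) i'"
  shows "\<exists>z\<in>coords. lam ^ Suc k / 4 \<le> \<bar>G t z - G u z\<bar>"
proof -
  let ?q = "i div b" and ?q' = "i' div b" and ?l = "lam ^ Suc k"
  obtain a where a: "0 \<le> a" "a \<le> 1" "\<And>z. fst z = Suc k mod M \<Longrightarrow>
     \<bar>G t z - (v (Suc k) i z + a * (v (Suc k) (i + 1) z - v (Suc k) i z))\<bar> \<le> ?l / 16"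
    using G_hull_block[OF t(1)] by blast
  obtain a' where a': "0 \<le> a'" "a' \<le> 1" "\<And>z. fst z = Suc k mod M \<Longrightarrow>
     \<bar>G u z - (v (Suc k) i' z + a' * (v (Suc k) (i' + 1) z - v (Suc k) i' z))\<bar> \<le> ?l / 16"
    using G_hull_block[OF t(2)] by blast
  define r where "r = i mod b"
  have r: "0 \<le> r" "r < b" "r \<noteq> 0" using new b_pos unfolding r_def by simp_all
  then have i: "i = b * ?q + r" "0 < r" "r < b" unfolding r_def by simp_all
  have r1: "r + 1 < b"
  proof (rule ccontr)
    assume "\<not> r + 1 < b"
    then have "r = b - 1" using i by simp
    then have "i + 1 = b * ?q + b" using i(1) by linarith
    then have "i + 1 = b * (?q + 1)" by (simp add: algebra_simps)
    then show False using new by (metis mod_mult_self1_is_0)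
  qed
  define \<rho> where "\<rho> = (if a \<le> 1 / 2 then r else r + 1)"
  have \<rho>: "0 < \<rho>" "\<rho> < b" "b * ?q + \<rho> \<in> {i, i + 1}" using i r1 \<rho>_def by auto
  define z where "z = key (Suc k) (b * ?q + \<rho>)"
  have z: "z \<in> coords" "fst z = Suc k mod M" by (simp_all add: z_def key_coords fst_key del: key.simps)
  define r' where "r' = i' mod b"
  have i': "i' = b * ?q' + r'" "0 \<le> r'" "r' < b" using b_pos by (auto simp: r'_def)
  have i1: "i + 1 = b * ?q + (r + 1)" "i' + 1 = b * ?q' + (r' + 1)" using i i' by simp_all
  have ne: "rep (Suc k) (b * ?q + \<rho>) \<noteq> rep (Suc k) j'" if "j' \<in> {i', i' + 1}" for j'
    using nadj \<rho>(3) that unfolding adj_def by blast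
  have v'_gen: "v (Suc k) (b * ?q' + x) z = interp k ?q' x z"
    if "0 \<le> x" "x \<le> b" "b * ?q' + x \<in> {i', i' + 1}" for x
    using v_Suc[OF that(1,2), of k ?q' z] new_vertex_sep[OF adj \<rho>(1,2) that(1,2) ne[OF that(3)]]
    unfolding z_def[symmetric] by (simp del: v.simps rep.simps)
  have v': "v (Suc k) i' z = interp k ?q' r' z" "v (Suc k) (i' + 1) z = interp k ?q' (r' + 1) z"
  proof -
    show "v (Suc k) i' z = interp k ?q' r' z" using v'_gen[of r'] i' by (simp del: v.simps)
    have "b * ?q' + (r' + 1) \<in> {i', i' + 1}" unfolding i1(2)[symmetric] by simp
    then show "v (Suc k) (i' + 1) z = interp k ?q' (r' + 1) z"
      using v'_gen[of "r' + 1"] i'(2,3) unfolding i1(2)[symmetric] by simp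
  qed
  have v: "v (Suc k) i z = interp k ?q r z + ?l * bump (Suc k) i z"
    "v (Suc k) (i + 1) z = interp k ?q (r + 1) z + ?l * bump (Suc k) (i + 1) z"
    using v_Suc[of r k ?q z] v_Suc[of "r + 1" k ?q z, folded i1(1)] i by (simp_all del: v.simps)
  define c where "c = max (interp k ?q' r' z) (interp k ?q' (r' + 1) z)"
  have c: "c - ?l / 8 \<le> interp k ?q s z" if "0 \<le> s" "s \<le> b" for s
  proof -
    have "\<bar>interp k ?q s z - interp k ?q' r' z\<bar> \<le> ?l / 8"
      "\<bar>interp k ?q s z - interp k ?q' (r' + 1) z\<bar> \<le> ?l / 8"
      by (rule interp_close[OF adj that _ _ z(2)]; use i'(2,3) in simp)+
    then show ?thesis unfolding c_def by linarith
  qed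
  have "G u z \<le> c + ?l / 16"
    using a'(3)[OF z(2)] interp_le[OF a'(1,2), of "interp k ?q' r' z" c "interp k ?q' (r' + 1) z"]
    unfolding v' c_def by linarith
  moreover have "c - ?l / 8 + ?l / 2 - ?l / 16 \<le> G t z"
  proof -
    have "bump (Suc k) i z + a * (bump (Suc k) (i + 1) z - bump (Suc k) i z) \<ge> 1 / 2"
    proof (cases "a \<le> 1 / 2")
      case True
      then have "bump (Suc k) i z = 1" using bump_self[of r "Suc k" ?q] i \<rho>_def z_def by simp
      moreover have "a * (bump (Suc k) (i + 1) z - 1) \<ge> a * (-1)"
        using bump_bounds[of "Suc k" "i + 1" z] a by (intro mult_left_mono) auto
      ultimately show ?thesis using True by (simp add: algebra_simps)
    next
      case False
      then have "\<rho> = r + 1" using \<rho>_def by simp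
      then have "bump (Suc k) (i + 1) z = 1"
        unfolding z_def i1(1) using bump_self[of "r + 1" "Suc k" ?q] r1 i(2) by (simp del: key.simps)
      moreover have "(1 - a) * bump (Suc k) i z \<ge> 0" using bump_bounds[of "Suc k" i z] a by simp
      ultimately show ?thesis using False by (simp add: algebra_simps)
    qed
    then have "?l / 2 \<le> ?l * (bump (Suc k) i z + a * (bump (Suc k) (i + 1) z - bump (Suc k) i z))"
      using mult_left_mono[of "1 / 2" _ ?l] lam_pos by simp
    moreover have "c - ?l / 8 \<le> interp k ?q r z + a * (interp k ?q (r + 1) z - interp k ?q r z)"
      using interp_ge[OF a(1,2)] c[of r] c[of "r + 1"] i r1 by simp
    moreover have "v (Suc k) i z + a * (v (Suc k) (i + 1) z - v (Suc k) i z) =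
      interp k ?q r z + a * (interp k ?q (r + 1) z - interp k ?q r z)
      + ?l * (bump (Suc k) i z + a * (bump (Suc k) (i + 1) z - bump (Suc k) i z))"
      unfolding v by (simp add: algebra_simps)
    ultimately show ?thesis using a(3)[OF z(2)] by linarith
  qed
  ultimately have "?l / 4 \<le> \<bar>G t z - G u z\<bar>" by linarith
  then show ?thesis using z by blast
qed

text \<open>In the coordinates of level \<open>k\<close>, an edge of the next level has only the
  inherited difference, at most \<open>2 * lam ^ k / (b - 1)\<close>. Since
  \<open>17 \<le> b\<close>, this is at most an eighth of \<open>lam ^ k\<close>; the hull error
  adds a sixteenth.\<close>

lemma near_old_vertex:
  assumes "b * A \<in> {i, i + 1}" "t \<in> edge (Suc k) i" "fst z = k mod M"
  shows "\<bar>G t z - v k A z\<bar> \<le> 3 / 16 * lam ^ k"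
proof -
  let ?q = "i div b"
  have nz: "fst z \<noteq> Suc k mod M" using mod_shift[of k "Suc k"] M_ge assms(3) by simp
  \<comment> \<open>After level \<open>Suc k\<close>, \<open>M - 2\<close> further levels reach
    \<open>k + M - 1\<close>, just before the coordinates of level \<open>k\<close> are used
    again.\<close>
  have tail: "K1 * lam ^ (Suc k + (M - 2)) \<le> lam ^ k / 16"
  proof -
    have e: "Suc k + (M - 2) = (M - 1) + k" using M_ge by simp
    show ?thesis unfolding e power_add
      using mult_right_mono[OF M_tail, of "lam ^ k"] lam_pos by (simp only: mult.assoc) simp
  qed
  obtain a where a: "0 \<le> a" "a \<le> 1"
     "\<bar>G t z - (v (Suc k) i z + a * (v (Suc k) (i + 1) z - v (Suc k) i z))\<bar> \<le> lam ^ k / 16"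
  proof -
    have "\<forall>l. Suc k < l \<longrightarrow> l \<le> Suc k + (M - 2) \<longrightarrow> l mod M \<noteq> fst z"
      using mod_shift[of k] M_ge assms(3) by auto
    then show thesis using G_hull[OF assms(2), of "M - 2"] that tail order_trans by blast
  qed
  define d where "d = v (Suc k) (i + 1) z - v (Suc k) i z"
  have "\<bar>d\<bar> \<le> \<bar>v k (?q + 1) z - v k ?q z\<bar> / (b - 1)" using v_step[of k i z] nz unfolding d_def by simp
  also have "\<dots> \<le> 2 * lam ^ k / 16"
    by (rule frac_le[OF _ v_diff]) (use b_real lam_pos in auto)
  finally have d: "\<bar>d\<bar> \<le> lam ^ k / 8" by simp
  have "\<bar>a * d\<bar> \<le> \<bar>d\<bar>" "\<bar>(1 - a) * d\<bar> \<le> \<bar>d\<bar>"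
    using a mult_right_mono[of a 1 "\<bar>d\<bar>"] mult_right_mono[of "1 - a" 1 "\<bar>d\<bar>"] by (simp_all add: abs_mult)
  moreover have "v (Suc k) i z + a * d = v (Suc k) (i + 1) z - (1 - a) * d" by (simp add: d_def algebra_simps)
  moreover have "v k A z = v (Suc k) i z \<or> v k A z = v (Suc k) (i + 1) z"
    using assms(1) v_old[of k A z] by (auto simp del: v.simps)
  ultimately show ?thesis using a(3) d unfolding d_def[symmetric] by linarith
qed

lemma div_pow_less: "i < b ^ Suc k \<Longrightarrow> i div b < b ^ k"
proof -
  assume i: "i < b ^ Suc k"
  obtain q r where qr: "i = b * q + r" "0 \<le> r" "r < b" by (rule int_digit_cases)
  then have "b * q < b * b ^ k" using i unfolding power_Suc by linarith
  then have "q < b ^ k" using b_pos by simp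
  then show "i div b < b ^ k" using qr by simp
qed

text \<open>
  If the parents are already non-adjacent, the coarser level separates the points. Otherwise either one of the
  edges has two new vertices and the coordinates of level \<open>k\<close> separate them, or both edges start or end at old
  vertices, which the coordinates of level \<open>k - 1\<close> separate.
\<close>

theorem G_lower:
  assumes "0 \<le> i" "i < b ^ k" "0 \<le> i'" "i' < b ^ k" "t \<in> edge k i" "u \<in> edge k i'" "\<not> adj k i i'"
  shows "\<exists>z\<in>coords. lam ^ k / 4 \<le> \<bar>G t z - G u z\<bar>"
  using assms
proof (induction k arbitrary: i i')
  case 0
  then have "i = i'" by simp
  then show ?case using 0 adj_refl by blast
next
  case (Suc k)
  let ?q = "i div b" and ?q' = "i' div b"
  have q: "0 \<le> ?q" "?q < b ^ k" "0 \<le> ?q'" "?q' < b ^ k"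
    using Suc.prems b_pos by (auto simp: pos_imp_zdiv_nonneg_iff intro!: div_pow_less)
  show ?case
  proof (cases "adj k ?q ?q'")
    case False
    then obtain z where "z \<in> coords" "lam ^ k / 4 \<le> \<bar>G t z - G u z\<bar>"
      using Suc.IH[OF q] edge_parent Suc.prems(5,6) by blast
    moreover have "lam ^ Suc k \<le> lam ^ k" using lam_pos lam_less by simp
    ultimately have "lam ^ Suc k / 4 \<le> \<bar>G t z - G u z\<bar>" by linarith
    then show ?thesis using \<open>z \<in> coords\<close> by blast
  next
    case adj: True
    show ?thesis
    proof (cases "i mod b \<noteq> 0 \<and> (i + 1) mod b \<noteq> 0")
      case True
      then show ?thesis using lower_new_edge[OF adj] Suc.prems by blast
    next
      case old: False
      show ?thesis
      proof (cases "i' mod b \<noteq> 0 \<and> (i' + 1) mod b \<noteq> 0")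
        case True
        then obtain z where "z \<in> coords" "lam ^ Suc k / 4 \<le> \<bar>G u z - G t z\<bar>"
          using lower_new_edge[OF adj_sym[OF adj]] Suc.prems adj_sym by blast
        then show ?thesis by (metis abs_minus_commute)
      next
        case old': False
        obtain A where A: "b * A \<in> {i, i + 1}" using old by (auto simp: dvd_def) blast+
        obtain A' where A': "b * A' \<in> {i', i' + 1}" using old' by (auto simp: dvd_def) blast+
        have ne: "rep k A \<noteq> rep k A'"
        proof
          assume "rep k A = rep k A'"
          then have "rep (Suc k) (b * A) = rep (Suc k) (b * A')" using rep_old by simp
          then show False using A A' Suc.prems(7) unfolding adj_def by blast
        qed
        obtain z where z: "z \<in> coords" "fst z = k mod M" "7 / 8 * lam ^ k \<le> \<bar>v k A z - v k A' z\<bar>"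
        proof -
          have "?q = 0 \<and> ?q' = 0" if "k = 0" using q that by simp
          then show thesis using vertex_sep[OF adj vertex_old[OF A refl] vertex_old[OF A' refl] ne] that by blast
        qed
        have "\<bar>G t z - v k A z\<bar> \<le> 3 / 16 * lam ^ k" "\<bar>G u z - v k A' z\<bar> \<le> 3 / 16 * lam ^ k"
          using near_old_vertex A A' Suc.prems z by blast+
        moreover have "lam ^ Suc k \<le> lam ^ k" using lam_pos lam_less by simp
        ultimately have "lam ^ Suc k / 4 \<le> \<bar>G t z - G u z\<bar>" using z(3) by linarith
        then show ?thesis using z by blast
      qed
    qed
  qed
qed

section \<open>Oscillation of the curve over one edge length\<close>

lemma G_step:
  assumes "\<bar>t - u\<bar> * real_of_int b ^ k \<le> 1"
  shows "\<bar>G t z - G u z\<bar> \<le> (2 * K1 + 2) * lam ^ k"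
proof -
  define j where "j = \<lfloor>t * real_of_int b ^ k\<rfloor>"
  define j' where "j' = \<lfloor>u * real_of_int b ^ k\<rfloor>"
  have "\<bar>t * real_of_int b ^ k - u * real_of_int b ^ k\<bar> \<le> 1"
    using assms b_pos by (simp add: abs_mult left_diff_distrib[symmetric])
  then have "j = j' \<or> j' = j + 1 \<or> j = j' + 1" unfolding j_def j'_def by linarith
  then have "\<bar>v k j z - v k j' z\<bar> \<le> 2 * lam ^ k"
    using v_diff[of k j z] v_diff[of k j' z] lam_pow_pos[of k] by auto
  moreover have "\<bar>G t z - v k j z\<bar> \<le> K1 * lam ^ k" "\<bar>G u z - v k j' z\<bar> \<le> K1 * lam ^ k"
    using G_approx j_def j'_def by auto
  ultimately show ?thesis unfolding distrib_right by linarith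
qed

lemma G_bounded: "\<bar>G t z\<bar> \<le> K1 + 1"
  using G_approx[of t z 0] bump_bounds[of 0 "\<lfloor>t\<rfloor>" z] by auto

end

subsection \<open>Euclidean distance and Hausdorff measure\<close>

lemma eucl_dist_L2: "eucl_dist N x y = L2_set (\<lambda>i. x i - y i) {..<N}"
  by (simp add: eucl_dist_def L2_set_def)

lemma eucl_dist_nonneg [simp]: "0 \<le> eucl_dist N x y"
  by (simp add: eucl_dist_L2)

lemma eucl_dist_commute: "eucl_dist N x y = eucl_dist N y x"
  by (simp add: eucl_dist_def power2_commute)

lemma eucl_dist_self [simp]: "eucl_dist N x x = 0"
  by (simp add: eucl_dist_def)

lemma eucl_dist_ge_coord: "i < N \<Longrightarrow> \<bar>x i - y i\<bar> \<le> eucl_dist N x y"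
  unfolding eucl_dist_L2 L2_set_def
  by (rule real_le_rsqrt) (auto simp: intro!: member_le_sum[of i "{..<N}" "\<lambda>i. (x i - y i)\<^sup>2"])

lemma eucl_dist_le_sum: "eucl_dist N x y \<le> (\<Sum>i<N. \<bar>x i - y i\<bar>)"
  unfolding eucl_dist_L2 by (rule L2_set_le_sum_abs)

lemma eucl_dist_le_bound:
  assumes "\<And>i. i < N \<Longrightarrow> \<bar>x i - y i\<bar> \<le> e"
  shows "eucl_dist N x y \<le> N * e"
proof -
  have "(\<Sum>i<N. \<bar>x i - y i\<bar>) \<le> (\<Sum>i<N. e)" by (intro sum_mono) (use assms in auto)
  then show ?thesis using eucl_dist_le_sum[of N x y] by simp
qed

lemma eucl_dist_triangle: "eucl_dist N x z \<le> eucl_dist N x y + eucl_dist N y z"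
  unfolding eucl_dist_L2 using L2_set_triangle_ineq[of "\<lambda>i. x i - y i" "\<lambda>i. y i - z i" "{..<N}"] by simp

lemma eucl_dist_eq_0:
  assumes "x \<in> RN N" "y \<in> RN N" "eucl_dist N x y = 0"
  shows "x = y"
proof
  fix i show "x i = y i"
    using assms eucl_dist_ge_coord[of i N x y] by (cases "i < N") (auto simp: RN_def)
qed

lemma RN_metric: "Metric_space (RN N) (eucl_dist N)"
  by unfold_locales (auto simp: eucl_dist_commute eucl_dist_triangle eucl_dist_eq_0)

lemma ediam_ge: "x \<in> U \<Longrightarrow> y \<in> U \<Longrightarrow> ennreal (eucl_dist N x y) \<le> ediam N U"
  unfolding ediam_def by (meson SUP_upper SUP_upper2)

lemma ediam_le: "(\<And>x y. x \<in> U \<Longrightarrow> y \<in> U \<Longrightarrow> eucl_dist N x y \<le> d) \<Longrightarrow> ediam N U \<le> ennreal d"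
  unfolding ediam_def by (intro SUP_least ennreal_leI) auto

lemma ediam_empty [simp]: "ediam N {} = 0"
  by (simp add: ediam_def bot_ennreal)

lemma hausdorff_pre_le:
  assumes "E \<subseteq> (\<Union>i. U i)" "\<And>i. U i \<subseteq> RN N" "\<And>i. ediam N (U i) \<le> ennreal \<delta>"
  shows "hausdorff_pre N s \<delta> E \<le> (\<Sum>i. ennreal (enn2real (ediam N (U i)) powr s))"
  unfolding hausdorff_pre_def by (rule INF_lower) (use assms in auto)

lemma hausdorff_null_iff: "hausdorff N s E = 0 \<longleftrightarrow> (\<forall>\<delta>>0. hausdorff_pre N s \<delta> E = 0)"
proof -
  have "hausdorff N s E = 0 \<longleftrightarrow> hausdorff N s E \<le> 0" by simp
  then show ?thesis unfolding hausdorff_def SUP_le_iff by auto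
qed

lemma hausdorff_pre_mono: "E \<subseteq> F \<Longrightarrow> hausdorff_pre N s \<delta> E \<le> hausdorff_pre N s \<delta> F"
  unfolding hausdorff_pre_def by (rule INF_superset_mono) auto

lemma hausdorff_null_mono: "E \<subseteq> F \<Longrightarrow> hausdorff N s F = 0 \<Longrightarrow> hausdorff N s E = 0"
  unfolding hausdorff_null_iff using hausdorff_pre_mono[of E F] by (metis le_zero_eq)

lemma hausdorff_null_UN:
  fixes E :: "nat \<Rightarrow> (nat \<Rightarrow> real) set"
  assumes "\<And>n. hausdorff N s (E n) = 0"
  shows "hausdorff N s (\<Union>n. E n) = 0"
  unfolding hausdorff_null_iff
proof (intro allI impI)
  fix \<delta> :: real assume "0 < \<delta>"
  have le: "hausdorff_pre N s \<delta> (\<Union>n. E n) \<le> 0 + ennreal \<epsilon>" if "0 < \<epsilon>" for \<epsilon> :: real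
  proof -
    have "\<exists>U. E n \<subseteq> (\<Union>i. U i) \<and> (\<forall>i. U i \<subseteq> RN N) \<and> (\<forall>i. ediam N (U i) \<le> ennreal \<delta>) \<and>
      (\<Sum>i. ennreal (enn2real (ediam N (U i)) powr s)) < ennreal (\<epsilon> * (1/2) ^ Suc n)" for n
    proof -
      have "hausdorff_pre N s \<delta> (E n) < ennreal (\<epsilon> * (1/2) ^ Suc n)"
        using assms \<open>0 < \<delta>\<close> \<open>0 < \<epsilon>\<close> unfolding hausdorff_null_iff by simp
      then show ?thesis unfolding hausdorff_pre_def INF_less_iff by blast
    qed
    then obtain U where U: "\<And>n. E n \<subseteq> (\<Union>i. U n i)" "\<And>n i. U n i \<subseteq> RN N"
      "\<And>n i. ediam N (U n i) \<le> ennreal \<delta>"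
      "\<And>n. (\<Sum>i. ennreal (enn2real (ediam N (U n i)) powr s)) < ennreal (\<epsilon> * (1/2) ^ Suc n)"
      by metis
    define V where "V i = case_prod U (prod_decode i)" for i
    have "(\<Union>n. E n) \<subseteq> (\<Union>i. V i)"
    proof
      fix x assume "x \<in> (\<Union>n. E n)"
      then obtain n i where "x \<in> U n i" using U(1) by blast
      then have "x \<in> V (prod_encode (n, i))" by (simp add: V_def)
      then show "x \<in> (\<Union>i. V i)" by blast
    qed
    moreover have "V i \<subseteq> RN N" "ediam N (V i) \<le> ennreal \<delta>" for i
      using U(2,3) by (auto simp: V_def split: prod.split)
    ultimately have "hausdorff_pre N s \<delta> (\<Union>n. E n) \<le> (\<Sum>i. ennreal (enn2real (ediam N (V i)) powr s))"
      by (rule hausdorff_pre_le)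
    also have "\<dots> = (\<Sum>i. (\<lambda>p. ennreal (enn2real (ediam N (case_prod U p)) powr s)) (prod_decode i))"
      by (simp add: V_def)
    also have "\<dots> = (\<Sum>n. \<Sum>i. ennreal (enn2real (ediam N (U n i)) powr s))"
      by (subst suminf_ennreal_2dimen[OF refl]) simp
    also have "\<dots> \<le> (\<Sum>n. ennreal (\<epsilon> * (1/2) ^ Suc n))"
      by (intro suminf_le less_imp_le[OF U(4)]) auto
    also have "\<dots> = ennreal \<epsilon>"
    proof (rule suminf_ennreal_eq)
      show "(\<lambda>n. \<epsilon> * (1/2) ^ Suc n) sums \<epsilon>" using sums_mult[OF power_half_series, of \<epsilon>] by simp
    qed (use \<open>0 < \<epsilon>\<close> in auto)
    finally show ?thesis by simp
  qed
  have "hausdorff_pre N s \<delta> (\<Union>n. E n) \<le> 0" by (rule ennreal_le_epsilon) (rule le)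
  then show "hausdorff_pre N s \<delta> (\<Union>n. E n) = 0" by simp
qed

lemma hausdorff_pre_finite_cover:
  fixes V :: "'i \<Rightarrow> (nat \<Rightarrow> real) set"
  assumes "finite F" "E \<subseteq> (\<Union>i\<in>F. V i)" and V: "\<And>i. i \<in> F \<Longrightarrow> V i \<subseteq> RN N"
    "\<And>i x y. i \<in> F \<Longrightarrow> x \<in> V i \<Longrightarrow> y \<in> V i \<Longrightarrow> eucl_dist N x y \<le> d" "0 \<le> d" "d \<le> \<delta>" and "0 < s"
  shows "hausdorff_pre N s \<delta> E \<le> ennreal (card F * d powr s)"
proof -
  obtain h where h: "bij_betw h {..<card F} F" using ex_bij_betw_nat_finite[OF assms(1)] atLeast0LessThan by metis
  define U where "U i = (if i < card F then V (h i) else {})" for i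
  have hF: "i < card F \<Longrightarrow> h i \<in> F" for i using h by (auto simp: bij_betw_def)
  have di: "ediam N (U i) \<le> ennreal d" for i
  proof (cases "i < card F")
    case True
    then show ?thesis unfolding U_def using V(2)[OF hF[OF True]] by (auto intro: ediam_le)
  qed (simp add: U_def)
  have "hausdorff_pre N s \<delta> E \<le> (\<Sum>i. ennreal (enn2real (ediam N (U i)) powr s))"
  proof (rule hausdorff_pre_le)
    show "E \<subseteq> (\<Union>i. U i)"
    proof
      fix x assume "x \<in> E"
      then obtain f where f: "f \<in> F" "x \<in> V f" using assms(2) by blast
      then obtain i where "i < card F" "f = h i" using h by (auto simp: bij_betw_def)
      then have "x \<in> U i" using f by (simp add: U_def)
      then show "x \<in> (\<Union>i. U i)" by blast
    qed
    show "U i \<subseteq> RN N" for i using V(1) hF by (auto simp: U_def)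
    show "ediam N (U i) \<le> ennreal \<delta>" for i using di[of i] \<open>d \<le> \<delta>\<close> by (meson ennreal_leI order_trans)
  qed
  also have "\<dots> = (\<Sum>i<card F. ennreal (enn2real (ediam N (U i)) powr s))"
    by (rule suminf_finite) (auto simp: U_def)
  also have "\<dots> \<le> (\<Sum>i<card F. ennreal (d powr s))"
  proof (intro sum_mono ennreal_leI powr_mono2)
    show "enn2real (ediam N (U i)) \<le> d" for i using di[of i] \<open>0 \<le> d\<close> by (simp add: enn2real_leI)
  qed (use \<open>0 < s\<close> in auto)
  also have "\<dots> = ennreal (card F * d powr s)" by (simp add: ennreal_mult ennreal_of_nat_eq_real_of_nat)
  finally show ?thesis .
qed

text \<open>Mass distribution principle with Lebesgue measure on the parameter interval as the mass.
  \<open>B\<close> appears because the preimage of an arbitrary covering set need not be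
  measurable.\<close>

lemma hausdorff_pos_of_mass:
  fixes g :: "real \<Rightarrow> nat \<Rightarrow> real"
  assumes "0 < C" and mass: "\<And>d A. A \<subseteq> {0..1} \<Longrightarrow> 0 \<le> d \<Longrightarrow>
      (\<And>t u. t \<in> A \<Longrightarrow> u \<in> A \<Longrightarrow> eucl_dist N (g t) (g u) \<le> d) \<Longrightarrow>
      \<exists>B\<in>sets lborel. A \<subseteq> B \<and> emeasure lborel B \<le> ennreal (C * d powr s)"
  shows "hausdorff N s (g ` {0..1}) > 0"
proof -
  have "ennreal (1 / C) \<le> hausdorff_pre N s 1 (g ` {0..1})"
    unfolding hausdorff_pre_def
  proof (rule INF_greatest)
    fix U :: "nat \<Rightarrow> (nat \<Rightarrow> real) set"
    assume "U \<in> {U. g ` {0..1} \<subseteq> (\<Union>i. U i) \<and> (\<forall>i. U i \<subseteq> RN N) \<and> (\<forall>i. ediam N (U i) \<le> ennreal 1)}"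
    then have U: "g ` {0..1} \<subseteq> (\<Union>i. U i)" "\<And>i. ediam N (U i) \<le> ennreal 1" by auto
    define d where "d i = enn2real (ediam N (U i))" for i
    define A where "A i = {t \<in> {0..1}. g t \<in> U i}" for i
    have fin: "ediam N (U i) < top" for i using U(2)[of i] by (simp add: le_less_trans)
    have "\<exists>B\<in>sets lborel. A i \<subseteq> B \<and> emeasure lborel B \<le> ennreal (C * d i powr s)" for i
    proof (rule mass)
      fix t u assume "t \<in> A i" "u \<in> A i"
      then have "ennreal (eucl_dist N (g t) (g u)) \<le> ediam N (U i)" by (intro ediam_ge) (auto simp: A_def)
      also have "\<dots> = ennreal (d i)" using fin[of i] by (simp add: d_def)
      finally show "eucl_dist N (g t) (g u) \<le> d i" by (simp add: d_def)
    qed (auto simp: A_def d_def)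
    then obtain B where B: "\<And>i. B i \<in> sets lborel" "\<And>i. A i \<subseteq> B i"
      "\<And>i. emeasure lborel (B i) \<le> ennreal (C * d i powr s)" by metis
    have "{0..1} \<subseteq> (\<Union>i. A i)" using U(1) by (fastforce simp: A_def)
    then have sub: "{0..1::real} \<subseteq> (\<Union>i. B i)" using B(2) by blast
    have "1 = emeasure lborel {0..1::real}" by simp
    also have "\<dots> \<le> emeasure lborel (\<Union>i. B i)" using B(1) sub by (intro emeasure_mono) auto
    also have "\<dots> \<le> (\<Sum>i. emeasure lborel (B i))"
      using B(1) by (intro emeasure_subadditive_countably) auto
    also have "\<dots> \<le> (\<Sum>i. ennreal C * ennreal (d i powr s))"
      using B(3) \<open>0 < C\<close> by (intro suminf_le) (auto simp: ennreal_mult)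
    also have "\<dots> = ennreal C * (\<Sum>i. ennreal (d i powr s))" by simp
    finally have "ennreal (1 / C) * 1 \<le> ennreal (1 / C) * (ennreal C * (\<Sum>i. ennreal (d i powr s)))"
      by (intro mult_left_mono) auto
    also have "\<dots> = (\<Sum>i. ennreal (d i powr s))"
      using \<open>0 < C\<close> by (simp add: mult.assoc[symmetric] ennreal_mult[symmetric])
    finally show "ennreal (1 / C) \<le> (\<Sum>i. ennreal (enn2real (ediam N (U i)) powr s))" by (simp add: d_def)
  qed
  also have "\<dots> \<le> hausdorff N s (g ` {0..1})" unfolding hausdorff_def by (rule SUP_upper) auto
  finally show ?thesis using \<open>0 < C\<close> by (metis ennreal_less_zero_iff not_gr_zero le_zero_eq zero_less_divide_1_iff)
qed

subsection \<open>Hoelder and mass estimates\<close>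

text \<open>\<open>lam_s\<close> balances the \<open>b ^ k\<close> edges of level \<open>k\<close>
  against their size \<open>lam ^ k\<close>: the sum of the \<open>s\<close>-th powers is the same
  on every level.\<close>

locale loop_snowflake = loop_curve +
  fixes s :: real
  assumes s_gt: "1 < s" and lam_s: "lam powr s = 1 / b"
begin

lemma lam_pow_s: "(lam ^ k) powr s = 1 / real_of_int b ^ k"
proof (induction k)
  case (Suc k)
  then show ?case using lam_s lam_pos by (simp add: powr_mult)
qed simp

lemma edge_exists:
  assumes "t \<in> {0..1}"
  shows "\<exists>i. 0 \<le> i \<and> i < b ^ k \<and> t \<in> edge k i"
proof (cases "t = 1")
  case True
  have "1 \<le> b ^ k" using b_pos by simp
  then show ?thesis using True b_pos by (intro exI[of _ "b ^ k - 1"]) (auto simp: edge_def divide_simps)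
next
  case False
  have B: "0 < real_of_int b ^ k" using b_pos by simp
  have "t * real_of_int b ^ k < real_of_int b ^ k" using assms False B by simp
  then have "\<lfloor>t * real_of_int b ^ k\<rfloor> < b ^ k" by (simp add: floor_less_iff)
  moreover have "0 \<le> \<lfloor>t * real_of_int b ^ k\<rfloor>" using assms B by simp
  moreover have "t \<in> edge k \<lfloor>t * real_of_int b ^ k\<rfloor>"
    unfolding edge_def atLeastAtMost_iff using B by (simp add: divide_le_eq le_divide_eq)
  ultimately show ?thesis by blast
qed

lemma edge_floor: "t \<in> edge k \<lfloor>t * real_of_int b ^ k\<rfloor>"
proof -
  have B: "0 < real_of_int b ^ k" using b_pos by simp
  show ?thesis unfolding edge_def atLeastAtMost_iff using B by (simp add: divide_le_eq le_divide_eq)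
qed

lemma emeasure_edge: "emeasure lborel (edge k i) = ennreal (1 / real_of_int b ^ k)"
proof -
  have "0 < real_of_int b ^ k" using b_pos by simp
  then show ?thesis by (simp add: edge_def divide_right_mono diff_divide_distrib[symmetric])
qed

text \<open>Eight adjacent edges, a factor \<open>b\<close> for the one level lost when the scale is
  chosen, and \<open>4 powr s\<close> for the separation \<open>lam ^ k / 4\<close>.\<close>

definition C_mass :: real where "C_mass = 8 * b * 4 powr s"

text \<open>As soon as \<open>d\<close> is below the separation \<open>lam ^ k / 4\<close>, all of
  \<open>A\<close> lies in the edges adjacent to a single edge of level \<open>k\<close>.\<close>

lemma G_mass:
  assumes A: "A \<subseteq> {0..1}" and d: "0 \<le> d"
    and close: "\<And>t u z. t \<in> A \<Longrightarrow> u \<in> A \<Longrightarrow> z \<in> coords \<Longrightarrow> \<bar>G t z - G u z\<bar> \<le> d"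
  shows "\<exists>B\<in>sets lborel. A \<subseteq> B \<and> emeasure lborel B \<le> ennreal (C_mass * d powr s)"
proof (cases "A = {}")
  case True
  then show ?thesis by (intro bexI[of _ "{}"]) auto
next
  case False
  then obtain t0 where t0: "t0 \<in> A" by blast
  have b1: "1 \<le> 8 * real_of_int b" using b_real by simp
  have Bk: "\<exists>B\<in>sets lborel. A \<subseteq> B \<and> emeasure lborel B \<le> ennreal (8 / real_of_int b ^ k)"
    if k: "d < lam ^ k / 4" for k
  proof -
    obtain i where i: "0 \<le> i" "i < b ^ k" "t0 \<in> edge k i" using edge_exists t0 A by blast
    define B where "B = (\<Union>i'\<in>{i'. adj k i i'}. edge k i')"
    have fin: "finite {i'. adj k i i'}" "card {i'. adj k i i'} \<le> 8" using card_adj by auto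
    have "A \<subseteq> B"
    proof
      fix u assume u: "u \<in> A"
      obtain i' where i': "0 \<le> i'" "i' < b ^ k" "u \<in> edge k i'" using edge_exists u A by blast
      have "adj k i i'"
      proof (rule ccontr)
        assume "\<not> adj k i i'"
        then obtain z where "z \<in> coords" "lam ^ k / 4 \<le> \<bar>G t0 z - G u z\<bar>"
          using G_lower i i' by blast
        then show False using close[OF t0 u] k by fastforce
      qed
      then show "u \<in> B" using i' by (auto simp: B_def)
    qed
    moreover have "B \<in> sets lborel" unfolding B_def using fin by (auto simp: edge_def)
    moreover have "emeasure lborel B \<le> ennreal (8 / real_of_int b ^ k)"
    proof -
      have "emeasure lborel B \<le> (\<Sum>i'\<in>{i'. adj k i i'}. emeasure lborel (edge k i'))"
        unfolding B_def by (rule emeasure_subadditive_finite) (use fin in \<open>auto simp: edge_def\<close>)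
      also have "\<dots> = ennreal (card {i'. adj k i i'} * (1 / real_of_int b ^ k))"
        using b_pos by (simp add: emeasure_edge ennreal_mult[symmetric] ennreal_of_nat_eq_real_of_nat)
      also have "\<dots> \<le> ennreal (8 / real_of_int b ^ k)"
        using fin(2) b_pos by (intro ennreal_leI) (simp add: divide_right_mono)
      finally show ?thesis .
    qed
    ultimately show ?thesis by blast
  qed
  show ?thesis
  proof (cases "d < 1 / 4")
    case False
    have "1 \<le> 4 powr s * d powr s"
      using False s_gt by (simp add: powr_mult[symmetric] ge_one_powr_ge_zero)
    then have "1 * 1 \<le> (8 * real_of_int b) * (4 powr s * d powr s)" using b1 by (intro mult_mono) auto
    then show ?thesis using A by (intro bexI[of _ "{0..1}"]) (auto simp: C_mass_def ennreal_1[symmetric] mult.assoc simp del: ennreal_1 intro!: ennreal_leI)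
  next
    case small: True
    have lim0: "(\<lambda>k. lam ^ k / 4) \<longlonglongrightarrow> 0" 
      using tendsto_divide[OF LIMSEQ_realpow_zero[of lam] tendsto_const[of 4]] lam_pos lam_less by simp
    show ?thesis
    proof (cases "d = 0")
      case False
      then have "\<exists>k. lam ^ k / 4 \<le> d" using order_tendstoD(2)[OF lim0, of d] d
        by (metis eventually_sequentially less_eq_real_def order_refl)
      define k where "k = (LEAST k. lam ^ k / 4 \<le> d)"
      have k: "lam ^ k / 4 \<le> d" unfolding k_def by (rule LeastI_ex) fact
      have "k \<noteq> 0" using k small by (intro notI) simp
      then obtain m where m: "k = Suc m" by (cases k) auto
      have "d < lam ^ m / 4" using not_less_Least[of m "\<lambda>k. lam ^ k / 4 \<le> d"] m unfolding k_def by simp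
      then obtain B where B: "B \<in> sets lborel" "A \<subseteq> B" "emeasure lborel B \<le> ennreal (8 / real_of_int b ^ m)"
        using Bk by blast
      have "1 / real_of_int b ^ k = (lam ^ k) powr s" by (simp add: lam_pow_s)
      also have "\<dots> \<le> (4 * d) powr s" using k lam_pos s_gt by (intro powr_mono2) auto
      finally have "1 / real_of_int b ^ k \<le> 4 powr s * d powr s" using d by (simp add: powr_mult)
      then have "8 * b * (1 / real_of_int b ^ k) \<le> C_mass * d powr s"
        unfolding C_mass_def mult.assoc[of _ "4 powr s"] using b_real by (intro mult_left_mono) auto
      moreover have "8 * b * (1 / real_of_int b ^ k) = 8 / real_of_int b ^ m" using b_real by (simp add: m)
      ultimately show ?thesis using B by (intro bexI[of _ B]) (auto intro: order_trans ennreal_leI)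
    next
      \<comment> \<open>For \<open>d = 0\<close> the bound demands a null set, which no single level
        provides, so the covers of all levels are intersected.\<close>
      case True
      then have "\<forall>k. \<exists>B\<in>sets lborel. A \<subseteq> B \<and> emeasure lborel B \<le> ennreal (8 / real_of_int b ^ k)"
        using Bk lam_pos by simp
      then obtain B where B: "\<And>k. B k \<in> sets lborel" "\<And>k. A \<subseteq> B k"
        "\<And>k. emeasure lborel (B k) \<le> ennreal (8 / real_of_int b ^ k)" by metis
      have I: "(\<Inter>k. B k) \<in> sets lborel" using B(1) by auto
      have le: "emeasure lborel (\<Inter>k. B k) \<le> ennreal (8 / real_of_int b ^ k)" for k
      proof -
        have "emeasure lborel (\<Inter>k. B k) \<le> emeasure lborel (B k)" by (rule emeasure_mono) (use B(1) in auto)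
        then show ?thesis using B(3) order_trans by blast
      qed
      have "(\<lambda>k. 8 / real_of_int b ^ k) \<longlonglongrightarrow> 0"
        using tendsto_mult[OF tendsto_const[of 8] LIMSEQ_realpow_zero[of "1 / real_of_int b"]] b_real
        by (simp add: power_one_over)
      then have "(\<lambda>k. ennreal (8 / real_of_int b ^ k)) \<longlonglongrightarrow> ennreal 0" by (rule tendsto_ennrealI)
      then have "emeasure lborel (\<Inter>k. B k) \<le> ennreal 0"
        by (rule LIMSEQ_le_const) (use le in auto)
      then show ?thesis using I B(2) by (intro bexI[of _ "\<Inter>k. B k"]) auto
    qed
  qed
qed

lemma G_holder:
  "\<bar>G t z - G u z\<bar> \<le> (2 * K1 + 2) / lam * \<bar>t - u\<bar> powr (1 / s)"
proof -
  have K: "0 < K1" using lam_less by simp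
  show ?thesis
  proof (cases "t = u")
    case True
    then show ?thesis by simp
  next
    case ne: False
    show ?thesis
    proof (cases "\<bar>t - u\<bar> \<le> 1")
      case False
      then have "1 \<le> \<bar>t - u\<bar> powr (1 / s)" using s_gt by (simp add: ge_one_powr_ge_zero)
      moreover have "2 * K1 + 2 \<le> (2 * K1 + 2) / lam" using lam_pos lam_less K by (simp add: divide_simps)
      ultimately have "(2 * K1 + 2) * 1 \<le> (2 * K1 + 2) / lam * \<bar>t - u\<bar> powr (1 / s)"
        using K lam_pos by (intro mult_mono divide_nonneg_pos) auto
      moreover have "\<bar>G t z - G u z\<bar> \<le> (2 * K1 + 2) * 1"
        using G_bounded[of t z] G_bounded[of u z] unfolding mult_1_right distrib_left by linarith
      ultimately show ?thesis by (rule order_trans[rotated])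
    next
      case True
      have "\<exists>k. 1 < \<bar>t - u\<bar> * real_of_int b ^ k"
      proof -
        obtain k where "1 / \<bar>t - u\<bar> < real_of_int b ^ k" using real_arch_pow[of b] b_real by auto
        then show ?thesis using ne by (intro exI[of _ k]) (simp add: divide_simps mult.commute)
      qed
      define k where "k = (LEAST k. 1 < \<bar>t - u\<bar> * real_of_int b ^ k)"
      have k: "1 < \<bar>t - u\<bar> * real_of_int b ^ k" unfolding k_def by (rule LeastI_ex) fact
      have "k \<noteq> 0" using k True by (intro notI) simp
      then obtain m where m: "k = Suc m" by (cases k) auto
      have "\<bar>t - u\<bar> * real_of_int b ^ m \<le> 1"
        using not_less_Least[of m "\<lambda>k. 1 < \<bar>t - u\<bar> * real_of_int b ^ k"] m unfolding k_def by simp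
      then have "\<bar>G t z - G u z\<bar> \<le> (2 * K1 + 2) * lam ^ m" by (rule G_step)
      also have "\<dots> = (2 * K1 + 2) / lam * lam ^ k" using lam_pos by (simp add: m)
      also have "\<dots> \<le> (2 * K1 + 2) / lam * \<bar>t - u\<bar> powr (1 / s)"
      proof (rule mult_left_mono)
        have "lam ^ k = ((lam ^ k) powr s) powr (1 / s)" using lam_pos s_gt by (simp add: powr_powr)
        also have "\<dots> = (1 / real_of_int b ^ k) powr (1 / s)" by (simp only: lam_pow_s)
        also have "\<dots> \<le> \<bar>t - u\<bar> powr (1 / s)"
          using k b_real s_gt by (intro powr_mono2) (auto simp: divide_simps)
        finally show "lam ^ k \<le> \<bar>t - u\<bar> powr (1 / s)" .
        show "0 \<le> (2 * K1 + 2) / lam" using K lam_pos by (intro divide_nonneg_pos) auto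
      qed
      finally show ?thesis .
    qed
  qed
qed

end

subsection \<open>A topological invariant of lines with loops\<close>

text \<open>Two connected sets are allowed to cover the complement, and they may overlap. This
  excludes ordinary points of a line and interior points of a loop alike: the images of the two open
  half-lines of parameters are such sets.\<close>

definition triple_points :: "'a topology \<Rightarrow> 'a set" where
  "triple_points X = {p \<in> topspace X.
     \<nexists>C D. connectedin X C \<and> connectedin X D \<and> C \<union> D = topspace X - {p}}"

lemma homeomorphic_maps_triple_points:
  assumes "homeomorphic_maps X Y f g"
  shows "f ` triple_points X \<subseteq> triple_points Y"
proof
  fix y assume "y \<in> f ` triple_points X"
  then obtain p where p: "p \<in> triple_points X" "y = f p" by blast
  have f: "homeomorphic_map X Y f" and g: "homeomorphic_map Y X g"
    using assms homeomorphic_maps_map by blast+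
  have pX: "p \<in> topspace X" using p by (simp add: triple_points_def)
  have fg: "\<And>x. x \<in> topspace X \<Longrightarrow> g (f x) = x" "\<And>y. y \<in> topspace Y \<Longrightarrow> f (g y) = y"
    and fX: "\<And>x. x \<in> topspace X \<Longrightarrow> f x \<in> topspace Y" "\<And>y. y \<in> topspace Y \<Longrightarrow> g y \<in> topspace X"
    using assms by (auto simp: homeomorphic_maps_def continuous_map_def)
  show "y \<in> triple_points Y"
    unfolding triple_points_def mem_Collect_eq
  proof (intro conjI notI)
    show "y \<in> topspace Y" using fX pX p by simp
    assume "\<exists>C D. connectedin Y C \<and> connectedin Y D \<and> C \<union> D = topspace Y - {y}"
    then obtain C D where CD: "connectedin Y C" "connectedin Y D" "C \<union> D = topspace Y - {y}" by blast
    have "connectedin X (g ` C)" "connectedin X (g ` D)"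
      using CD homeomorphic_map_connectedness_eq[OF g] by blast+
    moreover have "g ` C \<union> g ` D = topspace X - {p}"
    proof -
      have "g ` C \<union> g ` D = g ` (topspace Y - {y})" by (simp add: CD(3)[symmetric] image_Un)
      also have "\<dots> = topspace X - {p}"
      proof (intro equalityI subsetI)
        fix x assume "x \<in> g ` (topspace Y - {y})"
        then obtain y' where "y' \<in> topspace Y" "y' \<noteq> y" "x = g y'" by blast
        then show "x \<in> topspace X - {p}" using fg(2) fX(2) p(2) by auto
      next
        fix x assume x: "x \<in> topspace X - {p}"
        then have "f x \<noteq> y" using fg(1) pX p(2) by (metis Diff_iff singletonI)
        then have "f x \<in> topspace Y - {y}" "x = g (f x)" using x fg(1)[of x] fX(1)[of x] by auto
        then show "x \<in> g ` (topspace Y - {y})" by (rule rev_image_eqI)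
      qed
      finally show ?thesis .
    qed
    ultimately show False using p unfolding triple_points_def by blast
  qed
qed

lemma homeomorphic_space_card_triple_points:
  assumes "X homeomorphic_space Y"
  shows "card (triple_points X) = card (triple_points Y)"
proof -
  obtain f g where fg: "homeomorphic_maps X Y f g" using assms homeomorphic_space_def by blast
  have 1: "f ` triple_points X \<subseteq> triple_points Y" by (rule homeomorphic_maps_triple_points[OF fg])
  have 2: "g ` triple_points Y \<subseteq> triple_points X"
    by (rule homeomorphic_maps_triple_points) (use fg homeomorphic_maps_sym in blast)
  have inv: "\<And>x. x \<in> topspace X \<Longrightarrow> g (f x) = x" "\<And>y. y \<in> topspace Y \<Longrightarrow> f (g y) = y"
    using fg by (auto simp: homeomorphic_maps_def)
  have sub: "triple_points X \<subseteq> topspace X" "triple_points Y \<subseteq> topspace Y" by (auto simp: triple_points_def)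
  have "bij_betw f (triple_points X) (triple_points Y)"
  proof (rule bij_betw_byWitness[where f' = g])
    show "\<forall>a\<in>triple_points X. g (f a) = a" using inv(1) sub(1) by blast
    show "\<forall>a\<in>triple_points Y. f (g a) = a" using inv(2) sub(2) by blast
  qed (rule 1 2)+
  then show ?thesis by (rule bij_betw_same_card)
qed

text \<open>Properness makes images of closed parameter sets closed; their complements are the open
  sets of the separation argument.\<close>

locale proper_curve =
  fixes N :: nat and \<gamma> :: "real \<Rightarrow> nat \<Rightarrow> real"
  assumes continuous: "continuous_map euclideanreal (eucl_top N) \<gamma>"
    and proper: "\<And>R. \<exists>\<rho>. \<forall>\<tau>. eucl_dist N (\<lambda>i. 0) (\<gamma> \<tau>) \<le> R \<longrightarrow> \<bar>\<tau>\<bar> \<le> \<rho>"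
begin

sublocale M: Metric_space "RN N" "eucl_dist N" by (rule RN_metric)

lemma topspace_eucl: "topspace (eucl_top N) = RN N"
  by (simp add: eucl_top_def)

lemma gam_RN: "\<gamma> \<tau> \<in> RN N"
  using continuous topspace_eucl by (auto simp: continuous_map_def)

lemma closed_image:
  assumes "closed S"
  shows "closedin (eucl_top N) (\<gamma> ` S)"
  unfolding eucl_top_def M.closedin_metric
proof (intro conjI allI impI)
  show "\<gamma> ` S \<subseteq> RN N" using gam_RN by auto
  fix x assume x: "x \<in> RN N - \<gamma> ` S"
  obtain \<rho> where \<rho>: "\<And>\<tau>. eucl_dist N (\<lambda>i. 0) (\<gamma> \<tau>) \<le> eucl_dist N (\<lambda>i. 0) x + 1 \<Longrightarrow> \<bar>\<tau>\<bar> \<le> \<rho>"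
    using proper[of "eucl_dist N (\<lambda>i. 0) x + 1"] by blast
  have "compactin euclideanreal (S \<inter> {-\<rho>..\<rho>})"
    using assms by (simp add: closed_Int_compact)
  then have "compactin M.mtopology (\<gamma> ` (S \<inter> {-\<rho>..\<rho>}))"
    using continuous image_compactin unfolding eucl_top_def by blast
  then have "closedin M.mtopology (\<gamma> ` (S \<inter> {-\<rho>..\<rho>}))"
    using compactin_imp_closedin M.Hausdorff_space_mtopology by blast
  then obtain r where r: "0 < r" "disjnt (\<gamma> ` (S \<inter> {-\<rho>..\<rho>})) (M.mball x r)"
    using x unfolding M.closedin_metric by blast
  have "disjnt (\<gamma> ` S) (M.mball x (min r 1))"
  proof (rule ccontr)
    assume "\<not> ?thesis"
    then obtain \<tau> where \<tau>: "\<tau> \<in> S" "\<gamma> \<tau> \<in> M.mball x (min r 1)" unfolding disjnt_def by blast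
    then have "eucl_dist N (\<lambda>i. 0) (\<gamma> \<tau>) \<le> eucl_dist N (\<lambda>i. 0) x + 1"
      using eucl_dist_triangle[of N "\<lambda>i. 0" "\<gamma> \<tau>" x] by simp
    then have "\<gamma> \<tau> \<in> \<gamma> ` (S \<inter> {-\<rho>..\<rho>})" using \<rho> \<tau> by force
    moreover have "\<gamma> \<tau> \<in> M.mball x r" using \<tau> by auto
    ultimately show False using r by (auto simp: disjnt_def)
  qed
  then show "\<exists>r>0. disjnt (\<gamma> ` S) (M.mball x r)" using r(1) by (intro exI[of _ "min r 1"]) auto
qed

abbreviation T :: "(nat \<Rightarrow> real) topology" where
  "T \<equiv> subtopology (eucl_top N) (range \<gamma>)"

lemma topspace_T: "topspace T = range \<gamma>"
  using gam_RN topspace_eucl by auto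

lemma connected_image: "connected I \<Longrightarrow> connectedin T (\<gamma> ` I)"
  unfolding connectedin_subtopology
  using connectedin_continuous_map_image[OF continuous, of I] by auto

lemma open_compl_image: "closed S \<Longrightarrow> openin T (range \<gamma> - \<gamma> ` S)"
proof -
  assume "closed S"
  then have "closedin T (\<gamma> ` S)" by (intro closedin_subset_topspace closed_image) auto
  then show ?thesis using openin_diff[OF openin_topspace[of T]] unfolding topspace_T by (simp only:)
qed

text \<open>Removing the base point of a loop leaves the part before it, the open loop and the part
  after it: three disjoint nonempty open sets, of which a connected set meets at most one. Gaps
  larger than 1 keep the other loops, of parameter length 1, from joining two of these
  parts.\<close>

lemma triple_points_curve:
  assumes sep: "\<And>a a'. a \<in> A \<Longrightarrow> a' \<in> A \<Longrightarrow> a \<noteq> a' \<Longrightarrow> 1 < \<bar>a - a'\<bar>"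
    and fib: "\<And>\<tau> \<tau>'. \<gamma> \<tau> = \<gamma> \<tau>' \<longleftrightarrow> \<tau> = \<tau>' \<or> \<tau> \<in> A \<and> \<tau>' = \<tau> + 1 \<or> \<tau>' \<in> A \<and> \<tau> = \<tau>' + 1"
  shows "triple_points T = \<gamma> ` A"
proof
  show "triple_points T \<subseteq> \<gamma> ` A"
  proof (rule ccontr)
    assume "\<not> ?thesis"
    then obtain p where p: "p \<in> triple_points T" "p \<notin> \<gamma> ` A" by blast
    then obtain \<tau> where \<tau>: "p = \<gamma> \<tau>" unfolding triple_points_def topspace_T by blast
    have "\<gamma> (\<tau> - 1) = \<gamma> \<tau>" if "\<tau> - 1 \<in> A" using fib[of "\<tau> - 1" \<tau>] that by simp
    then have "\<tau> \<notin> A" "\<tau> - 1 \<notin> A" using p(2) \<tau> by (auto simp: image_iff)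
    then have one: "\<gamma> \<tau>' = p \<longleftrightarrow> \<tau>' = \<tau>" for \<tau>' using fib[of \<tau>' \<tau>] \<tau> by auto
    have "\<gamma> ` {..<\<tau>} \<union> \<gamma> ` {\<tau><..} = topspace T - {p}"
    proof -
      have "\<gamma> ` {..<\<tau>} \<union> \<gamma> ` {\<tau><..} = \<gamma> ` (UNIV - {\<tau>})" by (auto simp: image_Un[symmetric]) 
      also have "\<dots> = range \<gamma> - {p}" using one by auto
      finally show ?thesis unfolding topspace_T .
    qed
    moreover have "connectedin T (\<gamma> ` {..<\<tau>})" "connectedin T (\<gamma> ` {\<tau><..})"
      by (auto intro: connected_image)
    ultimately show False using p unfolding triple_points_def by blast
  qed
next
  show "\<gamma> ` A \<subseteq> triple_points T"
  proof
    fix p assume "p \<in> \<gamma> ` A"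
    then obtain a where a: "a \<in> A" "p = \<gamma> a" by blast
    \<comment> \<open>Writing the three parts as complements of closed images makes them open at
      once; the fibre condition then shows which parameters they contain.\<close>
    define S1 where "S1 = range \<gamma> - \<gamma> ` {a..}"
    define S2 where "S2 = range \<gamma> - \<gamma> ` ({..a} \<union> {a + 1..})"
    define S3 where "S3 = range \<gamma> - \<gamma> ` {..a + 1}"
    have op: "openin T S1" "openin T S2" "openin T S3"
      unfolding S1_def S2_def S3_def by (auto intro!: open_compl_image)
    have in1: "\<gamma> \<tau> \<in> S1" if "\<tau> < a" for \<tau>
      using that fib[of \<tau>] a(1) sep[of a \<tau>] by (force simp: S1_def image_iff)
    have in2: "\<gamma> \<tau> \<in> S2" if "a < \<tau>" "\<tau> < a + 1" for \<tau>
      using that fib[of \<tau>] a(1) sep[of a \<tau>] sep[of a "\<tau> - 1"] by (force simp: S2_def image_iff)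
    have in3: "\<gamma> \<tau> \<in> S3" if "a + 1 < \<tau>" for \<tau>
      using that fib[of \<tau>] a(1) sep[of a \<tau>] sep[of a "\<tau> - 1"] by (force simp: S3_def image_iff)
    have cover: "range \<gamma> - {p} \<subseteq> S1 \<union> S2 \<union> S3"
    proof
      fix y assume "y \<in> range \<gamma> - {p}"
      then obtain \<tau> where \<tau>: "y = \<gamma> \<tau>" "\<gamma> \<tau> \<noteq> \<gamma> a" using a by auto
      then have "\<tau> \<noteq> a" "\<tau> \<noteq> a + 1" using fib[of \<tau> a] a by auto
      then consider "\<tau> < a" | "a < \<tau>" "\<tau> < a + 1" | "a + 1 < \<tau>" by linarith
      then show "y \<in> S1 \<union> S2 \<union> S3" using in1 in2 in3 \<tau> by cases auto
    qed
    have disj: "S1 \<inter> S2 = {}" "S1 \<inter> S3 = {}" "S2 \<inter> S3 = {}"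
    proof -
      have "S1 \<inter> S2 = range \<gamma> - \<gamma> ` ({a..} \<union> ({..a} \<union> {a + 1..}))"
        "S1 \<inter> S3 = range \<gamma> - \<gamma> ` ({a..} \<union> {..a + 1})"
        "S2 \<inter> S3 = range \<gamma> - \<gamma> ` (({..a} \<union> {a + 1..}) \<union> {..a + 1})"
        unfolding S1_def S2_def S3_def by blast+
      moreover have "{a..} \<union> ({..a} \<union> {a + 1..}) = UNIV" "{a..} \<union> {..a + 1} = UNIV"
        "({..a} \<union> {a + 1..}) \<union> {..a + 1} = UNIV" by auto
      ultimately show "S1 \<inter> S2 = {}" "S1 \<inter> S3 = {}" "S2 \<inter> S3 = {}" by simp_all
    qed
    have one: "(C \<inter> S1 = {} \<or> C \<inter> S2 = {}) \<and> (C \<inter> S1 = {} \<or> C \<inter> S3 = {}) \<and> (C \<inter> S2 = {} \<or> C \<inter> S3 = {})"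
      if C: "connectedin T C" "C \<subseteq> range \<gamma> - {p}" for C
    proof -
      have sep2: "C \<inter> E1 = {} \<or> C \<inter> E2 = {}" if "openin T E1" "openin T E2" "C \<subseteq> E1 \<union> E2" "E1 \<inter> E2 = {}" for E1 E2
        using connectedinD[OF C(1) that(1,2,3)] that(4) by blast
      have "C \<subseteq> S1 \<union> S2 \<union> S3" using C cover by blast
      then show ?thesis
        using sep2[OF op(1) openin_Un[OF op(2,3)]] sep2[OF op(2) openin_Un[OF op(1,3)]]
          sep2[OF op(3) openin_Un[OF op(1,2)]] disj by blast
    qed
    have x: "\<gamma> (a - 1) \<in> S1" "\<gamma> (a + 1 / 2) \<in> S2" "\<gamma> (a + 2) \<in> S3" using in1 in2 in3 by auto
    have np: "\<gamma> (a - 1) \<noteq> p" "\<gamma> (a + 1 / 2) \<noteq> p" "\<gamma> (a + 2) \<noteq> p"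
    proof -
      have "p \<notin> S1" "p \<notin> S2" "p \<notin> S3" unfolding a(2) S1_def S2_def S3_def by auto
      then show "\<gamma> (a - 1) \<noteq> p" "\<gamma> (a + 1 / 2) \<noteq> p" "\<gamma> (a + 2) \<noteq> p" using x by metis+
    qed
    show "p \<in> triple_points T"
      unfolding triple_points_def mem_Collect_eq topspace_T
    proof (intro conjI notI)
      show "p \<in> range \<gamma>" using a by simp
      assume "\<exists>C D. connectedin T C \<and> connectedin T D \<and> C \<union> D = range \<gamma> - {p}"
      then obtain C D where CD: "connectedin T C" "connectedin T D" "C \<union> D = range \<gamma> - {p}" by blast
      have "\<gamma> (a - 1) \<in> C \<union> D" "\<gamma> (a + 1 / 2) \<in> C \<union> D" "\<gamma> (a + 2) \<in> C \<union> D" using np CD by auto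
      moreover have "C \<subseteq> range \<gamma> - {p}" "D \<subseteq> range \<gamma> - {p}" using CD by auto
      ultimately show False using one[OF CD(1)] one[OF CD(2)] x by blast
    qed
  qed
qed

end

subsection \<open>Attouch-Wets limits of curves\<close>

lemma exc_le:
  assumes "\<And>a. a \<in> A \<Longrightarrow> \<exists>b\<in>B. eucl_dist N a b \<le> e"
  shows "exc N A B \<le> ennreal e"
  unfolding exc_def
proof (rule SUP_least)
  fix a assume "a \<in> A"
  then obtain b where "b \<in> B" "eucl_dist N a b \<le> e" using assms by blast
  then show "(INF b\<in>B. ennreal (eucl_dist N a b)) \<le> ennreal e" by (meson INF_lower2 ennreal_leI)
qed

lemma tendsto_0_ennrealI:
  fixes f :: "nat \<Rightarrow> ennreal"
  assumes "\<And>e::real. 0 < e \<Longrightarrow> eventually (\<lambda>m. f m \<le> ennreal e) sequentially"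
  shows "f \<longlonglongrightarrow> 0"
proof (rule order_tendstoI)
  fix a :: ennreal assume "0 < a"
  then obtain c where c: "0 < c" "c < a" using dense by blast
  then have "c < top" by (meson less_le_trans top_greatest)
  then have e: "c = ennreal (enn2real c)" "0 < enn2real c" using c by (auto simp: enn2real_positive_iff)
  show "eventually (\<lambda>m. f m < a) sequentially"
    using assms[OF e(2)] by eventually_elim (use c e in auto)
qed auto

text \<open>\<open>F_proper\<close> concerns every parameter in \<open>J m\<close>: it keeps remote
  pieces of the curves from returning to a fixed ball, which uniform convergence on bounded
  intervals cannot detect. \<open>J m\<close> stands for the parameter interval of a rescaled
  compact curve.\<close>

locale curve_limit =
  fixes N :: nat and F :: "nat \<Rightarrow> real \<Rightarrow> nat \<Rightarrow> real" and \<gamma> :: "real \<Rightarrow> nat \<Rightarrow> real"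
    and J :: "nat \<Rightarrow> real set"
  assumes F_RN: "\<And>m \<tau>. F m \<tau> \<in> RN N" and gam_RN: "\<And>\<tau>. \<gamma> \<tau> \<in> RN N"
    and gam_cont: "continuous_map euclideanreal (eucl_top N) \<gamma>"
    and F_cont: "\<And>m. continuous_map euclideanreal (eucl_top N) (F m)"
    and J_compact: "\<And>m. compact (J m)" and J_ne: "\<And>m. J m \<noteq> {}"
    and unif: "\<And>\<rho> e. 0 < e \<Longrightarrow>
      eventually (\<lambda>m. \<forall>\<tau>. \<bar>\<tau>\<bar> \<le> \<rho> \<longrightarrow> eucl_dist N (F m \<tau>) (\<gamma> \<tau>) \<le> e) sequentially"
    and F_proper: "\<And>R. \<exists>\<rho>. eventually (\<lambda>m. \<forall>\<tau>\<in>J m. eucl_dist N (\<lambda>i. 0) (F m \<tau>) \<le> R \<longrightarrow> \<bar>\<tau>\<bar> \<le> \<rho>) sequentially"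
    and J_exhaust: "\<And>\<rho>. eventually (\<lambda>m. {-\<rho>..\<rho>} \<subseteq> J m) sequentially"
begin

lemma gam_proper: "\<exists>\<rho>. \<forall>\<tau>. eucl_dist N (\<lambda>i. 0) (\<gamma> \<tau>) \<le> R \<longrightarrow> \<bar>\<tau>\<bar> \<le> \<rho>"
proof -
  obtain \<rho> where \<rho>: "eventually (\<lambda>m. \<forall>\<tau>\<in>J m. eucl_dist N (\<lambda>i. 0) (F m \<tau>) \<le> R + 1 \<longrightarrow> \<bar>\<tau>\<bar> \<le> \<rho>) sequentially"
    using F_proper by blast
  have "\<bar>\<tau>\<bar> \<le> \<rho>" if "eucl_dist N (\<lambda>i. 0) (\<gamma> \<tau>) \<le> R" for \<tau>
  proof -
    have "eventually (\<lambda>m. \<bar>\<tau>\<bar> \<le> \<rho>) sequentially"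
      using \<rho> J_exhaust[of "\<bar>\<tau>\<bar>"] unif[of 1 "\<bar>\<tau>\<bar>", OF zero_less_one]
    proof eventually_elim
      case (elim m)
      have "eucl_dist N (F m \<tau>) (\<gamma> \<tau>) \<le> 1" using elim(3) by simp
      then have "eucl_dist N (\<lambda>i. 0) (F m \<tau>) \<le> R + 1"
        using eucl_dist_triangle[of N "\<lambda>i. 0" "F m \<tau>" "\<gamma> \<tau>"] that eucl_dist_commute[of N "F m \<tau>" "\<gamma> \<tau>"] by linarith
      moreover have "\<tau> \<in> J m" using elim(2) by (rule subsetD) auto
      ultimately show ?case using elim(1) by blast
    qed
    then show ?thesis by simp
  qed
  then show ?thesis by blast
qed

sublocale proper_curve N \<gamma>
  by unfold_locales (use gam_cont gam_proper in auto)

lemma AW_limit: "AW_converges N (\<lambda>m. F m ` J m) (range \<gamma>)"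
  unfolding AW_converges_def
proof (intro conjI allI impI)
  fix m show "F m ` J m \<noteq> {}" using J_ne by simp
  have "compactin (eucl_top N) (F m ` J m)"
    using image_compactin[OF _ F_cont, of "J m" m] J_compact by simp
  then show "closedin (eucl_top N) (F m ` J m)"
    using compactin_imp_closedin M.Hausdorff_space_mtopology unfolding eucl_top_def by blast
next
  show "range \<gamma> \<noteq> {}" by simp
  show "closedin (eucl_top N) (range \<gamma>)" using closed_image[of UNIV] by simp
next
  fix r :: real assume "0 < r"
  show "(\<lambda>m. exc N (F m ` J m \<inter> closed_ball0 N r) (range \<gamma>)) \<longlonglongrightarrow> 0"
  proof (rule tendsto_0_ennrealI)
    fix e :: real assume "0 < e"
    obtain \<rho> where "eventually (\<lambda>m. \<forall>\<tau>\<in>J m. eucl_dist N (\<lambda>i. 0) (F m \<tau>) \<le> r \<longrightarrow> \<bar>\<tau>\<bar> \<le> \<rho>) sequentially"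
      using F_proper by blast
    then show "eventually (\<lambda>m. exc N (F m ` J m \<inter> closed_ball0 N r) (range \<gamma>) \<le> ennreal e) sequentially"
      using unif[OF \<open>0 < e\<close>, of \<rho>]
    proof eventually_elim
      case (elim m)
      show ?case
      proof (rule exc_le)
        fix a assume "a \<in> F m ` J m \<inter> closed_ball0 N r"
        then obtain \<tau> where "\<tau> \<in> J m" "a = F m \<tau>" "eucl_dist N (\<lambda>i. 0) (F m \<tau>) \<le> r"
          by (auto simp: closed_ball0_def)
        then show "\<exists>b\<in>range \<gamma>. eucl_dist N a b \<le> e" using elim by blast
      qed
    qed
  qed
  show "(\<lambda>m. exc N (range \<gamma> \<inter> closed_ball0 N r) (F m ` J m)) \<longlonglongrightarrow> 0"
  proof (rule tendsto_0_ennrealI)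
    fix e :: real assume "0 < e"
    obtain \<rho> where \<rho>: "\<forall>\<tau>. eucl_dist N (\<lambda>i. 0) (\<gamma> \<tau>) \<le> r \<longrightarrow> \<bar>\<tau>\<bar> \<le> \<rho>" using gam_proper by blast
    show "eventually (\<lambda>m. exc N (range \<gamma> \<inter> closed_ball0 N r) (F m ` J m) \<le> ennreal e) sequentially"
      using unif[OF \<open>0 < e\<close>, of \<rho>] J_exhaust[of \<rho>]
    proof eventually_elim
      case (elim m)
      show ?case
      proof (rule exc_le)
        fix a assume "a \<in> range \<gamma> \<inter> closed_ball0 N r"
        then obtain \<tau> where \<tau>: "a = \<gamma> \<tau>" "eucl_dist N (\<lambda>i. 0) (\<gamma> \<tau>) \<le> r" by (auto simp: closed_ball0_def)
        then have "\<bar>\<tau>\<bar> \<le> \<rho>" using \<rho> by blast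
        then have "\<tau> \<in> J m" "eucl_dist N a (F m \<tau>) \<le> e"
          using elim \<tau> eucl_dist_commute[of N a] by (auto simp: abs_le_iff)
        then show "\<exists>b\<in>F m ` J m. eucl_dist N a b \<le> e" by blast
      qed
    qed
  qed
qed

text \<open>Meant for the base point of the blow-ups, which every curve attains at a bounded
  parameter that may change with \<open>m\<close>.\<close>

lemma limit_point:
  assumes "\<And>m. \<exists>\<tau>. \<bar>\<tau>\<bar> \<le> \<rho> \<and> F m \<tau> = x" "x \<in> RN N"
  shows "x \<in> range \<gamma>"
proof (rule ccontr)
  assume "x \<notin> range \<gamma>"
  moreover have "closedin M.mtopology (range \<gamma>)" using closed_image[of UNIV] by (simp add: eucl_top_def)
  ultimately obtain r where r: "0 < r" "disjnt (range \<gamma>) (M.mball x r)"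
    using assms(2) unfolding M.closedin_metric by blast
  have "eventually (\<lambda>m. \<forall>\<tau>. \<bar>\<tau>\<bar> \<le> \<rho> \<longrightarrow> eucl_dist N (F m \<tau>) (\<gamma> \<tau>) \<le> r / 2) sequentially"
    by (rule unif) (use r in simp)
  then obtain m where m: "\<forall>\<tau>. \<bar>\<tau>\<bar> \<le> \<rho> \<longrightarrow> eucl_dist N (F m \<tau>) (\<gamma> \<tau>) \<le> r / 2"
    unfolding eventually_sequentially by blast
  obtain \<tau> where "\<bar>\<tau>\<bar> \<le> \<rho>" "F m \<tau> = x" using assms(1) by blast
  then have "\<gamma> \<tau> \<in> M.mball x r" using m r assms(2) gam_RN by force
  then show False using r unfolding disjnt_def by blast
qed

end

text \<open>Arzela-Ascoli on the line: a diagonal subsequence converges at rational parameters, and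
  the common modulus of continuity spreads this to uniform convergence on bounded intervals.\<close>

lemma equicontinuous_subsequence:
  fixes F :: "nat \<Rightarrow> real \<Rightarrow> nat \<Rightarrow> real"
  assumes "0 < a" and eq: "\<And>p \<tau> \<tau>' i. \<bar>F p \<tau> i - F p \<tau>' i\<bar> \<le> C * \<bar>\<tau> - \<tau>'\<bar> powr a"
    and bd: "\<And>\<tau>. \<exists>B. \<forall>p i. \<bar>F p \<tau> i\<bar> \<le> B"
  obtains r \<gamma> where "strict_mono (r :: nat \<Rightarrow> nat)"
    "\<And>\<rho> e i. 0 < e \<Longrightarrow> eventually (\<lambda>p. \<forall>\<tau>. \<bar>\<tau>\<bar> \<le> \<rho> \<longrightarrow> \<bar>F (r p) \<tau> i - \<gamma> \<tau> i\<bar> \<le> e) sequentially"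
    "\<And>\<tau> i. (\<lambda>p. F (r p) \<tau> i) \<longlonglongrightarrow> \<gamma> \<tau> i"
proof -
  obtain B where B: "\<And>\<tau> p i. \<bar>F p \<tau> i\<bar> \<le> B \<tau>" using bd by metis
  \<comment> \<open>The diagonal argument asks for one bound on all values, so each value is divided
    by the bound belonging to its parameter.\<close>
  define f where "f p x = F p (fst x) (snd x) / (B (fst x) + 1)" for p :: nat and x :: "real \<times> nat"
  have Bpos: "0 \<le> B \<tau>" for \<tau> using B[of 0 \<tau> 0] by linarith
  have "norm (f p x) \<le> 1" for p x
    using B[of p "fst x" "snd x"] Bpos[of "fst x"] by (simp add: f_def)
  moreover have "countable (\<rat> \<times> UNIV :: (real \<times> nat) set)" using countable_rat by (intro countable_SIGMA) auto
  ultimately obtain r where r: "strict_mono r" "\<And>x. x \<in> \<rat> \<times> UNIV \<Longrightarrow> \<exists>l. (\<lambda>n. f (r n) x) \<longlonglongrightarrow> l"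
    using function_convergent_subsequence[of "\<rat> \<times> UNIV" f 1] by blast
  have conv: "convergent (\<lambda>p. F (r p) q i)" if q: "q \<in> \<rat>" for q i
  proof -
    obtain l where "(\<lambda>n. f (r n) (q, i)) \<longlonglongrightarrow> l" using r(2)[of "(q, i)"] q by auto
    then have "(\<lambda>n. f (r n) (q, i) * (B q + 1)) \<longlonglongrightarrow> l * (B q + 1)" by (intro tendsto_intros)
    moreover have "f (r n) (q, i) * (B q + 1) = F (r n) q i" for n using Bpos[of q] by (simp add: f_def)
    ultimately show ?thesis by (auto simp: convergent_def)
  qed
  define \<omega> where "\<omega> d = C * d powr a" for d
  have \<omega>: "\<exists>\<delta>>0. \<forall>d. 0 \<le> d \<longrightarrow> d < \<delta> \<longrightarrow> \<omega> d \<le> e" if "0 < e" for e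
  proof -
    have "((\<lambda>d. C * d powr a) \<longlongrightarrow> C * 0 powr a) (at 0 within {0..})"
      using \<open>0 < a\<close> by (intro tendsto_mult tendsto_const tendsto_powr2 tendsto_ident_at) (auto simp: eventually_at_filter)
    then have "eventually (\<lambda>d. \<omega> d < e) (at 0 within {0..})"
      unfolding \<omega>_def using that by (intro order_tendstoD(2)[of _ "C * 0 powr a"]) auto
    then obtain \<delta> where "0 < \<delta>" "\<And>d. 0 \<le> d \<Longrightarrow> d \<noteq> 0 \<Longrightarrow> d < \<delta> \<Longrightarrow> \<omega> d < e"
      unfolding eventually_at by (auto simp: dist_real_def)
    moreover have "\<omega> 0 \<le> e" using that by (simp add: \<omega>_def)
    ultimately show ?thesis by (metis less_imp_le)
  qed
  have ucauchy: "\<exists>P. \<forall>p\<ge>P. \<forall>p'\<ge>P. \<forall>\<tau>. \<bar>\<tau>\<bar> \<le> \<rho> \<longrightarrow> \<bar>F (r p) \<tau> i - F (r p') \<tau> i\<bar> \<le> e"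
    if e: "0 < e" for e \<rho> i
  proof -
    obtain \<delta> where \<delta>: "0 < \<delta>" "\<And>d. 0 \<le> d \<Longrightarrow> d < \<delta> \<Longrightarrow> \<omega> d \<le> e / 3" using \<omega>[of "e / 3"] e by auto
    have "{-\<rho>..\<rho>} \<subseteq> (\<Union>q\<in>\<rat>. ball q \<delta>)"
    proof
      fix x assume "x \<in> {-\<rho>..\<rho>}"
      obtain q where "q \<in> \<rat>" "x - \<delta> < q" "q < x + \<delta>" using Rats_dense_in_real[of "x - \<delta>" "x + \<delta>"] \<delta> by auto
      then show "x \<in> (\<Union>q\<in>\<rat>. ball q \<delta>)" by (auto simp: dist_real_def intro!: bexI[of _ q])
    qed
    then obtain Q where Q: "Q \<subseteq> \<rat>" "finite Q" "{-\<rho>..\<rho>} \<subseteq> (\<Union>q\<in>Q. ball q \<delta>)"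
      using compactE_image[of "{-\<rho>..\<rho>}" \<rat> "\<lambda>q. ball q \<delta>"] by auto
    have "\<exists>P. \<forall>p\<ge>P. \<forall>p'\<ge>P. \<bar>F (r p) q i - F (r p') q i\<bar> < e / 3" if "q \<in> Q" for q
    proof -
      have "Cauchy (\<lambda>p. F (r p) q i)" using conv[of q i] that Q convergent_Cauchy by blast
      then show ?thesis using e unfolding Cauchy_def dist_real_def by (metis divide_pos_pos zero_less_numeral)
    qed
    then obtain P where P: "\<And>q p p'. q \<in> Q \<Longrightarrow> P q \<le> p \<Longrightarrow> P q \<le> p' \<Longrightarrow> \<bar>F (r p) q i - F (r p') q i\<bar> < e / 3"
      by metis
    obtain P0 where P0: "\<And>q. q \<in> Q \<Longrightarrow> P q \<le> P0"
      using finite_nat_set_iff_bounded_le[of "P ` Q"] Q(2) by auto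
    show ?thesis
    proof (intro exI[of _ P0] allI impI)
      fix p p' \<tau> assume p: "P0 \<le> p" "P0 \<le> p'" and "\<bar>\<tau>\<bar> \<le> \<rho>"
      then have "\<tau> \<in> {-\<rho>..\<rho>}" by auto
      then obtain q where q: "q \<in> Q" "\<bar>\<tau> - q\<bar> < \<delta>" using Q(3) by (auto simp: dist_real_def abs_minus_commute)
      have "\<omega> \<bar>\<tau> - q\<bar> \<le> e / 3" using \<delta>(2) q by simp
      then have "\<bar>F x \<tau> i - F x q i\<bar> \<le> e / 3" for x using eq[of x \<tau> i q] unfolding \<omega>_def by linarith
      from this[of "r p"] this[of "r p'"] P[OF q(1), of p p'] P0[OF q(1)] p
      show "\<bar>F (r p) \<tau> i - F (r p') \<tau> i\<bar> \<le> e" by linarith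
    qed
  qed
  have "convergent (\<lambda>p. F (r p) \<tau> i)" for \<tau> i
  proof (rule Cauchy_convergent, unfold Cauchy_def, intro allI impI)
    fix e :: real assume "0 < e"
    then obtain P where "\<forall>p\<ge>P. \<forall>p'\<ge>P. \<forall>\<tau>'. \<bar>\<tau>'\<bar> \<le> \<bar>\<tau>\<bar> \<longrightarrow> \<bar>F (r p) \<tau>' i - F (r p') \<tau>' i\<bar> \<le> e / 2"
      using ucauchy[of "e / 2" "\<bar>\<tau>\<bar>" i] by auto
    then show "\<exists>P. \<forall>p\<ge>P. \<forall>p'\<ge>P. dist (F (r p) \<tau> i) (F (r p') \<tau> i) < e"
      using \<open>0 < e\<close> unfolding dist_real_def by (intro exI[of _ P]) force
  qed
  then obtain \<gamma> where \<gamma>: "\<And>\<tau> i. (\<lambda>p. F (r p) \<tau> i) \<longlonglongrightarrow> \<gamma> \<tau> i"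
    unfolding convergent_def by metis
  show thesis
  proof (rule that[OF r(1) _ \<gamma>])
    fix \<rho> e :: real and i :: nat assume "0 < e"
    then obtain P where P: "\<And>p p' \<tau>. P \<le> p \<Longrightarrow> P \<le> p' \<Longrightarrow> \<bar>\<tau>\<bar> \<le> \<rho> \<Longrightarrow> \<bar>F (r p) \<tau> i - F (r p') \<tau> i\<bar> \<le> e"
      using ucauchy by blast
    have "\<bar>F (r p) \<tau> i - \<gamma> \<tau> i\<bar> \<le> e" if "P \<le> p" "\<bar>\<tau>\<bar> \<le> \<rho>" for p \<tau>
    proof (rule LIMSEQ_le_const2)
      show "(\<lambda>p'. \<bar>F (r p) \<tau> i - F (r p') \<tau> i\<bar>) \<longlonglongrightarrow> \<bar>F (r p) \<tau> i - \<gamma> \<tau> i\<bar>"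
        by (intro tendsto_intros \<gamma>)
      show "\<exists>P. \<forall>p'\<ge>P. \<bar>F (r p) \<tau> i - F (r p') \<tau> i\<bar> \<le> e" using P that by blast
    qed
    then show "eventually (\<lambda>p. \<forall>\<tau>. \<bar>\<tau>\<bar> \<le> \<rho> \<longrightarrow> \<bar>F (r p) \<tau> i - \<gamma> \<tau> i\<bar> \<le> e) sequentially"
      unfolding eventually_sequentially by blast
  qed
qed

lemma continuous_eucl_of_holder:
  assumes "\<And>\<tau>. f \<tau> \<in> RN N" "0 < a"
    and "\<And>\<tau> \<tau>' i. \<bar>f \<tau> i - f \<tau>' i\<bar> \<le> C * \<bar>\<tau> - \<tau>'\<bar> powr a"
  shows "continuous_map euclideanreal (eucl_top N) f"
proof -
  interpret Metric_space "RN N" "eucl_dist N" by (rule RN_metric)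
  have "continuous_map euclideanreal mtopology f"
    unfolding continuous_map_to_metric
  proof (intro ballI allI impI)
    fix \<tau> :: real and e :: real assume "0 < e"
    have "((\<lambda>d. N * (C * d powr a)) \<longlongrightarrow> N * (C * 0 powr a)) (at 0 within {0..})"
      using \<open>0 < a\<close> by (intro tendsto_mult tendsto_const tendsto_powr2 tendsto_ident_at) (auto simp: eventually_at_filter)
    then have "eventually (\<lambda>d. N * (C * d powr a) < e) (at 0 within {0..})"
      using \<open>0 < e\<close> by (intro order_tendstoD(2)[of _ "N * (C * 0 powr a)"]) auto
    then obtain \<delta> where \<delta>: "0 < \<delta>" "\<And>d. 0 \<le> d \<Longrightarrow> d \<noteq> 0 \<Longrightarrow> d < \<delta> \<Longrightarrow> N * (C * d powr a) < e"
      unfolding eventually_at by (auto simp: dist_real_def)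
    have "f \<tau>' \<in> mball (f \<tau>) e" if "\<tau>' \<in> ball \<tau> \<delta>" for \<tau>'
    proof (cases "\<tau>' = \<tau>")
      case False
      have "eucl_dist N (f \<tau>) (f \<tau>') \<le> N * (C * \<bar>\<tau> - \<tau>'\<bar> powr a)"
        by (rule eucl_dist_le_bound) (rule assms(3))
      also have "\<dots> < e" using \<delta>(2)[of "\<bar>\<tau> - \<tau>'\<bar>"] False that by (auto simp: dist_real_def)
      finally show ?thesis using assms(1) by simp
    qed (use \<open>0 < e\<close> assms(1) in simp)
    then show "\<exists>U. openin euclideanreal U \<and> \<tau> \<in> U \<and> (\<forall>y\<in>U. f y \<in> mball (f \<tau>) e)"
      using \<delta>(1) by (intro exI[of _ "ball \<tau> \<delta>"]) auto
  qed
  then show ?thesis by (simp add: eucl_top_def)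
qed

subsection \<open>Windows and typical points\<close>

text \<open>\<open>divergent\<close> is the hypothesis of the second Borel-Cantelli lemma for the
  events that all \<open>K w\<close> digits in window \<open>w\<close> are 1, taken over the windows
  with \<open>n w = \<nu>\<close>. \<open>K_lim\<close> pushes every other loop out of sight in the
  tangent.\<close>

locale window_curve = loop_snowflake +
  fixes K n :: "nat \<Rightarrow> nat" and N :: nat and dec :: "nat \<Rightarrow> coord"
  assumes K_pos: "\<And>w. 1 \<le> K w" and K_lim: "filterlim K at_top sequentially"
    and divergent: "\<And>\<nu>. \<not> summable (\<lambda>w. if n w = \<nu> then 1 / real_of_int b ^ K w else 0)"
    and L_windows: "\<And>l q. L l q \<longleftrightarrow> (\<exists>w. l = (\<Sum>i<Suc w. K i) \<and>
       (\<Sum>i<K w. b ^ i) \<le> q mod b ^ K w \<and> q mod b ^ K w < (\<Sum>i<K w. b ^ i) + n w)"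
    and dec: "bij_betw dec {..<N} coords"
begin

definition g :: "real \<Rightarrow> nat \<Rightarrow> real" where
  "g t i = (if i < N then G t (dec i) else 0)"

definition st :: "nat \<Rightarrow> nat" where
  "st w = (\<Sum>i<w. K i)"

definition ones :: "nat \<Rightarrow> int" where
  "ones k = (\<Sum>i<k. b ^ i)"

text \<open>
  Clusters start at the residue \<open>11...1\<close> in base \<open>b\<close>: an edge with these digits never touches a vertex of
  an earlier level of the window, hence stays away from all coarser loops.
\<close>

definition hit :: "real \<Rightarrow> nat \<Rightarrow> bool" where
  "hit t w \<longleftrightarrow> \<lfloor>t * real_of_int b ^ st (Suc w)\<rfloor> mod b ^ K w = ones (K w)"

definition C_holder :: real where "C_holder = (2 * K1 + 2) / lam"

lemma C_holder_pos: "0 < C_holder"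
proof -
  have "0 < K1" using lam_less by simp
  then have "0 < 2 * K1 + 2" by linarith
  then show ?thesis using lam_pos unfolding C_holder_def by (rule divide_pos_pos)
qed

lemma L_iff: "L l q \<longleftrightarrow> (\<exists>w. l = st (Suc w) \<and> ones (K w) \<le> q mod b ^ K w \<and> q mod b ^ K w < ones (K w) + n w)"
  unfolding L_windows st_def ones_def ..

lemma st_Suc: "st (Suc w) = st w + K w"
  by (simp add: st_def)

lemma st_strict: "strict_mono st"
  unfolding strict_mono_Suc_iff using K_pos by (simp add: st_Suc Suc_le_eq)

lemma g_RN: "g t \<in> RN N"
  by (simp add: RN_def g_def)

lemma g_holder: "\<bar>g t i - g u i\<bar> \<le> C_holder * \<bar>t - u\<bar> powr (1 / s)"
  using G_holder[of t "dec i" u] C_holder_pos by (auto simp: g_def C_holder_def)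

lemma g_step:
  assumes "\<bar>t - u\<bar> * real_of_int b ^ k \<le> 1"
  shows "eucl_dist N (g t) (g u) \<le> N * (2 * K1 + 2) * lam ^ k"
proof -
  have "eucl_dist N (g t) (g u) \<le> N * ((2 * K1 + 2) * lam ^ k)"
    by (rule eucl_dist_le_bound) (use G_step[OF assms] in \<open>simp add: g_def\<close>)
  then show ?thesis by (simp add: mult.assoc)
qed

lemma g_coord:
  assumes "z \<in> coords"
  obtains i where "i < N" "\<And>t. g t i = G t z"
  using assms dec unfolding bij_betw_def g_def by (metis imageE lessThan_iff)

lemma g_image_pos: "hausdorff N s (g ` {0..1}) > 0"
proof (rule hausdorff_pos_of_mass)
  show "0 < C_mass" using b_real by (simp add: C_mass_def)
  fix d and A :: "real set"
  assume A: "A \<subseteq> {0..1}" "0 \<le> d" "\<And>t u. t \<in> A \<Longrightarrow> u \<in> A \<Longrightarrow> eucl_dist N (g t) (g u) \<le> d"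
  show "\<exists>B\<in>sets lborel. A \<subseteq> B \<and> emeasure lborel B \<le> ennreal (C_mass * d powr s)"
  proof (rule G_mass[OF A(1,2)])
    fix t u z assume "t \<in> A" "u \<in> A" "z \<in> coords"
    moreover obtain i where "i < N" "\<And>t. g t i = G t z" using g_coord \<open>z \<in> coords\<close> by blast
    ultimately show "\<bar>G t z - G u z\<bar> \<le> d" using A(3) eucl_dist_ge_coord[of i N "g t" "g u"] by force
  qed
qed

lemma ones_Suc: "ones (Suc k) = b * ones k + 1"
proof (induction k)
  case (Suc k)
  have "ones (Suc (Suc k)) = ones (Suc k) + b ^ Suc k" by (simp add: ones_def)
  also have "\<dots> = b * (ones k + b ^ k) + 1" using Suc by (simp add: algebra_simps)
  also have "ones k + b ^ k = ones (Suc k)" by (simp add: ones_def)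
  finally show ?case .
qed (simp add: ones_def)

lemma ones_ge: "int k \<le> ones k"
proof (induction k)
  case (Suc k)
  have "1 \<le> b ^ k" using b_pos by simp
  then show ?case using Suc by (simp add: ones_def)
qed (simp add: ones_def)

text \<open>Leaves room on both sides: in a block of length \<open>b ^ K w\<close>, the position
  \<open>ones (K w)\<close> has at least that many positions to its right.\<close>

lemma ones_double: "2 * ones k \<le> b ^ k"
proof (induction k)
  case (Suc k)
  have "2 * ones (Suc k) = 2 * (b * ones k) + 2" unfolding ones_Suc by simp
  show ?case
  proof (cases k)
    case 0
    then show ?thesis using b_ge by (simp add: ones_def)
  next
    case (Suc k')
    have 1: "ones (Suc k) = ones k + b ^ k" by (simp add: ones_def)
    have "b * b ^ k \<ge> 3 * b ^ k" using b_ge by (intro mult_right_mono) auto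
    then show ?thesis using 1 Suc.IH by simp
  qed
qed (simp add: ones_def)

lemma ones_less: "ones k < b ^ k"
  using ones_double[of k] ones_ge[of k] b_pos by (cases "k = 0") (auto simp: ones_def)

lemma floor_div_pow: "\<lfloor>t * real_of_int b ^ (l + d)\<rfloor> div b ^ d = \<lfloor>t * real_of_int b ^ l\<rfloor>"
  using floor_divide_real_eq_div[of "b ^ d" "t * real_of_int b ^ (l + d)"] b_pos b_nz
  by (simp add: power_add)

section \<open>Almost every point is typical: Borel-Cantelli by counting\<close>

definition miss :: "nat \<Rightarrow> nat \<Rightarrow> real set" where
  "miss \<nu> P = {t \<in> {0..1}. \<forall>w\<ge>P. n w = \<nu> \<longrightarrow> \<not> hit t w}"

text \<open>The discrete counterpart of \<open>miss\<close>; the division recovers the ancestor at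
  the end of window \<open>w'\<close>.\<close>

definition avoid :: "nat \<Rightarrow> nat \<Rightarrow> nat \<Rightarrow> int set" where
  "avoid \<nu> P w = {i. 0 \<le> i \<and> i < b ^ st w \<and> (\<forall>w'. P \<le> w' \<longrightarrow> w' < w \<longrightarrow> n w' = \<nu> \<longrightarrow>
     (i div b ^ (st w - st (Suc w'))) mod b ^ K w' \<noteq> ones (K w'))}"

lemma avoid_finite: "finite (avoid \<nu> P w)"
  by (rule finite_subset[of _ "{0..<b ^ st w}"]) (auto simp: avoid_def)

text \<open>Independence of the windows as a count: window \<open>w\<close> appends
  \<open>K w\<close> free digits to the index, and one of the \<open>b ^ K w\<close> digit strings
  is forbidden if the window counts.\<close>

lemma card_avoid_Suc:
  "card (avoid \<nu> P (Suc w)) \<le> card (avoid \<nu> P w) * (nat (b ^ K w) - (if P \<le> w \<and> n w = \<nu> then 1 else 0))"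
proof -
  define R where "R = {0..<b ^ K w} - (if P \<le> w \<and> n w = \<nu> then {ones (K w)} else {})"
  have B: "0 < b ^ K w" using b_pos by simp
  have cR: "card R = nat (b ^ K w) - (if P \<le> w \<and> n w = \<nu> then 1 else 0)"
    using ones_ge[of "K w"] ones_less[of "K w"] by (auto simp: R_def card_Diff_singleton)
  have "avoid \<nu> P (Suc w) \<subseteq> (\<lambda>(i, r). b ^ K w * i + r) ` (avoid \<nu> P w \<times> R)"
  proof
    fix j assume j: "j \<in> avoid \<nu> P (Suc w)"
    define i where "i = j div b ^ K w"
    define r where "r = j mod b ^ K w"
    have "0 \<le> i" using j B by (simp add: i_def avoid_def pos_imp_zdiv_nonneg_iff)
    moreover have "i < b ^ st w"
    proof -
      have "b ^ K w * i \<le> j" 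
        using pos_mod_sign[OF B, of j] mult_div_mod_eq[of "b ^ K w" j] unfolding i_def by linarith
      also have "j < b ^ K w * b ^ st w" using j by (simp add: avoid_def st_Suc power_add mult.commute)
      finally show ?thesis using B by simp
    qed
    moreover have "(i div b ^ (st w - st (Suc w'))) mod b ^ K w' \<noteq> ones (K w')"
      if w': "P \<le> w'" "w' < w" "n w' = \<nu>" for w'
    proof -
      have "st (Suc w') \<le> st w" using w' st_strict by (simp add: strict_mono_less_eq)
      then have e: "st (Suc w) - st (Suc w') = K w + (st w - st (Suc w'))" by (simp add: st_Suc)
      have "i div b ^ (st w - st (Suc w')) = j div b ^ (st (Suc w) - st (Suc w'))"
        unfolding e power_add i_def by (rule zdiv_zmult2_eq[symmetric]) (use b_pos in simp)
      then show ?thesis using j w' by (simp add: avoid_def)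
    qed
    ultimately have "i \<in> avoid \<nu> P w" by (simp add: avoid_def)
    moreover have "r \<in> R"
    proof -
      have "r \<noteq> ones (K w)" if "P \<le> w" "n w = \<nu>"
        using j that unfolding avoid_def mem_Collect_eq r_def by (metis diff_self_eq_0 div_by_1 lessI power_0)
      moreover have "0 \<le> r" "r < b ^ K w" using B by (simp_all add: r_def)
      ultimately show ?thesis by (auto simp: R_def)
    qed
    moreover have "j = b ^ K w * i + r" by (simp add: i_def r_def)
    ultimately show "j \<in> (\<lambda>(i, r). b ^ K w * i + r) ` (avoid \<nu> P w \<times> R)" by force
  qed
  then have "card (avoid \<nu> P (Suc w)) \<le> card ((\<lambda>(i, r). b ^ K w * i + r) ` (avoid \<nu> P w \<times> R))"
    by (intro card_mono finite_imageI finite_cartesian_product avoid_finite) (auto simp: R_def)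
  also have "\<dots> \<le> card (avoid \<nu> P w \<times> R)"
    by (intro card_image_le finite_cartesian_product avoid_finite) (auto simp: R_def)
  also have "\<dots> = card (avoid \<nu> P w) * card R" by (rule card_cartesian_product)
  finally show ?thesis unfolding cR .
qed

definition weight :: "nat \<Rightarrow> nat \<Rightarrow> nat \<Rightarrow> real" where
  "weight \<nu> P w = (if P \<le> w \<and> n w = \<nu> then 1 / real_of_int b ^ K w else 0)"

text \<open>The density is at most a product of factors \<open>1 - weight\<close>, each bounded
  through \<open>1 - x \<le> exp (- x)\<close>.\<close>

lemma avoid_density: "card (avoid \<nu> P w) / real_of_int b ^ st w \<le> exp (- (\<Sum>i<w. weight \<nu> P i))"
proof (induction w)
  case 0
  have "avoid \<nu> P 0 = {0}" by (auto simp: avoid_def st_def)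
  then show ?case by (simp add: st_def)
next
  case (Suc w)
  define c where "c = (if P \<le> w \<and> n w = \<nu> then 1 else 0 :: nat)"
  have B: "0 < real_of_int b ^ K w" "0 < real_of_int b ^ st w" using b_pos by simp_all
  have n1: "1 \<le> nat (b ^ K w)" using b_pos by (simp add: Suc_le_eq)
  have c: "c / real_of_int b ^ K w = weight \<nu> P w" by (simp add: c_def weight_def)
  have "real (card (avoid \<nu> P (Suc w))) \<le> real (card (avoid \<nu> P w) * (nat (b ^ K w) - c))"
    unfolding c_def of_nat_le_iff by (rule card_avoid_Suc)
  also have "\<dots> = card (avoid \<nu> P w) * (real_of_int b ^ K w - c)"
  proof -
    have "real (nat (b ^ K w) - c) = real (nat (b ^ K w)) - c" using n1 by (auto simp: c_def of_nat_diff)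
    also have "real (nat (b ^ K w)) = real_of_int b ^ K w" using b_pos by simp
    finally show ?thesis by simp
  qed
  finally have "card (avoid \<nu> P (Suc w)) / real_of_int b ^ st (Suc w)
     \<le> card (avoid \<nu> P w) * (real_of_int b ^ K w - c) / (real_of_int b ^ st w * real_of_int b ^ K w)"
    using B by (simp add: st_Suc power_add divide_right_mono)
  also have "\<dots> = card (avoid \<nu> P w) / real_of_int b ^ st w * (1 - weight \<nu> P w)"
    unfolding c[symmetric] using B(1) b_nz by (simp add: diff_divide_distrib right_diff_distrib)
  also have "\<dots> \<le> exp (- (\<Sum>i<w. weight \<nu> P i)) * exp (- weight \<nu> P w)"
  proof (intro mult_mono Suc)
    show "1 - weight \<nu> P w \<le> exp (- weight \<nu> P w)" using exp_ge_add_one_self[of "- weight \<nu> P w"] by simp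
    have "1 \<le> real_of_int b ^ K w" using b_real by simp
    then show "0 \<le> 1 - weight \<nu> P w" by (auto simp: weight_def divide_simps)
  qed auto
  finally show ?case by (simp add: exp_add[symmetric] add.commute)
qed

lemma avoid_density_lim: "(\<lambda>w. card (avoid \<nu> P w) / real_of_int b ^ st w) \<longlonglongrightarrow> 0"
proof -
  have nn: "0 \<le> weight \<nu> P i" for i using b_pos by (simp add: weight_def)
  have ns: "\<not> summable (weight \<nu> P)"
  proof
    assume sm: "summable (weight \<nu> P)"
    have ev: "eventually (\<lambda>w. weight \<nu> P w = (if n w = \<nu> then 1 / real_of_int b ^ K w else 0)) sequentially"
      using eventually_ge_at_top[of P] by eventually_elim (simp add: weight_def)
    show False using sm divergent[of \<nu>] unfolding summable_cong[OF ev] by contradiction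
  qed
  have "filterlim (\<lambda>w. \<Sum>i<w. weight \<nu> P i) at_top sequentially"
    unfolding filterlim_at_top
  proof
    fix Z :: real
    have "\<exists>w0. Z < (\<Sum>i<w0. weight \<nu> P i)"
    proof (rule ccontr)
      assume "\<not> ?thesis"
      then have "(\<Sum>i<w. weight \<nu> P i) \<le> Z" for w by (simp add: not_less)
      then have "summable (weight \<nu> P)" by (rule summableI_nonneg_bounded[OF nn])
      then show False using ns by contradiction
    qed
    then obtain w0 where "Z < (\<Sum>i<w0. weight \<nu> P i)" by blast
    moreover have "(\<Sum>i<w0. weight \<nu> P i) \<le> (\<Sum>i<w. weight \<nu> P i)" if "w0 \<le> w" for w
      using that nn by (intro sum_mono2) auto
    ultimately have "\<forall>w\<ge>w0. Z \<le> (\<Sum>i<w. weight \<nu> P i)" by force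
    then show "eventually (\<lambda>w. Z \<le> (\<Sum>i<w. weight \<nu> P i)) sequentially"
      unfolding eventually_sequentially by blast
  qed
  then have "filterlim (\<lambda>w. - (\<Sum>i<w. weight \<nu> P i)) at_bot sequentially"
    by (simp add: filterlim_uminus_at_bot)
  then have "(\<lambda>w. exp (- (\<Sum>i<w. weight \<nu> P i))) \<longlonglongrightarrow> 0"
    by (rule filterlim_compose[OF exp_at_bot])
  then show ?thesis
    by (rule tendsto_sandwich[OF _ _ tendsto_const, rotated 2])
       (use avoid_density b_pos in auto)
qed

text \<open>The extra index \<open>b ^ st w\<close> is there for \<open>t = 1\<close>, whose floor
  lies outside the range of \<open>avoid\<close>.\<close>

lemma miss_cover: "miss \<nu> P \<subseteq> (\<Union>i\<in>insert (b ^ st w) (avoid \<nu> P w). edge (st w) i)"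
proof
  fix t assume t: "t \<in> miss \<nu> P"
  define i where "i = \<lfloor>t * real_of_int b ^ st w\<rfloor>"
  have B: "0 < real_of_int b ^ st w" using b_pos by simp
  have "i \<in> insert (b ^ st w) (avoid \<nu> P w)"
  proof (cases "t = 1")
    case True
    have "i = b ^ st w" unfolding i_def True mult_1 by (metis floor_of_int of_int_power)
    then show ?thesis by simp
  next
    case False
    have t01: "0 \<le> t" "t < 1" using t False by (auto simp: miss_def)
    have "0 \<le> i" using t01 B by (simp add: i_def)
    moreover have "i < b ^ st w" using t01 B by (simp add: i_def floor_less_iff)
    moreover have "(i div b ^ (st w - st (Suc w'))) mod b ^ K w' \<noteq> ones (K w')"
      if w': "P \<le> w'" "w' < w" "n w' = \<nu>" for w'
    proof -
      have "st (Suc w') \<le> st w" using w' st_strict by (simp add: strict_mono_less_eq)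
      then have "i div b ^ (st w - st (Suc w')) = \<lfloor>t * real_of_int b ^ st (Suc w')\<rfloor>"
        unfolding i_def using floor_div_pow[of t "st (Suc w')" "st w - st (Suc w')"] by simp
      then show ?thesis using t w' by (simp add: miss_def hit_def)
    qed
    ultimately show ?thesis by (simp add: avoid_def)
  qed
  then show "t \<in> (\<Union>i\<in>insert (b ^ st w) (avoid \<nu> P w). edge (st w) i)"
    using edge_floor[of t "st w"] unfolding i_def by blast
qed

lemma st_lim: "filterlim st at_top sequentially"
  by (rule filterlim_subseq[OF st_strict])

text \<open>The surviving edges serve as the cover. The image of one of them has diameter at most
  \<open>D * lam ^ st w\<close>, with \<open>s\<close>-th power \<open>D powr s / b ^ st w\<close>,
  so the premeasure is bounded by a multiple of the density of survivors.\<close>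

lemma hausdorff_miss: "hausdorff N s (g ` miss \<nu> P) = 0"
  unfolding hausdorff_null_iff
proof (intro allI impI)
  fix \<delta> :: real assume \<delta>: "0 < \<delta>"
  define D where "D = N * (2 * K1 + 2)"
  have D: "0 \<le> D" using lam_less by (auto simp: D_def)
  let ?x = "\<lambda>w. card (avoid \<nu> P w) / real_of_int b ^ st w + (1 / real_of_int b) ^ st w"
  have le: "hausdorff_pre N s \<delta> (g ` miss \<nu> P) \<le> ennreal (?x w * D powr s)" if small: "D * lam ^ st w \<le> \<delta>" for w
  proof -
    let ?F = "insert (b ^ st w) (avoid \<nu> P w)"
    have B: "0 < real_of_int b ^ st w" using b_pos by simp
    have "hausdorff_pre N s \<delta> (g ` miss \<nu> P) \<le> ennreal (card ?F * (D * lam ^ st w) powr s)"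
    proof (rule hausdorff_pre_finite_cover)
      show "finite ?F" using avoid_finite by simp
      show "g ` miss \<nu> P \<subseteq> (\<Union>i\<in>?F. g ` edge (st w) i)" using miss_cover[of \<nu> P w] by blast
      show "g ` edge (st w) i \<subseteq> RN N" for i using g_RN by blast
      show "eucl_dist N x y \<le> D * lam ^ st w" if xy: "x \<in> g ` edge (st w) i" "y \<in> g ` edge (st w) i" for i x y
      proof -
        obtain t u where tu: "x = g t" "y = g u" "t \<in> edge (st w) i" "u \<in> edge (st w) i" using xy by blast
        then have "\<bar>t - u\<bar> \<le> (i + 1) / real_of_int b ^ st w - i / real_of_int b ^ st w"
          unfolding edge_def atLeastAtMost_iff of_int_add of_int_1 by linarith
        also have "\<dots> = 1 / real_of_int b ^ st w" by (simp add: diff_divide_distrib[symmetric])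
        finally have "\<bar>t - u\<bar> * real_of_int b ^ st w \<le> 1" using B by (simp add: le_divide_eq)
        then show ?thesis using g_step tu D_def by blast
      qed
    qed (use D lam_pos s_gt small in auto)
    also have "card ?F * (D * lam ^ st w) powr s \<le> ?x w * D powr s"
    proof -
      have "card ?F \<le> card (avoid \<nu> P w) + 1" by (simp add: avoid_finite card_insert_if)
      then have "card ?F / real_of_int b ^ st w \<le> ?x w"
        using B b_nz by (simp add: divide_simps power_one_over)
      moreover have "(D * lam ^ st w) powr s = D powr s / real_of_int b ^ st w"
        using D lam_pos by (simp add: powr_mult lam_pow_s)
      ultimately show ?thesis
        using mult_right_mono[of "card ?F / real_of_int b ^ st w" "?x w" "D powr s"] by simp
    qed
    finally show ?thesis by (simp add: ennreal_leI)
  qed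
  have "(\<lambda>w. (1 / real_of_int b) ^ st w) \<longlonglongrightarrow> 0"
    using b_real by (intro filterlim_compose[OF LIMSEQ_realpow_zero st_lim]) auto
  then have "(\<lambda>w. ?x w * D powr s) \<longlonglongrightarrow> (0 + 0) * D powr s"
    by (intro tendsto_mult tendsto_add avoid_density_lim tendsto_const)
  then have lim: "(\<lambda>w. ennreal (?x w * D powr s)) \<longlonglongrightarrow> ennreal 0" by (intro tendsto_ennrealI) simp
  have "(\<lambda>w. D * lam ^ st w) \<longlonglongrightarrow> D * 0"
    by (intro tendsto_mult tendsto_const filterlim_compose[OF LIMSEQ_realpow_zero st_lim])
       (use lam_pos lam_less in auto)
  then have ev: "eventually (\<lambda>w. D * lam ^ st w < \<delta>) sequentially" using \<delta> by (intro order_tendstoD(2)) auto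
  have "hausdorff_pre N s \<delta> (g ` miss \<nu> P) \<le> ennreal 0"
    by (rule tendsto_lowerbound[OF lim]) (use ev in \<open>eventually_elim, use le less_imp_le in blast\<close>, simp)
  then show "hausdorff_pre N s \<delta> (g ` miss \<nu> P) = 0" by simp
qed

definition typical :: "real \<Rightarrow> bool" where
  "typical t \<longleftrightarrow> (\<forall>\<nu> P. \<exists>w\<ge>P. n w = \<nu> \<and> hit t w)"

lemma hausdorff_atypical: "hausdorff N s (g ` {t \<in> {0..1}. \<not> typical t}) = 0"
proof (rule hausdorff_null_mono)
  show "g ` {t \<in> {0..1}. \<not> typical t} \<subseteq> (\<Union>\<nu>. \<Union>P. g ` miss \<nu> P)"
    unfolding typical_def miss_def by blast
  show "hausdorff N s (\<Union>\<nu>. \<Union>P. g ` miss \<nu> P) = 0"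
    by (intro hausdorff_null_UN hausdorff_miss)
qed

end

subsection \<open>Zooming in at a cluster\<close>

lemma floor_near:
  fixes y :: real
  assumes "z = \<lfloor>y\<rfloor> \<or> z = \<lfloor>y\<rfloor> + 1"
  shows "\<bar>y - real_of_int z\<bar> \<le> 1"
  using assms by (elim disjE) linarith+

context window_curve
begin

lemma no_loop: "st w < l \<Longrightarrow> l < st (Suc w) \<Longrightarrow> \<not> L l q"
  using strict_mono_less[OF st_strict] unfolding L_iff by (metis less_Suc_eq_le not_less)

text \<open>
  Level \<open>st w\<close> itself carries the loops of the preceding window; therefore ancestors are taken one level below.
\<close>

lemma rep_inner:
  assumes "rep (Suc (st w) + j) x = rep (Suc (st w) + j) y" "j < K w"
    "Q * b ^ j < x" "x < (Q + 1) * b ^ j" "Q * b ^ j < y" "y < (Q + 1) * b ^ j"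
  shows "x = y"
  using assms
proof (induction j arbitrary: x y)
  case 0
  then show ?case by simp
next
  case (Suc j)
  have nl: "\<not> L (Suc (st w) + j) z" for z using no_loop[of w "Suc (st w) + j"] Suc.prems by (simp add: st_Suc)
  have "rep (Suc (Suc (st w) + j)) x = rep (Suc (Suc (st w) + j)) y" using Suc.prems(1) by simp
  then show ?case
  proof (cases rule: rep_Suc_eq_cases)
    case (old x1 y1)
    have "Q * b ^ j < z" "z < (Q + 1) * b ^ j" if "Q * b ^ Suc j < b * z" "b * z < (Q + 1) * b ^ Suc j" for z
    proof -
      have "b * (Q * b ^ j) < b * z" "b * z < b * ((Q + 1) * b ^ j)" using that by (simp_all add: mult_ac)
      then show "Q * b ^ j < z" "z < (Q + 1) * b ^ j" using b_pos by (simp_all only: mult_less_cancel_left_pos)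
    qed
    then have "x1 = y1" using Suc.IH[OF old(3)] Suc.prems old by simp
    then show ?thesis using old by simp
  next
    case same
    then show ?thesis .
  next
    case (loop z)
    then show ?thesis using nl by simp
  qed
qed

lemma ones_add: "ones (a + c) = ones a + b ^ a * ones c"
  unfolding ones_def sum.nat_group[symmetric] 
  by (induction c) (auto simp: algebra_simps power_add)

definition pos :: "real \<Rightarrow> nat \<Rightarrow> int" where
  "pos t w = \<lfloor>t * real_of_int b ^ st (Suc w)\<rfloor>"

text \<open>Loops are declared on parents of level \<open>st (Suc w)\<close>, so they are edges of
  the next level, which becomes the unit scale of the zoom.\<close>

definition lev :: "nat \<Rightarrow> nat" where
  "lev w = Suc (st (Suc w))"

text \<open>One unit of \<tau> is one edge of level \<open>lev w\<close>, counted from the start of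
  the parent edge \<open>pos t w\<close>. At a hit, loop number \<open>l\<close> of the cluster thus
  occupies the parameters from \<open>b * l + 2\<close> to \<open>b * l + 3\<close>, whatever the
  window.\<close>

definition zoom :: "real \<Rightarrow> nat \<Rightarrow> real \<Rightarrow> nat \<Rightarrow> real" where
  "zoom t w \<tau> i = (g ((real_of_int (b * pos t w) + \<tau>) / real_of_int b ^ lev w) i - g t i) / lam ^ lev w"

definition range_of :: "real \<Rightarrow> nat \<Rightarrow> real set" where
  "range_of t w = {- real_of_int (b * pos t w) .. real_of_int b ^ lev w - real_of_int (b * pos t w)}"

lemma zoom_RN: "zoom t w \<tau> \<in> RN N"
  by (simp add: RN_def zoom_def g_def)

lemma zoom_holder: "\<bar>zoom t w \<tau> i - zoom t w \<tau>' i\<bar> \<le> C_holder * \<bar>\<tau> - \<tau>'\<bar> powr (1 / s)"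
proof -
  let ?u = "\<lambda>\<tau>. (real_of_int (b * pos t w) + \<tau>) / real_of_int b ^ lev w"
  have B: "0 < real_of_int b ^ lev w" using b_pos by simp
  have "\<bar>?u \<tau> - ?u \<tau>'\<bar> = \<bar>\<tau> - \<tau>'\<bar> * (1 / real_of_int b ^ lev w)"
    using B by (simp add: diff_divide_distrib[symmetric] abs_divide)
  then have "\<bar>?u \<tau> - ?u \<tau>'\<bar> powr (1 / s) = \<bar>\<tau> - \<tau>'\<bar> powr (1 / s) * ((lam ^ lev w) powr s) powr (1 / s)"
    using B by (simp only: lam_pow_s) (rule powr_mult; simp)
  also have "\<dots> = \<bar>\<tau> - \<tau>'\<bar> powr (1 / s) * lam ^ lev w" using lam_pos s_gt by (simp add: powr_powr)
  finally have "\<bar>g (?u \<tau>) i - g (?u \<tau>') i\<bar> \<le> C_holder * (\<bar>\<tau> - \<tau>'\<bar> powr (1 / s) * lam ^ lev w)"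
    using g_holder[of "?u \<tau>" i "?u \<tau>'"] by simp
  moreover have "\<bar>zoom t w \<tau> i - zoom t w \<tau>' i\<bar> = \<bar>g (?u \<tau>) i - g (?u \<tau>') i\<bar> / lam ^ lev w"
    using lam_pos by (simp add: zoom_def diff_divide_distrib[symmetric])
  ultimately show ?thesis using lam_pow_pos[of "lev w"] by (simp add: divide_le_eq mult.assoc)
qed

lemma zoom_base: "\<exists>\<tau>::real. 0 \<le> \<tau> \<and> \<tau> \<le> real_of_int b \<and> zoom t w \<tau> = (\<lambda>i. 0)"
proof -
  define \<tau> where "\<tau> = t * real_of_int b ^ lev w - real_of_int (b * pos t w)"
  have B: "0 < real_of_int b" using b_pos by simp
  have f: "pos t w \<le> t * real_of_int b ^ st (Suc w)" "t * real_of_int b ^ st (Suc w) \<le> pos t w + 1"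
    unfolding pos_def by linarith+
  have "\<tau> = b * (t * real_of_int b ^ st (Suc w) - pos t w)" by (simp add: \<tau>_def lev_def algebra_simps)
  moreover have "b * (t * real_of_int b ^ st (Suc w) - pos t w) \<le> real_of_int b * 1"
    using f B by (intro mult_left_mono) auto
  moreover have "0 \<le> b * (t * real_of_int b ^ st (Suc w) - pos t w)" using f B by simp
  moreover have "(real_of_int (b * pos t w) + \<tau>) / real_of_int b ^ lev w = t" using B by (simp add: \<tau>_def)
  ultimately have "0 \<le> \<tau>" "\<tau> \<le> real_of_int b" "zoom t w \<tau> = (\<lambda>i. 0)"
    unfolding zoom_def by simp_all
  then show ?thesis by blast
qed

lemma zoom_blowup: "blowup (g ` {0..1}) (g t) (lam ^ lev w) = zoom t w ` range_of t w"
proof -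
  have B: "0 < real_of_int b ^ lev w" using b_pos by simp
  let ?u = "\<lambda>\<tau>. (real_of_int (b * pos t w) + \<tau>) / real_of_int b ^ lev w"
  have "?u ` range_of t w = {0..1}"
  proof (intro equalityI subsetI)
    fix x assume "x \<in> ?u ` range_of t w"
    then show "x \<in> {0..1}" using B by (auto simp: range_of_def divide_simps)
  next
    fix x :: real assume x: "x \<in> {0..1}"
    show "x \<in> ?u ` range_of t w"
    proof (rule image_eqI)
      show "x = ?u (x * real_of_int b ^ lev w - real_of_int (b * pos t w))" using B b_nz by simp
      show "x * real_of_int b ^ lev w - real_of_int (b * pos t w) \<in> range_of t w"
        using x B mult_right_mono[of x 1 "real_of_int b ^ lev w"] by (simp add: range_of_def)
    qed
  qed
  then have "blowup (g ` {0..1}) (g t) (lam ^ lev w) = (\<lambda>y i. (y i - g t i) / lam ^ lev w) ` g ` ?u ` range_of t w"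
    by (simp add: blowup_def)
  also have "\<dots> = zoom t w ` range_of t w"
    unfolding image_image by (intro image_cong refl ext) (simp add: zoom_def)
  finally show ?thesis .
qed

section \<open>Identifications around a hit\<close>

lemma hit_pos:
  assumes "hit t w"
  shows "pos t w mod b ^ K w = ones (K w)"
  using assms by (simp add: hit_def pos_def)

lemma hit_lt_1:
  assumes "hit t w" "t \<in> {0..1}"
  shows "t < 1"
proof (rule ccontr)
  assume "\<not> t < 1"
  then have "t = 1" using assms by simp
  then have "pos t w = b ^ st (Suc w)" unfolding pos_def by (metis floor_of_int mult_1 of_int_power)
  then have "b ^ K w dvd pos t w" by (simp add: st_Suc power_add)
  then have "ones (K w) = 0" using hit_pos[OF assms(1)] by simp
  then show False using ones_ge[of "K w"] K_pos[of w] by simp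
qed

lemma pos_bounds:
  assumes "hit t w" "t \<in> {0..1}"
  shows "ones (K w) \<le> pos t w" "pos t w + ones (K w) \<le> b ^ st (Suc w)"
proof -
  define Q where "Q = pos t w div b ^ K w"
  have B: "0 < b ^ K w" "0 < b ^ st w" using b_pos by simp_all
  have q: "pos t w = b ^ K w * Q + ones (K w)"
    using hit_pos[OF assms(1)] mult_div_mod_eq[of "b ^ K w" "pos t w"] unfolding Q_def by simp
  have "0 \<le> pos t w" using assms b_pos by (simp add: pos_def)
  then have "0 \<le> Q" using B unfolding Q_def by (simp add: pos_imp_zdiv_nonneg_iff)
  then show "ones (K w) \<le> pos t w" using q B by simp
  have "pos t w < b ^ st (Suc w)"
    using hit_lt_1[OF assms] b_pos by (simp add: pos_def floor_less_iff)
  then have "b ^ K w * Q < b ^ K w * b ^ st w"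
    using q ones_ge[of "K w"] by (simp add: st_Suc power_add mult.commute)
  then have "Q + 1 \<le> b ^ st w" using B by simp
  then have "b ^ K w * (Q + 1) \<le> b ^ K w * b ^ st w" using B by (intro mult_left_mono) auto
  then show "pos t w + ones (K w) \<le> b ^ st (Suc w)"
    using q ones_double[of "K w"] by (simp add: st_Suc power_add algebra_simps)
qed

lemma K_eq: "K w = Suc (K w - 1)"
  using K_pos[of w] by simp

text \<open>Splitting off the leading digit 1 exhibits the ancestor \<open>Q\<close> of level
  \<open>Suc (st w)\<close>, the level at which \<open>rep_inner\<close> starts.\<close>

lemma hit_inner:
  assumes "hit t w"
  obtains Q where "pos t w = Q * b ^ (K w - 1) + ones (K w - 1)"
proof -
  let ?d = "K w - 1"
  have "pos t w = b ^ K w * (pos t w div b ^ K w) + ones (K w)"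
    using hit_pos[OF assms] mult_div_mod_eq[of "b ^ K w" "pos t w"] by simp
  also have "\<dots> = b ^ Suc ?d * (pos t w div b ^ K w) + ones (Suc ?d)" by (simp only: K_eq[symmetric])
  also have "\<dots> = (b * (pos t w div b ^ K w) + 1) * b ^ ?d + ones ?d" by (simp add: ones_def algebra_simps)
  finally show thesis by (rule that)
qed

text \<open>For such small shifts \<open>ones (K w) + \<delta>\<close> stays between 0 and
  \<open>b ^ K w\<close>, so no carry leads into a neighbouring block with its own cluster.\<close>

lemma loop_iff:
  assumes "hit t w" "\<bar>\<delta>\<bar> \<le> ones (K w - 1)"
  shows "L (st (Suc w)) (pos t w + \<delta>) \<longleftrightarrow> 0 \<le> \<delta> \<and> \<delta> < n w"
proof -
  let ?d = "K w - 1"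
  have o: "ones (K w) = ones ?d + b ^ ?d" by (subst K_eq) (simp add: ones_def)
  have bd: "0 < b ^ ?d" using b_pos by simp
  have "ones (K w) + \<delta> < b ^ K w" "0 \<le> ones (K w) + \<delta>"
    using assms(2) o ones_double[of "K w"] bd by linarith+
  then have "(ones (K w) + \<delta>) mod b ^ K w = ones (K w) + \<delta>" by simp
  moreover have "(pos t w + \<delta>) mod b ^ K w = (pos t w mod b ^ K w + \<delta>) mod b ^ K w"
    by (simp add: mod_add_left_eq)
  ultimately have "(pos t w + \<delta>) mod b ^ K w = ones (K w) + \<delta>" using hit_pos[OF assms(1)] by simp
  moreover have "st (Suc w) = st (Suc w') \<longleftrightarrow> w' = w" for w'
    using strict_mono_eq[OF st_strict] by auto
  ultimately show ?thesis unfolding L_iff by auto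
qed

lemma rep_pos_inj:
  assumes "hit t w" "\<bar>x - pos t w\<bar> < ones (K w - 1)" "\<bar>y - pos t w\<bar> < ones (K w - 1)"
    "rep (st (Suc w)) x = rep (st (Suc w)) y"
  shows "x = y"
proof -
  let ?d = "K w - 1"
  obtain Q where Q: "pos t w = Q * b ^ ?d + ones ?d" using hit_inner[OF assms(1)] .
  have e: "st (Suc w) = Suc (st w) + ?d" using K_eq[of w] by (simp add: st_Suc)
  have "Q * b ^ ?d < z \<and> z < (Q + 1) * b ^ ?d" if "\<bar>z - pos t w\<bar> < ones ?d" for z
    using that Q ones_double[of ?d] unfolding distrib_right by linarith
  then show ?thesis using rep_inner[of w ?d x y Q] assms K_eq[of w] unfolding e by simp
qed

text \<open>The loops of the cluster arise at level \<open>lev w\<close>. Coarser identifications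
  are excluded nearby by \<open>rep_pos_inj\<close>, and the loops of the next window first appear
  at level \<open>lev w + K (Suc w)\<close>.\<close>

lemma rep_window:
  assumes "hit t w" "h < K (Suc w)" "rep (lev w + h) x = rep (lev w + h) y"
    "\<bar>x - b ^ Suc h * pos t w\<bar> < b ^ Suc h * ones (K w - 1)"
    "\<bar>y - b ^ Suc h * pos t w\<bar> < b ^ Suc h * ones (K w - 1)"
  shows "x = y \<or> (\<exists>\<delta>. 0 \<le> \<delta> \<and> \<delta> < int (n w) \<and>
    {x, y} = {b ^ h * (b * (pos t w + \<delta>) + 2), b ^ h * (b * (pos t w + \<delta>) + 3)})"
  using assms(2-)
proof (induction h arbitrary: x y)
  case 0
  let ?q = "pos t w" and ?o = "ones (K w - 1)"
  have bd: "\<bar>z - ?q\<bar> < ?o" if "\<bar>b * z - b * ?q\<bar> < b * ?o" for z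
  proof -
    have "b * \<bar>z - ?q\<bar> < b * ?o" using that b_pos by (simp add: right_diff_distrib[symmetric] abs_mult)
    then show ?thesis using b_pos by simp
  qed
  from 0 have "rep (Suc (st (Suc w))) x = rep (Suc (st (Suc w))) y" by (simp add: lev_def del: rep.simps)
  then show ?case
  proof (cases rule: rep_Suc_eq_cases)
    case (old x1 y1)
    then have "x1 = y1" using rep_pos_inj[OF assms(1) _ _ old(3)] bd 0 by simp
    then show ?thesis using old by simp
  next
    case same
    then show ?thesis by simp
  next
    case (loop z)
    have xy: "\<bar>b * z + 2 - b * ?q\<bar> < b * ?o" using loop(2) 0 by (auto simp: doubleton_eq_iff)
    have "\<bar>z - ?q\<bar> \<le> ?o"
    proof (rule ccontr)
      assume "\<not> ?thesis"
      then consider "?o + 1 \<le> z - ?q" | "?o + 1 \<le> ?q - z" by linarith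
      then have "b * (?o + 1) \<le> b * (z - ?q) \<or> b * (?o + 1) \<le> b * (?q - z)"
        using b_pos by cases (auto intro: mult_left_mono)
      then show False using xy b_ge by (auto simp: algebra_simps abs_less_iff)
    qed
    then have "0 \<le> z - ?q \<and> z - ?q < int (n w)" using loop_iff[OF assms(1), of "z - ?q"] loop(1) by simp
    then show ?thesis using loop(2) by (intro disjI2 exI[of _ "z - ?q"]) simp
  qed
next
  case (Suc h)
  let ?q = "pos t w" and ?o = "ones (K w - 1)"
  have nl: "\<not> L (lev w + h) z" for z
    using no_loop[of "Suc w" "lev w + h"] Suc.prems(1) by (simp add: lev_def st_Suc)
  have bd: "\<bar>z - b ^ Suc h * ?q\<bar> < b ^ Suc h * ?o" if "\<bar>b * z - b ^ Suc (Suc h) * ?q\<bar> < b ^ Suc (Suc h) * ?o" for z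
  proof -
    have "b * z - b ^ Suc (Suc h) * ?q = b * (z - b ^ Suc h * ?q)" by (simp add: right_diff_distrib)
    then have "b * \<bar>z - b ^ Suc h * ?q\<bar> < b * (b ^ Suc h * ?o)"
      using that b_pos by (simp add: abs_mult mult.assoc)
    then show ?thesis using b_pos by simp
  qed
  have "rep (Suc (lev w + h)) x = rep (Suc (lev w + h)) y" using Suc.prems(2) by (simp del: rep.simps)
  then show ?case
  proof (cases rule: rep_Suc_eq_cases)
    case (old x1 y1)
    have "x1 = y1 \<or> (\<exists>\<delta>. 0 \<le> \<delta> \<and> \<delta> < int (n w) \<and>
      {x1, y1} = {b ^ h * (b * (?q + \<delta>) + 2), b ^ h * (b * (?q + \<delta>) + 3)})"
      by (rule Suc.IH) (use Suc.prems old bd in auto)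
    then show ?thesis
    proof
      assume "\<exists>\<delta>. 0 \<le> \<delta> \<and> \<delta> < int (n w) \<and> {x1, y1} = {b ^ h * (b * (?q + \<delta>) + 2), b ^ h * (b * (?q + \<delta>) + 3)}"
      then obtain \<delta> where \<delta>: "0 \<le> \<delta>" "\<delta> < int (n w)"
        "{x1, y1} = {b ^ h * (b * (?q + \<delta>) + 2), b ^ h * (b * (?q + \<delta>) + 3)}" by blast
      have "{x, y} = (*) b ` {x1, y1}" using old by simp
      also have "\<dots> = {b ^ Suc h * (b * (?q + \<delta>) + 2), b ^ Suc h * (b * (?q + \<delta>) + 3)}"
        unfolding \<delta>(3) by (simp add: mult.assoc)
      finally show ?thesis using \<delta> by blast
    qed (use old in simp)
  next
    case same
    then show ?thesis by simp
  next
    case (loop z)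
    then show ?thesis using nl by simp
  qed
qed

text \<open>The edge containing \<open>t\<close> has last digit 1, so its ends have digits 1 and 2:
  both are new and, with no loops declared on these levels, glued to nothing. Only its neighbours
  along the curve can touch it.\<close>

lemma window_neighbour:
  assumes "hit t w" "1 \<le> j" "j < K w" "adj (Suc (st w) + j) \<lfloor>t * real_of_int b ^ (Suc (st w) + j)\<rfloor> i'"
  shows "\<bar>\<lfloor>t * real_of_int b ^ (Suc (st w) + j)\<rfloor> - i'\<bar> \<le> 1"
proof -
  let ?d = "K w - 1" and ?l = "Suc (st w) + j"
  define i where "i = \<lfloor>t * real_of_int b ^ ?l\<rfloor>"
  obtain Q where Q: "pos t w = Q * b ^ ?d + ones ?d" using hit_inner[OF assms(1)] .
  have e: "st (Suc w) = ?l + (?d - j)" using assms K_eq[of w] by (simp add: st_Suc)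
  have "?d = (?d - j) + j" using assms by simp
  then have "pos t w = b ^ (?d - j) * (Q * b ^ j + ones j) + ones (?d - j)"
    using Q ones_add[of "?d - j" j] power_add[of b "?d - j" j] by (simp add: algebra_simps)
  moreover have "i = pos t w div b ^ (?d - j)"
    unfolding i_def pos_def e by (rule floor_div_pow[symmetric])
  ultimately have "i = Q * b ^ j + ones j"
    using ones_less[of "?d - j"] ones_ge[of "?d - j"] b_pos by simp
  moreover obtain j' where j: "j = Suc j'" using assms by (cases j) auto
  ultimately have i: "i = b * (Q * b ^ j' + ones j') + 1" unfolding j ones_Suc by (simp add: algebra_simps)
  have nl: "\<not> L (Suc (st w) + j') z" for z
    using no_loop[of w "Suc (st w) + j'"] assms j by (simp add: st_Suc)
  have "i + 1 = b * (Q * b ^ j' + ones j') + 2" using i by simp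
  moreover have "\<not> b dvd b * x + 1" "\<not> b dvd b * x + 2" for x
    by (rule not_dvd_digit; use b_ge in simp)+
  ultimately have ndvd: "\<not> b dvd i" "\<not> b dvd i + 1" using i by metis+
  have inj: "v = v'" if "v \<in> {i, i + 1}" "rep ?l v = rep ?l v'" for v v'
  proof -
    have "rep (Suc (Suc (st w) + j')) v = rep (Suc (Suc (st w) + j')) v'" using that(2) j by (simp del: rep.simps)
    then show ?thesis
    proof (cases rule: rep_Suc_eq_cases)
      case (old q q')
      then show ?thesis using ndvd that(1) by (metis dvd_triv_left insertE singletonD)
    qed (use nl in auto)
  qed
  obtain v v' where v: "v \<in> {i, i + 1}" "v' \<in> {i', i' + 1}" "rep ?l v = rep ?l v'"
    using assms(4) unfolding adj_def i_def[symmetric] by blast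
  have "v = v'" by (rule inj[OF v(1,3)])
  then have "i' = i - 1 \<or> i' = i \<or> i' = i + 1" using v(1,2) by auto
  then show ?thesis unfolding i_def[symmetric] by auto
qed

section \<open>Escape to infinity and separation in the zooms\<close>

lemma floor_edge_bounds:
  assumes "0 \<le> u" "u < 1"
  shows "0 \<le> \<lfloor>u * real_of_int b ^ l\<rfloor>" "\<lfloor>u * real_of_int b ^ l\<rfloor> < b ^ l"
proof -
  have "0 < real_of_int b ^ l" using b_pos by simp
  then show "0 \<le> \<lfloor>u * real_of_int b ^ l\<rfloor>" "\<lfloor>u * real_of_int b ^ l\<rfloor> < b ^ l"
    using assms by (simp_all add: floor_less_iff)
qed

lemma edge_bounds: "u \<in> edge l i \<longleftrightarrow> i \<le> u * real_of_int b ^ l \<and> u * real_of_int b ^ l \<le> i + 1"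
proof -
  have "0 < real_of_int b ^ l" using b_pos by simp
  then show ?thesis by (simp add: edge_def divide_le_eq le_divide_eq)
qed

text \<open>Going up \<open>h\<close> levels turns a large parameter distance into non-adjacent
  edges; their separation grows to \<open>(1 / lam) ^ h / 4\<close> after rescaling. The summand
  \<open>b\<close> is needed since \<open>t\<close> itself sits at a zoom parameter between 0 and
  \<open>b\<close>.\<close>

lemma zoom_far:
  assumes hit: "hit t w" "t \<in> {0..1}" and h: "1 \<le> h" "h < K w" and \<tau>: "\<tau> \<in> range_of t w"
    and far: "2 * real_of_int b ^ h + b < \<bar>\<tau>\<bar>"
  shows "(1 / lam) ^ h / 4 \<le> eucl_dist N (\<lambda>i. 0) (zoom t w \<tau>)"
proof -
  define j where "j = K w - h"
  let ?l = "Suc (st w) + j"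
  have k: "lev w = ?l + h" using h by (simp add: lev_def st_Suc j_def)
  define u where "u = (real_of_int (b * pos t w) + \<tau>) / real_of_int b ^ lev w"
  have B: "0 < real_of_int b ^ lev w" "0 < real_of_int b ^ h" "0 < real_of_int b ^ ?l" using b_pos by simp_all
  have u01: "u \<in> {0..1}" using \<tau> B by (auto simp: u_def range_of_def divide_simps)
  obtain \<tau>0 where \<tau>0: "\<tau>0 = t * real_of_int b ^ lev w - real_of_int (b * pos t w)" "0 \<le> \<tau>0" "\<tau>0 \<le> b"
  proof -
    have f: "0 \<le> t * real_of_int b ^ st (Suc w) - pos t w" "t * real_of_int b ^ st (Suc w) - pos t w \<le> 1"
      unfolding pos_def by linarith+
    have e: "t * real_of_int b ^ lev w - real_of_int (b * pos t w) = b * (t * real_of_int b ^ st (Suc w) - pos t w)"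
      by (simp add: lev_def algebra_simps)
    show thesis
      by (rule that[OF refl]; unfold e) (use f b_pos mult_left_mono[OF f(2), of b] in simp_all)
  qed
  have "\<bar>(u - t) * real_of_int b ^ lev w\<bar> = \<bar>\<tau> - \<tau>0\<bar>"
  proof -
    have ub: "u * real_of_int b ^ lev w = real_of_int (b * pos t w) + \<tau>" using B b_nz by (simp add: u_def)
    show ?thesis unfolding left_diff_distrib ub \<tau>0(1) by (simp add: algebra_simps)
  qed
  also have "\<dots> > 2 * real_of_int b ^ h" using far \<tau>0 by linarith
  finally have "2 * real_of_int b ^ h < \<bar>u - t\<bar> * real_of_int b ^ ?l * real_of_int b ^ h"
    using B b_pos by (simp add: k power_add abs_mult mult.assoc)
  then have gap: "2 < \<bar>u - t\<bar> * real_of_int b ^ ?l" using B(2) by simp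
  define i where "i = \<lfloor>t * real_of_int b ^ ?l\<rfloor>"
  have i: "0 \<le> i" "i < b ^ ?l" "t \<in> edge ?l i"
    using floor_edge_bounds[of t ?l] hit_lt_1[OF hit] hit edge_floor[of t ?l] unfolding i_def by auto
  obtain i' where i': "0 \<le> i'" "i' < b ^ ?l" "u \<in> edge ?l i'" using edge_exists u01 by blast
  have "\<not> adj ?l i i'"
  proof
    assume "adj ?l i i'"
    then have "\<bar>i - i'\<bar> \<le> 1" using window_neighbour[OF hit(1), of j i'] h unfolding i_def j_def by simp
    then have "\<bar>(u - t) * real_of_int b ^ ?l\<bar> \<le> 2" using i(3) i'(3) unfolding edge_bounds left_diff_distrib by linarith
    then show False using gap B b_pos by (simp add: abs_mult)
  qed
  then obtain z where z: "z \<in> coords" "lam ^ ?l / 4 \<le> \<bar>G t z - G u z\<bar>" using G_lower i i' by blast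
  obtain m where m: "m < N" "\<And>t. g t m = G t z" using g_coord z by blast
  have "(1 / lam) ^ h / 4 = lam ^ ?l / 4 / lam ^ lev w" using lam_pos by (simp add: k power_add power_one_over)
  also have "\<dots> \<le> \<bar>G t z - G u z\<bar> / lam ^ lev w" using z lam_pos by (intro divide_right_mono) auto
  also have "\<dots> = \<bar>0 - zoom t w \<tau> m\<bar>" using lam_pos by (simp add: zoom_def m u_def abs_minus_commute)
  also have "\<dots> \<le> eucl_dist N (\<lambda>i. 0) (zoom t w \<tau>)" using eucl_dist_ge_coord[OF m(1), of "\<lambda>i. 0" "zoom t w \<tau>"] by simp
  finally show ?thesis .
qed

lemma zoom_loop:
  assumes "hit t w" "l < n w" "int l \<le> ones (K w - 1)"
  shows "zoom t w (real_of_int b * l + 2) = zoom t w (real_of_int b * l + 3)"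
proof -
  let ?q = "pos t w + l"
  have "L (st (Suc w)) ?q" using loop_iff[OF assms(1), of "int l"] assms by simp
  then have "rep (lev w) (b * ?q + 3) = rep (lev w) (b * ?q + 2)" using b_ge by (simp add: lev_def)
  then have "v (lev w) (b * ?q + 3) z = v (lev w) (b * ?q + 2) z" for z using v_rep by metis
  then have "G (real_of_int (b * ?q + 3) / real_of_int b ^ lev w) z = G (real_of_int (b * ?q + 2) / real_of_int b ^ lev w) z" for z
    unfolding G_vertex .
  moreover have "real_of_int (b * ?q + x) = real_of_int (b * pos t w) + (real_of_int b * real l + real_of_int x)" for x :: int
    by (simp add: algebra_simps)
  ultimately have "G ((real_of_int (b * pos t w) + (real_of_int b * real l + 3)) / real_of_int b ^ lev w) z
      = G ((real_of_int (b * pos t w) + (real_of_int b * real l + 2)) / real_of_int b ^ lev w) z" for z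
    by (simp only: of_int_numeral)
  then show ?thesis unfolding zoom_def g_def by (simp only:)
qed

text \<open>Quantitative injectivity with a bound independent of \<open>w\<close>, so that it
  survives the limit. Parameters more than two edge lengths of level \<open>lev w + h\<close> apart
  can have adjacent edges only through a loop, whose ends are then within one such length of \<tau>
  and \<tau>'.\<close>

lemma zoom_separated:
  fixes \<tau> \<tau>' :: real
  assumes hit: "hit t w" "t \<in> {0..1}" and h: "h < K (Suc w)" and less: "2 / real_of_int b ^ h < \<tau>' - \<tau>"
    and bd: "\<bar>\<tau>\<bar> + 1 < real_of_int (b * ones (K w - 1))" "\<bar>\<tau>'\<bar> + 1 < real_of_int (b * ones (K w - 1))"
    and noloop: "\<And>l. l < n w \<Longrightarrow> \<not> (\<bar>\<tau> - (real_of_int b * l + 2)\<bar> \<le> 1 / real_of_int b ^ h \<and> \<bar>\<tau>' - (real_of_int b * l + 3)\<bar> \<le> 1 / real_of_int b ^ h)"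
  shows "\<exists>i<N. lam ^ h / 4 \<le> \<bar>zoom t w \<tau> i - zoom t w \<tau>' i\<bar>"
proof -
  let ?k = "lev w" and ?q = "pos t w" and ?o = "ones (K w - 1)"
  have B: "0 < real_of_int b ^ h" "0 < real_of_int b ^ ?k" "1 \<le> real_of_int b ^ h" using b_pos b_real by simp_all
  have o: "?o \<le> ones (K w)" using b_pos by (subst (2) K_eq) (simp add: ones_def)
  define u where "u x = (real_of_int (b * ?q) + x) / real_of_int b ^ ?k" for x :: real
  have u: "0 \<le> u x" "u x < 1" if "\<bar>x\<bar> + 1 < real_of_int (b * ?o)" for x :: real
  proof -
    have 1: "b * ?o \<le> b * ?q" "b * ?q + b * ?o \<le> b * b ^ st (Suc w)"
      using pos_bounds[OF hit] o b_pos by (auto simp: distrib_left[symmetric])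
    then have "real_of_int (b * ?o) \<le> real_of_int (b * ?q)" 
      "real_of_int (b * ?q + b * ?o) \<le> real_of_int (b * b ^ st (Suc w))" by (simp_all only: of_int_le_iff)
    then have "0 \<le> real_of_int (b * ?q) + x" "real_of_int (b * ?q) + x < real_of_int b ^ ?k" using that by (auto simp: lev_def)
    then show "0 \<le> u x" "u x < 1" using B by (simp_all add: u_def)
  qed
  define I where "I x = \<lfloor>u x * real_of_int b ^ (?k + h)\<rfloor>" for x
  have uI: "u x * real_of_int b ^ (?k + h) = (real_of_int (b * ?q) + x) * real_of_int b ^ h" for x
    using B b_nz by (simp add: u_def power_add)
  have nadj: "\<not> adj (?k + h) (I \<tau>) (I \<tau>')"
  proof
    assume "adj (?k + h) (I \<tau>) (I \<tau>')"
    then obtain y y' where y: "y \<in> {I \<tau>, I \<tau> + 1}" "y' \<in> {I \<tau>', I \<tau>' + 1}" "rep (?k + h) y = rep (?k + h) y'"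
      unfolding adj_def by blast
    have near: "\<bar>(real_of_int (b * ?q) + x) * real_of_int b ^ h - z\<bar> \<le> 1" if "z \<in> {I x, I x + 1}" for x :: real and z
      by (rule floor_near) (use that in \<open>simp add: I_def uI\<close>)
    have close: "\<bar>z - b ^ Suc h * ?q\<bar> < b ^ Suc h * ?o" if "z \<in> {I x, I x + 1}" "\<bar>x\<bar> + 1 < real_of_int (b * ?o)" for x :: real and z
    proof -
      have "\<bar>real_of_int z - real_of_int b ^ Suc h * ?q\<bar> \<le> \<bar>x\<bar> * real_of_int b ^ h + 1"
        using near[OF that(1)] B(1) abs_mult[of x "real_of_int b ^ h"] by (simp add: algebra_simps)
      also have "\<dots> \<le> (\<bar>x\<bar> + 1) * real_of_int b ^ h" using B(3) by (simp add: distrib_right)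
      also have "\<dots> < real_of_int (b * ?o) * real_of_int b ^ h" using that(2) B(1) by (intro mult_strict_right_mono) auto
      finally have "\<bar>real_of_int (z - b ^ Suc h * ?q)\<bar> < real_of_int (b ^ Suc h * ?o)" by (simp add: mult_ac)
      then show ?thesis by (simp only: of_int_abs[symmetric] of_int_less_iff)
    qed
    have "2 < (\<tau>' - \<tau>) * real_of_int b ^ h" using less B(1) by (simp add: divide_less_eq)
    then have "(real_of_int (b * ?q) + \<tau>) * real_of_int b ^ h + 2 < (real_of_int (b * ?q) + \<tau>') * real_of_int b ^ h" by (simp add: algebra_simps)
    then have yy: "y < y'" using near[OF y(1)] near[OF y(2)] by linarith
    then obtain \<delta> where \<delta>: "0 \<le> \<delta>" "\<delta> < int (n w)"
      "{y, y'} = {b ^ h * (b * (?q + \<delta>) + 2), b ^ h * (b * (?q + \<delta>) + 3)}"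
      using rep_window[OF hit(1) h y(3) close[OF y(1) bd(1)] close[OF y(2) bd(2)]] by auto
    have "b ^ h * (b * (?q + \<delta>) + 2) < b ^ h * (b * (?q + \<delta>) + 3)" using b_pos by simp
    then have y_eq: "y = b ^ h * (b * (?q + \<delta>) + 2)" "y' = b ^ h * (b * (?q + \<delta>) + 3)"
      using \<delta>(3) yy by (auto simp: doubleton_eq_iff)
    obtain l where l: "\<delta> = int l" "l < n w" using \<delta> by (metis nat_0_le nat_less_iff zero_le_imp_eq_int of_nat_less_iff)
    have conv: "\<bar>x - (real_of_int b * l + c)\<bar> \<le> 1 / real_of_int b ^ h" 
      if "\<bar>(real_of_int (b * ?q) + x) * real_of_int b ^ h - b ^ h * (b * (?q + \<delta>) + c)\<bar> \<le> 1" for x :: real and c :: int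
    proof -
      have "(real_of_int (b * ?q) + x) * real_of_int b ^ h - b ^ h * (b * (?q + \<delta>) + c) = (x - (real_of_int b * l + c)) * real_of_int b ^ h"
        by (simp add: l algebra_simps)
      then have "\<bar>x - (real_of_int b * l + c)\<bar> * real_of_int b ^ h \<le> 1" using that B(1) by (simp add: abs_mult)
      then show ?thesis using B(1) by (simp add: le_divide_eq)
    qed
    have "\<bar>\<tau> - (real_of_int b * l + 2)\<bar> \<le> 1 / real_of_int b ^ h" using conv[of \<tau> 2] near[OF y(1)] y_eq by simp
    moreover have "\<bar>\<tau>' - (real_of_int b * l + 3)\<bar> \<le> 1 / real_of_int b ^ h" using conv[of \<tau>' 3] near[OF y(2)] y_eq by simp
    ultimately show False using noloop[OF l(2)] by blast
  qed
  have "\<exists>z\<in>coords. lam ^ (?k + h) / 4 \<le> \<bar>G (u \<tau>) z - G (u \<tau>') z\<bar>"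
    by (rule G_lower[OF _ _ _ _ _ _ nadj])
       (use floor_edge_bounds u bd edge_floor I_def in auto)
  then obtain z where z: "z \<in> coords" "lam ^ (?k + h) / 4 \<le> \<bar>G (u \<tau>) z - G (u \<tau>') z\<bar>" by blast
  obtain m where m: "m < N" "\<And>t. g t m = G t z" using g_coord z by blast
  have "lam ^ h / 4 = lam ^ (?k + h) / 4 / lam ^ ?k" using lam_pos by (simp add: power_add)
  also have "\<dots> \<le> \<bar>G (u \<tau>) z - G (u \<tau>') z\<bar> / lam ^ ?k" using z lam_pos by (intro divide_right_mono) auto
  also have "\<dots> = \<bar>zoom t w \<tau> m - zoom t w \<tau>' m\<bar>"
    using lam_pos by (simp add: zoom_def m u_def diff_divide_distrib[symmetric])
  finally show ?thesis using m by blast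
qed

end

subsection \<open>Tangents at typical points\<close>

context window_curve
begin

lemma typical_sequence:
  assumes "typical t"
  obtains w :: "nat \<Rightarrow> nat" where "strict_mono w" "\<And>p. n (w p) = \<nu>" "\<And>p. hit t (w p)"
proof -
  have "infinite {w. n w = \<nu> \<and> hit t w}"
    unfolding infinite_nat_iff_unbounded_le using assms unfolding typical_def by blast
  then obtain w :: "nat \<Rightarrow> nat" where "strict_mono w" "\<forall>p. w p \<in> {w. n w = \<nu> \<and> hit t w}"
    using infinite_enumerate by blast
  then show thesis using that[of w] by blast
qed

text \<open>The tangent is a limit of zooms at hits with \<open>n w = \<nu>\<close>. Loops stay
  closed in the limit because they eventually close at the same parameters in every zoom; further
  coincidences cannot arise because of the uniform bound in \<open>zoom_separated\<close>.\<close>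

lemma typical_tangent:
  assumes typical: "typical t" and t: "t \<in> {0..1}"
  shows "\<exists>T\<in>Tan N (g ` {0..1}) (g t). card (triple_points (subtopology (eucl_top N) T)) = \<nu>"
proof -
  obtain w0 :: "nat \<Rightarrow> nat" where w0: "strict_mono w0" "\<And>p. n (w0 p) = \<nu>" "\<And>p. hit t (w0 p)"
    by (rule typical_sequence[OF typical, of \<nu>]) (rule that)
  have pw: "0 < 1 / s" using s_gt by simp
  have bd: "\<exists>B. \<forall>p i. \<bar>zoom t (w0 p) \<tau> i\<bar> \<le> B" for \<tau>
  proof (intro exI allI)
    fix p i
    obtain \<tau>0 :: real where \<tau>0: "0 \<le> \<tau>0" "\<tau>0 \<le> real_of_int b" "zoom t (w0 p) \<tau>0 = (\<lambda>i. 0)" using zoom_base by blast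
    have "\<bar>zoom t (w0 p) \<tau> i\<bar> \<le> C_holder * \<bar>\<tau> - \<tau>0\<bar> powr (1 / s)"
      using zoom_holder[of t "w0 p" \<tau> i \<tau>0] \<tau>0(3) by simp
    also have "\<dots> \<le> C_holder * (\<bar>\<tau>\<bar> + b) powr (1 / s)"
      using \<tau>0 pw C_holder_pos by (intro mult_left_mono powr_mono2) auto
    finally show "\<bar>zoom t (w0 p) \<tau> i\<bar> \<le> C_holder * (\<bar>\<tau>\<bar> + b) powr (1 / s)" .
  qed
  obtain r \<gamma> where r: "strict_mono (r :: nat \<Rightarrow> nat)"
    and unif: "\<And>\<rho> e i. 0 < e \<Longrightarrow> eventually (\<lambda>p. \<forall>\<tau>. \<bar>\<tau>\<bar> \<le> \<rho> \<longrightarrow> \<bar>zoom t (w0 (r p)) \<tau> i - \<gamma> \<tau> i\<bar> \<le> e) sequentially"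
    and lim: "\<And>\<tau> i. (\<lambda>p. zoom t (w0 (r p)) \<tau> i) \<longlonglongrightarrow> \<gamma> \<tau> i"
    by (rule equicontinuous_subsequence[OF pw, of "\<lambda>p. zoom t (w0 p)" C_holder, OF zoom_holder bd]) blast
  define w where "w = w0 \<circ> r"
  have w: "strict_mono w" "\<And>p. n (w p) = \<nu>" "\<And>p. hit t (w p)"
    using w0 r by (auto simp: w_def strict_mono_o)
  have unif: "\<And>\<rho> e i. 0 < e \<Longrightarrow> eventually (\<lambda>p. \<forall>\<tau>. \<bar>\<tau>\<bar> \<le> \<rho> \<longrightarrow> \<bar>zoom t (w p) \<tau> i - \<gamma> \<tau> i\<bar> \<le> e) sequentially"
    and lim: "\<And>\<tau> i. (\<lambda>p. zoom t (w p) \<tau> i) \<longlonglongrightarrow> \<gamma> \<tau> i"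
    using unif lim by (simp_all add: w_def)
  have w_lim: "filterlim w at_top sequentially" by (rule filterlim_subseq[OF w(1)])
  have K_big: "eventually (\<lambda>p. c < K (w p)) sequentially" for c
    using filterlim_compose[OF K_lim w_lim] unfolding filterlim_at_top
    by (auto dest: spec[of _ "Suc c"] simp: Suc_le_eq)
  have K_Suc_big: "eventually (\<lambda>p. c < K (Suc (w p))) sequentially" for c
    using filterlim_compose[OF K_lim filterlim_compose[OF filterlim_Suc w_lim]] unfolding filterlim_at_top
    by (auto dest: spec[of _ "Suc c"] simp: Suc_le_eq)
  have ones_big: "eventually (\<lambda>p. x < real_of_int (ones (K (w p) - 1))) sequentially" for x
    using K_big[of "nat \<lceil>x\<rceil> + 1"]
  proof eventually_elim
    case (elim p)
    then have "nat \<lceil>x\<rceil> < K (w p) - 1" by simp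
    then show ?case using ones_ge[of "K (w p) - 1"] by linarith
  qed
  have gam_RN: "\<gamma> \<tau> \<in> RN N" for \<tau>
  proof -
    have "\<gamma> \<tau> i = 0" if "N \<le> i" for i
      using lim[of \<tau> i] that by (simp add: zoom_def g_def LIMSEQ_const_iff)
    then show ?thesis by (simp add: RN_def)
  qed
  have gam_holder: "\<bar>\<gamma> \<tau> i - \<gamma> \<tau>' i\<bar> \<le> C_holder * \<bar>\<tau> - \<tau>'\<bar> powr (1 / s)" for \<tau> \<tau>' i
  proof (rule LIMSEQ_le_const2)
    show "(\<lambda>p. \<bar>zoom t (w p) \<tau> i - zoom t (w p) \<tau>' i\<bar>) \<longlonglongrightarrow> \<bar>\<gamma> \<tau> i - \<gamma> \<tau>' i\<bar>" by (intro tendsto_intros lim)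
    show "\<exists>P. \<forall>p\<ge>P. \<bar>zoom t (w p) \<tau> i - zoom t (w p) \<tau>' i\<bar> \<le> C_holder * \<bar>\<tau> - \<tau>'\<bar> powr (1 / s)"
      using zoom_holder by blast
  qed
  interpret curve_limit N "\<lambda>p. zoom t (w p)" \<gamma> "\<lambda>p. range_of t (w p)"
  proof
    show "zoom t (w m) \<tau> \<in> RN N" for m \<tau> by (rule zoom_RN)
    show "\<gamma> \<tau> \<in> RN N" for \<tau> by (rule gam_RN)
    show "continuous_map euclideanreal (eucl_top N) \<gamma>"
      by (rule continuous_eucl_of_holder[OF gam_RN pw gam_holder])
    show "continuous_map euclideanreal (eucl_top N) (zoom t (w m))" for m
      by (rule continuous_eucl_of_holder[OF zoom_RN pw zoom_holder])
    show "compact (range_of t (w m))" "range_of t (w m) \<noteq> {}" for m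
      using b_pos by (simp_all add: range_of_def)
    show "eventually (\<lambda>m. \<forall>\<tau>. \<bar>\<tau>\<bar> \<le> \<rho> \<longrightarrow> eucl_dist N (zoom t (w m) \<tau>) (\<gamma> \<tau>) \<le> e) sequentially"
      if "0 < e" for \<rho> e
    proof -
      have e': "0 < e / (N + 1)" using that by simp
      have "eventually (\<lambda>m. \<forall>i\<in>{..<N}. \<forall>\<tau>. \<bar>\<tau>\<bar> \<le> \<rho> \<longrightarrow> \<bar>zoom t (w m) \<tau> i - \<gamma> \<tau> i\<bar> \<le> e / (N + 1)) sequentially"
        by (intro eventually_ball_finite ballI unif e') auto
      then show ?thesis
      proof eventually_elim
        case (elim m)
        show ?case
        proof (intro allI impI)
          fix \<tau> assume "\<bar>\<tau>\<bar> \<le> \<rho>"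
          then have "eucl_dist N (zoom t (w m) \<tau>) (\<gamma> \<tau>) \<le> N * (e / (N + 1))"
            using elim by (intro eucl_dist_le_bound) auto
          also have "\<dots> \<le> e" using that by (simp add: divide_simps algebra_simps)
          finally show "eucl_dist N (zoom t (w m) \<tau>) (\<gamma> \<tau>) \<le> e" .
        qed
      qed
    qed
    show "\<exists>\<rho>. eventually (\<lambda>m. \<forall>\<tau>\<in>range_of t (w m). eucl_dist N (\<lambda>i. 0) (zoom t (w m) \<tau>) \<le> R \<longrightarrow> \<bar>\<tau>\<bar> \<le> \<rho>) sequentially" for R
    proof -
      \<comment> \<open>\<open>h0\<close> makes the escape distance exceed \<open>R\<close>; one
        more level is added because \<open>zoom_far\<close> requires
        \<open>1 \<le> h\<close>.\<close>
      obtain h0 where h0: "4 * R < (1 / lam) ^ h0" using real_arch_pow[of "1 / lam" "4 * R"] lam_pos lam_less by auto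
      define h where "h = Suc h0"
      have "(1 / lam) ^ h0 \<le> (1 / lam) ^ h" unfolding h_def
        using lam_pos lam_less by (intro power_increasing) (auto simp: divide_simps)
      then have h: "R < (1 / lam) ^ h / 4" "1 \<le> h" using h0 by (auto simp: h_def)
      show ?thesis
      proof (intro exI[of _ "2 * real_of_int b ^ h + b"])
        show "eventually (\<lambda>m. \<forall>\<tau>\<in>range_of t (w m). eucl_dist N (\<lambda>i. 0) (zoom t (w m) \<tau>) \<le> R \<longrightarrow>
            \<bar>\<tau>\<bar> \<le> 2 * real_of_int b ^ h + b) sequentially"
          using K_big[of h]
        proof eventually_elim
          case (elim m)
          show ?case using zoom_far[OF w(3) t h(2) elim] h(1) by (meson dual_order.strict_trans1 not_le)
        qed
      qed
    qed
    show "eventually (\<lambda>m. {-\<rho>..\<rho>} \<subseteq> range_of t (w m)) sequentially" for \<rho>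
      using ones_big[of \<rho>]
    proof eventually_elim
      case (elim m)
      let ?o = "ones (K (w m))" and ?q = "pos t (w m)"
      have "ones (K (w m) - 1) \<le> ?o" using b_pos by (subst (2) K_eq) (simp add: ones_def)
      then have \<rho>: "\<rho> < real_of_int ?o" using elim by linarith
      have "0 \<le> ?o" using ones_ge[of "K (w m)"] by simp
      then have "?o \<le> b * ?o" using b_ge by (simp add: mult_le_cancel_right1)
      moreover have "b * ?o \<le> b * ?q" "b * (?q + ?o) \<le> b * b ^ st (Suc (w m))"
        using pos_bounds[OF w(3) t] b_pos by simp_all
      ultimately have "?o \<le> b * ?q" "?o \<le> b ^ lev (w m) - b * ?q" by (auto simp: lev_def distrib_left)
      then have "real_of_int ?o \<le> real_of_int (b * ?q)" "real_of_int ?o \<le> real_of_int (b ^ lev (w m) - b * ?q)"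
        by (simp_all only: of_int_le_iff)
      then show ?case using \<rho> by (auto simp: range_of_def)
    qed
  qed
  \<comment> \<open>The starts of the loops in zoom parameters: vertices with digit 2 of the parents
    \<open>pos t w + l\<close>.\<close>
  define A where "A = (\<lambda>l. real_of_int b * real l + 2) ` {..<\<nu>}"
  have sep: "1 < \<bar>a - a'\<bar>" if aa: "a \<in> A" "a' \<in> A" "a \<noteq> a'" for a a'
  proof -
    obtain l l' where l: "a = real_of_int b * real l + 2" "a' = real_of_int b * real l' + 2" using aa by (auto simp: A_def)
    then have "l \<noteq> l'" using aa by auto
    then have "1 \<le> \<bar>real l - real l'\<bar>" by linarith
    then have "real_of_int b * 1 \<le> real_of_int b * \<bar>real l - real l'\<bar>" using b_pos by (intro mult_left_mono) auto
    also have "\<dots> = \<bar>a - a'\<bar>" using b_pos by (simp add: l right_diff_distrib[symmetric] abs_mult)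
    finally show ?thesis using b_real by linarith
  qed
  have loop: "\<gamma> a = \<gamma> (a + 1)" if a: "a \<in> A" for a
  proof
    fix i
    obtain l where l: "a = real_of_int b * real l + 2" "l < \<nu>" using a by (auto simp: A_def)
    have "eventually (\<lambda>p. zoom t (w p) (a + 1) i = zoom t (w p) a i) sequentially"
      using ones_big[of "real l"]
    proof eventually_elim
      case (elim p)
      then have "int l \<le> ones (K (w p) - 1)" by linarith
      then show ?case using zoom_loop[OF w(3), of l] l w(2) by (simp add: add.assoc)
    qed
    then have "(\<lambda>p. zoom t (w p) a i) \<longlonglongrightarrow> \<gamma> (a + 1) i" by (rule Lim_transform_eventually[OF lim])
    then show "\<gamma> a i = \<gamma> (a + 1) i" using lim LIMSEQ_unique by blast
  qed
  have inj: "\<tau> \<in> A \<and> \<tau>' = \<tau> + 1" if eq: "\<gamma> \<tau> = \<gamma> \<tau>'" and less: "\<tau> < \<tau>'" for \<tau> \<tau>'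
  proof (rule ccontr)
    assume na: "\<not> (\<tau> \<in> A \<and> \<tau>' = \<tau> + 1)"
    \<comment> \<open>The level \<open>h\<close> is fixed first, depending only on the pair of
      parameters and on \<nu>: fine enough to resolve their distance and their deviation from the
      ends of each loop. Only then does the window tend to infinity.\<close>
    have b_inv: "(\<lambda>h. c / real_of_int b ^ h) \<longlonglongrightarrow> 0" for c
      using tendsto_mult[OF tendsto_const[of c] LIMSEQ_realpow_zero[of "1 / real_of_int b"]] b_real
      by (simp add: power_one_over)
    have "eventually (\<lambda>h. 2 / real_of_int b ^ h < \<tau>' - \<tau>) sequentially"
      using b_inv[of 2] less by (intro order_tendstoD(2)) auto
    moreover have "eventually (\<lambda>h. \<forall>l\<in>{..<\<nu>}. \<not> (\<bar>\<tau> - (real_of_int b * l + 2)\<bar> \<le> 1 / real_of_int b ^ h \<and>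
        \<bar>\<tau>' - (real_of_int b * l + 3)\<bar> \<le> 1 / real_of_int b ^ h)) sequentially"
    proof (intro eventually_ball_finite ballI)
      fix l assume l: "l \<in> {..<\<nu>}"
      define m where "m = max \<bar>\<tau> - (real_of_int b * l + 2)\<bar> \<bar>\<tau>' - (real_of_int b * l + 3)\<bar>"
      have "0 < m"
      proof (rule ccontr)
        assume "\<not> 0 < m"
        then have "\<tau> = real_of_int b * l + 2" "\<tau>' = \<tau> + 1" by (auto simp: m_def max_def split: if_splits)
        then show False using na l by (auto simp: A_def)
      qed
      then have "eventually (\<lambda>h. 1 / real_of_int b ^ h < m) sequentially"
        using b_inv[of 1] by (intro order_tendstoD(2)) auto
      then show "eventually (\<lambda>h. \<not> (\<bar>\<tau> - (real_of_int b * l + 2)\<bar> \<le> 1 / real_of_int b ^ h \<and>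
        \<bar>\<tau>' - (real_of_int b * l + 3)\<bar> \<le> 1 / real_of_int b ^ h)) sequentially"
        by eventually_elim (auto simp: m_def)
    qed simp
    ultimately have "eventually (\<lambda>h. 2 / real_of_int b ^ h < \<tau>' - \<tau> \<and>
      (\<forall>l\<in>{..<\<nu>}. \<not> (\<bar>\<tau> - (real_of_int b * l + 2)\<bar> \<le> 1 / real_of_int b ^ h \<and>
        \<bar>\<tau>' - (real_of_int b * l + 3)\<bar> \<le> 1 / real_of_int b ^ h))) sequentially"
      by (rule eventually_conj)
    then obtain h where h: "2 / real_of_int b ^ h < \<tau>' - \<tau>"
      "\<And>l. l < \<nu> \<Longrightarrow> \<not> (\<bar>\<tau> - (real_of_int b * l + 2)\<bar> \<le> 1 / real_of_int b ^ h \<and>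
        \<bar>\<tau>' - (real_of_int b * l + 3)\<bar> \<le> 1 / real_of_int b ^ h)"
      using eventually_happens'[OF sequentially_bot] by fastforce
    have "eventually (\<lambda>p. \<forall>i\<in>{..<N}. \<bar>zoom t (w p) \<tau> i - zoom t (w p) \<tau>' i\<bar> < lam ^ h / 4) sequentially"
    proof (intro eventually_ball_finite ballI)
      fix i
      have "(\<lambda>p. \<bar>zoom t (w p) \<tau> i - zoom t (w p) \<tau>' i\<bar>) \<longlonglongrightarrow> \<bar>\<gamma> \<tau> i - \<gamma> \<tau>' i\<bar>" by (intro tendsto_intros lim)
      then show "eventually (\<lambda>p. \<bar>zoom t (w p) \<tau> i - zoom t (w p) \<tau>' i\<bar> < lam ^ h / 4) sequentially"
        by (rule order_tendstoD(2)) (use eq lam_pos in simp)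
    qed simp
    then have "eventually (\<lambda>p. False) sequentially"
      using ones_big[of "max \<bar>\<tau>\<bar> \<bar>\<tau>'\<bar> + 1"] K_Suc_big[of h]
    proof eventually_elim
      case (elim p)
      have "ones (K (w p) - 1) \<le> b * ones (K (w p) - 1)"
        using ones_ge[of "K (w p) - 1"] b_ge by (simp add: mult_le_cancel_right1)
      then have "real_of_int (ones (K (w p) - 1)) \<le> real_of_int (b * ones (K (w p) - 1))" by (simp only: of_int_le_iff)
      then have bds: "\<bar>\<tau>\<bar> + 1 < real_of_int (b * ones (K (w p) - 1))" "\<bar>\<tau>'\<bar> + 1 < real_of_int (b * ones (K (w p) - 1))"
        using elim(2) by linarith+
      have "\<exists>i<N. lam ^ h / 4 \<le> \<bar>zoom t (w p) \<tau> i - zoom t (w p) \<tau>' i\<bar>"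
        by (rule zoom_separated[OF w(3) t elim(3) h(1) bds]) (use h(2) w(2) in auto)
      then show ?case using elim(1) by force
    qed
    then show False by simp
  qed
  have fib: "\<gamma> \<tau> = \<gamma> \<tau>' \<longleftrightarrow> \<tau> = \<tau>' \<or> \<tau> \<in> A \<and> \<tau>' = \<tau> + 1 \<or> \<tau>' \<in> A \<and> \<tau> = \<tau>' + 1" for \<tau> \<tau>'
    using loop inj[of \<tau> \<tau>'] inj[of \<tau>' \<tau>] by (metis linorder_less_linear)
  have "triple_points T = \<gamma> ` A" by (rule triple_points_curve[OF sep fib])
  moreover have "inj_on \<gamma> A"
  proof (rule inj_onI)
    fix a a' assume a: "a \<in> A" "a' \<in> A" "\<gamma> a = \<gamma> a'"
    then have "a = a' \<or> \<bar>a - a'\<bar> = 1" using fib[of a a'] by auto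
    then show "a = a'" using sep[OF a(1,2)] by linarith
  qed
  moreover have "card A = \<nu>" unfolding A_def using b_nz by (subst card_image) (auto simp: inj_on_def)
  ultimately have "card (triple_points T) = \<nu>" by (simp add: card_image)
  moreover have "range \<gamma> \<in> Tan N (g ` {0..1}) (g t)"
    unfolding Tan_def mem_Collect_eq
  proof (intro conjI exI[of _ "\<lambda>p. lam ^ lev (w p)"] allI)
    show "closedin (eucl_top N) (range \<gamma>)" using closed_image[of UNIV] by simp
    show "(\<lambda>i. 0) \<in> range \<gamma>"
    proof (rule limit_point)
      show "\<exists>\<tau>. \<bar>\<tau>\<bar> \<le> real_of_int b \<and> zoom t (w p) \<tau> = (\<lambda>i. 0)" for p
        using zoom_base[of t "w p"] by (metis abs_of_nonneg)
    qed (simp add: RN_def)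
    show "0 < lam ^ lev (w p)" for p using lam_pos by simp
    have lev_mono: "strict_mono (\<lambda>p. lev (w p))"
      using w(1) strict_mono_less[OF st_strict] by (auto simp: strict_mono_def lev_def)
    show "decseq (\<lambda>p. lam ^ lev (w p))"
      unfolding decseq_def using lev_mono lam_pos lam_less
      by (auto intro!: power_decreasing simp: strict_mono_less_eq[OF lev_mono])
    show "(\<lambda>p. lam ^ lev (w p)) \<longlonglongrightarrow> 0"
      by (rule filterlim_compose[OF LIMSEQ_realpow_zero filterlim_subseq[OF lev_mono]]) (use lam_pos lam_less in auto)
    show "AW_converges N (\<lambda>m. blowup (g ` {0..1}) (g t) (lam ^ lev (w m))) (range \<gamma>)"
      unfolding zoom_blowup by (rule AW_limit)
  qed
  ultimately show ?thesis by blast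
qed

lemma typical_infinite_tangents:
  assumes "typical t" "t \<in> {0..1}"
  shows "\<exists>F \<subseteq> Tan N (g ` {0..1}) (g t). infinite F \<and> (\<forall>T1\<in>F. \<forall>T2\<in>F. T1 \<noteq> T2 \<longrightarrow>
    \<not> (subtopology (eucl_top N) T1 homeomorphic_space subtopology (eucl_top N) T2))"
proof -
  define c where "c T = card (triple_points (subtopology (eucl_top N) T))" for T
  have "\<forall>\<nu>. \<exists>T. T \<in> Tan N (g ` {0..1}) (g t) \<and> c T = \<nu>"
    using typical_tangent[OF assms] unfolding c_def by blast
  then obtain T where T: "\<And>\<nu>. T \<nu> \<in> Tan N (g ` {0..1}) (g t)" "\<And>\<nu>. c (T \<nu>) = \<nu>" by metis
  have "inj T" by (rule inj_on_inverseI[of _ c]) (simp add: T)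
  then have "infinite (range T)" by (simp add: range_inj_infinite)
  moreover have "\<not> (subtopology (eucl_top N) T1 homeomorphic_space subtopology (eucl_top N) T2)"
    if "T1 \<in> range T" "T2 \<in> range T" "T1 \<noteq> T2" for T1 T2
  proof
    assume "subtopology (eucl_top N) T1 homeomorphic_space subtopology (eucl_top N) T2"
    then have "c T1 = c T2" unfolding c_def by (rule homeomorphic_space_card_triple_points)
    then show False using that T(2) by auto
  qed
  ultimately show ?thesis using T(1) by (intro exI[of _ "range T"]) auto
qed

end

subsection \<open>Choice of the parameters\<close>

text \<open>Adding \<open>b\<close> inside the logarithm makes even the first window have length at
  least 1.\<close>

lemma window_lengths:
  fixes b :: int
  assumes "2 \<le> b"
  obtains K :: "nat \<Rightarrow> nat" where "\<And>w. 1 \<le> K w" "filterlim K at_top sequentially"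
    "\<And>w. real_of_int b ^ K w \<le> w + b"
proof -
  define K where "K w = nat \<lfloor>log b (real w + b)\<rfloor>" for w
  have b1: "1 < real_of_int b" using assms by simp
  have le: "1 \<le> log b (real w + b)" for w
    using b1 by (simp add: le_log_iff)
  show thesis
  proof (rule that[of K])
    show "1 \<le> K w" for w using le[of w] unfolding K_def by linarith
    have "filterlim (\<lambda>w. real w + b) at_top sequentially"
      using filterlim_tendsto_add_at_top[OF tendsto_const[of "real_of_int b"] filterlim_real_sequentially]
      by (simp add: add.commute)
    then have "filterlim (\<lambda>w. ln (real w + b)) at_top sequentially" by (rule filterlim_compose[OF ln_at_top])
    then have "filterlim (\<lambda>w. ln (real w + b) * (1 / ln b)) at_top sequentially"
      using b1 by (intro filterlim_at_top_mult_tendsto_pos[OF tendsto_const]) auto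
    then have "filterlim (\<lambda>w. log b (real w + b)) at_top sequentially" by (simp add: log_def)
    then have ev: "eventually (\<lambda>w. real Z \<le> log b (real w + b)) sequentially" for Z :: nat
      by (simp add: filterlim_at_top)
    show "filterlim K at_top sequentially"
      unfolding filterlim_at_top
    proof
      fix Z show "eventually (\<lambda>w. Z \<le> K w) sequentially"
        using ev[of Z] by eventually_elim (simp add: K_def le_nat_floor le_floor_iff nat_le_iff; linarith)
    qed
    show "real_of_int b ^ K w \<le> w + b" for w
    proof -
      have "real (K w) \<le> log b (real w + b)" using le[of w] unfolding K_def by linarith
      then have "real_of_int b powr real (K w) \<le> real w + b" using b1 by (simp add: le_log_iff)
      then show ?thesis using b1 by (simp add: powr_realpow)
    qed
  qed
qed

lemma window_weights_diverge:
  fixes b :: int and K :: "nat \<Rightarrow> nat"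
  assumes "2 \<le> b" and K: "\<And>w. real_of_int b ^ K w \<le> w + b"
  shows "\<not> summable (\<lambda>w. if multiplicity 2 (Suc w) = \<nu> then 1 / real_of_int b ^ K w else 0)"
proof
  let ?f = "\<lambda>w. if multiplicity 2 (Suc w) = \<nu> then 1 / real_of_int b ^ K w else 0"
  assume sm: "summable ?f"
  \<comment> \<open>Enumerates the windows for which \<open>w + 1\<close> has 2-adic valuation
    exactly \<nu>.\<close>
  define \<omega> :: "nat \<Rightarrow> nat" where "\<omega> i = 2 ^ \<nu> * (2 * i + 1) - 1" for i
  have \<omega>: "Suc (\<omega> i) = 2 ^ \<nu> * (2 * i + 1)" for i by (simp add: \<omega>_def)
  have "inj \<omega>"
  proof (rule injI)
    fix i j assume "\<omega> i = \<omega> j"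
    then have "2 ^ \<nu> * (2 * i + 1) = (2 ^ \<nu> * (2 * j + 1) :: nat)" using \<omega> by metis
    then show "i = j" by simp
  qed
  then have sm2: "summable (?f \<circ> \<omega>)" by (rule summable_reindex[OF sm]) (use assms in auto)
  have mult: "multiplicity 2 (Suc (\<omega> i)) = \<nu>" for i
  proof -
    have "\<not> 2 ^ \<nu> * 2 dvd (2 ^ \<nu> * (2 * i + 1) :: nat)" by (subst dvd_times_left_cancel_iff) auto
    then show ?thesis unfolding \<omega> by (intro multiplicity_eqI) (simp_all only: power_Suc2 dvd_triv_left not_False_eq_True)
  qed
  define c where "c = 1 / (2 ^ Suc \<nu> + real_of_int b)"
  have den: "0 < 2 ^ Suc \<nu> + real_of_int b" using assms by (simp add: add_pos_pos)
  have "summable (\<lambda>i. c * (1 / real (Suc i)))"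
  proof (rule summable_comparison_test'[OF sm2, of 0])
    fix i :: nat
    have "real_of_int b ^ K (\<omega> i) \<le> \<omega> i + b" by (rule K)
    also have "\<dots> \<le> 2 ^ \<nu> * (2 * real i + 1) + b"
    proof -
      have "real (Suc (\<omega> i)) = 2 ^ \<nu> * (2 * real i + 1)" unfolding \<omega> by (simp add: distrib_left)
      then show ?thesis by simp
    qed
    also have "\<dots> \<le> (2 ^ Suc \<nu> + b) * real (Suc i)" using assms by (simp add: algebra_simps)
    finally have "1 / ((2 ^ Suc \<nu> + b) * real (Suc i)) \<le> 1 / real_of_int b ^ K (\<omega> i)"
      using assms den by (intro divide_left_mono) auto
    then show "norm (c * (1 / real (Suc i))) \<le> (?f \<circ> \<omega>) i" using den by (simp add: c_def mult)
  qed
  then have "summable (\<lambda>i. 1 / c * (c * (1 / real (Suc i))))" by (rule summable_mult)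
  moreover have "1 / c * (c * (1 / real (Suc i))) = inverse (real (Suc i))" for i
    using den by (simp add: c_def inverse_eq_divide)
  ultimately have "summable (\<lambda>i. inverse (real (Suc i)))" by (simp only:)
  then show False using not_summable_harmonic[where 'a = real] summable_Suc_iff[of "\<lambda>i. inverse (real i)"] by simp
qed

text \<open>\<open>s / (s - 1)\<close> is the reciprocal of \<open>1 - 1 / s\<close>, which is
  positive as \<open>1 < s\<close>. Hence the choice of \<open>b\<close> gives
  \<open>lam * b = b powr (1 - 1 / s) \<ge> 4\<close>, and replacing \<open>b\<close> by
  \<open>b - 1\<close> costs at most a factor of 2.\<close>

lemma snowflake_parameters:
  fixes s :: real
  assumes "1 < s"
  obtains b :: int and lam :: real and M :: nat
  where "17 \<le> b" "0 < lam" "lam < 1" "2 \<le> lam * (b - 1)" "2 \<le> M" "32 * (b - 1) \<le> 2 ^ M"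
    "3 / (1 - lam) * lam ^ (M - 1) \<le> 1 / 16" "lam powr s = 1 / b"
proof -
  define b where "b = max 17 \<lceil>4 powr (s / (s - 1))\<rceil>"
  define lam where "lam = real_of_int b powr (- (1 / s))"
  have b17: "17 \<le> b" by (simp add: b_def)
  have b: "17 \<le> real_of_int b" using b17 by linarith
  have b4: "4 powr (s / (s - 1)) \<le> real_of_int b" unfolding b_def by linarith
  have lam: "0 < lam" "lam < 1" using b assms by (auto simp: lam_def powr_less_one)
  have e: "(s / (s - 1)) * (1 - 1 / s) = 1" using assms by (simp add: field_simps)
  have "4 = (4 powr (s / (s - 1))) powr (1 - 1 / s)" unfolding powr_powr e by simp
  also have "\<dots> \<le> real_of_int b powr (1 - 1 / s)" using b4 assms by (intro powr_mono2) auto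
  also have "\<dots> = lam * b" using b by (simp add: lam_def powr_diff powr_minus_divide)
  finally have "4 \<le> lam * b" .
  moreover have "lam * b \<le> lam * (2 * (real_of_int b - 1))" using lam b by (intro mult_left_mono) auto
  moreover have "lam * (2 * (real_of_int b - 1)) = 2 * (lam * (real_of_int b - 1))" by simp
  ultimately have lb: "2 \<le> lam * (real_of_int b - 1)" by linarith
  have lams: "lam powr s = 1 / b" unfolding lam_def powr_powr using assms b by (simp add: powr_minus_divide)
  have "(\<lambda>M. 3 / (1 - lam) * lam ^ (M - 1)) \<longlonglongrightarrow> 3 / (1 - lam) * 0"
    by (intro tendsto_mult tendsto_const filterlim_compose[OF LIMSEQ_realpow_zero filterlim_minus_const_nat_at_top])
       (use lam in auto)
  then have "eventually (\<lambda>M. 3 / (1 - lam) * lam ^ (M - 1) < 1 / 16) sequentially"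
    by (rule order_tendstoD(2)) simp
  moreover have "eventually (\<lambda>M. 2 \<le> M \<and> nat (32 * (b - 1)) \<le> M) sequentially"
    by (intro eventually_conj eventually_ge_at_top)
  ultimately have "eventually (\<lambda>M. 3 / (1 - lam) * lam ^ (M - 1) < 1 / 16 \<and> 2 \<le> M \<and> nat (32 * (b - 1)) \<le> M) sequentially"
    by (rule eventually_conj)
  then obtain M where M: "3 / (1 - lam) * lam ^ (M - 1) < 1 / 16" "2 \<le> M" "nat (32 * (b - 1)) \<le> M"
    using eventually_happens'[OF sequentially_bot] by blast
  have "32 * (b - 1) \<le> int M" using M(3) by linarith
  also have "int M \<le> 2 ^ M" using less_exp[of M] by (metis less_imp_le of_nat_le_iff of_nat_numeral of_nat_power)
  finally have Mp: "32 * (b - 1) \<le> 2 ^ M" .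
  show thesis by (rule that[OF b17 lam _ M(2) Mp _ lams]) (use lb M(1) in auto)
qed

theorem theorem1p2:
  fixes s :: real
  assumes "s > 1"
  shows "\<exists>(N::nat) (g :: real \<Rightarrow> (nat \<Rightarrow> real)).
     g ` {0..1} \<subseteq> RN N \<and>
     (\<exists>C. \<forall>t\<in>{0..1}. \<forall>u\<in>{0..1}. eucl_dist N (g t) (g u) \<le> C * \<bar>t - u\<bar> powr (1 / s)) \<and>
     hausdorff N s (g ` {0..1}) > 0 \<and>
     hausdorff N s {x \<in> g ` {0..1}.
        \<not> (\<exists>F \<subseteq> Tan N (g ` {0..1}) x. infinite F \<and>
              (\<forall>T1\<in>F. \<forall>T2\<in>F. T1 \<noteq> T2 \<longrightarrow>
                 \<not> (subtopology (eucl_top N) T1 homeomorphic_space subtopology (eucl_top N) T2)))} = 0"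
proof -
  obtain b :: int and lam :: real and M :: nat where
    par: "17 \<le> b" "0 < lam" "lam < 1" "2 \<le> lam * (b - 1)" "2 \<le> M" "32 * (b - 1) \<le> 2 ^ M"
    "3 / (1 - lam) * lam ^ (M - 1) \<le> 1 / 16" "lam powr s = 1 / b"
    using snowflake_parameters[OF assms] by blast
  obtain K :: "nat \<Rightarrow> nat" where K: "\<And>w. 1 \<le> K w" "filterlim K at_top sequentially"
    "\<And>w. real_of_int b ^ K w \<le> w + b"
    using window_lengths[of b] par(1) by auto
  define n :: "nat \<Rightarrow> nat" where "n w = multiplicity 2 (Suc w)" for w
  define L where "L l q \<longleftrightarrow> (\<exists>w. l = (\<Sum>i<Suc w. K i) \<and>
       (\<Sum>i<K w. b ^ i) \<le> q mod b ^ K w \<and> q mod b ^ K w < (\<Sum>i<K w. b ^ i) + n w)" for l q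
  \<comment> \<open>The dimension is the number of coordinates, so these must be available before
    \<open>dec\<close> and the windows can be set up.\<close>
  interpret loop_curve b L lam M by unfold_locales (use par in auto)
  obtain dec where dec: "bij_betw dec {..<card coords} coords"
    using ex_bij_betw_nat_finite[OF finite_coords] atLeast0LessThan by metis
  interpret window_curve b L lam M s K n "card coords" dec
  proof
    show "\<not> summable (\<lambda>w. if n w = \<nu> then 1 / real_of_int b ^ K w else 0)" for \<nu>
      unfolding n_def by (rule window_weights_diverge) (use par K in auto)
  qed (use par K assms dec L_def in auto)
  let ?N = "card coords"
  show ?thesis
  proof (intro exI[of _ ?N] exI[of _ g] conjI)
    show "g ` {0..1} \<subseteq> RN ?N" using g_RN by blast
    show "\<exists>C. \<forall>t\<in>{0..1}. \<forall>u\<in>{0..1}. eucl_dist ?N (g t) (g u) \<le> C * \<bar>t - u\<bar> powr (1 / s)"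
    proof (intro exI[of _ "?N * C_holder"] ballI)
      fix t u
      have "eucl_dist ?N (g t) (g u) \<le> ?N * (C_holder * \<bar>t - u\<bar> powr (1 / s))"
        by (rule eucl_dist_le_bound) (rule g_holder)
      then show "eucl_dist ?N (g t) (g u) \<le> ?N * C_holder * \<bar>t - u\<bar> powr (1 / s)" by (simp add: mult.assoc)
    qed
    show "hausdorff ?N s (g ` {0..1}) > 0" by (rule g_image_pos)
    \<comment> \<open>A point with at least one typical parameter has the required tangents, so the
      exceptional set lies in the image of the atypical parameters.\<close>
    show "hausdorff ?N s {x \<in> g ` {0..1}. \<not> (\<exists>F \<subseteq> Tan ?N (g ` {0..1}) x. infinite F \<and>
              (\<forall>T1\<in>F. \<forall>T2\<in>F. T1 \<noteq> T2 \<longrightarrow>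
                 \<not> (subtopology (eucl_top ?N) T1 homeomorphic_space subtopology (eucl_top ?N) T2)))} = 0"
      by (rule hausdorff_null_mono[OF _ hausdorff_atypical]) (use typical_infinite_tangents in blast)
  qed
qed

end
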